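(* Let $E$ be a complex Hilbert space and let $\varphi: E\to E$ be a mapping. Then the composition operator $C_{\varphi}$ is compact on $\mathcal{H}(E)$ if and only if there is a compact linear operator $A$ on $E$ with $\|A\|<1$ and a vector $b\in E$ such that $\varphi(z)=Az+b$ for all $z\in E$.
   Context: Inner products are linear in the first variable. $E$ is an arbitrary complex Hilbert space (of any dimension). $\mathcal{H}(E)$ denotes the Segal-Bargmann (Fock) space over $E$: the reproducing kernel Hilbert space of functions on $E$ with kernel $K(z,w)=\exp(\langle z,w\rangle)$, $z,w\in E$. Concretely, let $E^{0}=\mathbb{C}$, let $E^{m}$ ($m\ge 1$) be the closed subspace of symmetric tensors in the Hilbert space tensor product $E^{\otimes m}$, and write $z^{m}=z\otimes\cdots\otimes z\in E^{m}$ ($z^0=1$); then $\mathcal{H}(E)$ consists of the functions $f(z)=\sum_{j=0}^{\infty}\langle z^{j},a_j\rangle$ with $a_j\in E^{j}$ and $\|f\|^2=\sum_{j=0}^\infty j!\,\|a_j\|^2<\infty$. No regularity is assumed on the mapping $\varphi$. The composition operator $C_\varphi$ is defined by $C_\varphi h=h\circ\varphi$ for all $h\in\mathcal{H}(E)$ for which $h\circ\varphi\in\mathcal{H}(E)$; that $C_\varphi$ is compact on $\mathcal{H}(E)$ means that $h\circ\varphi\in\mathcal{H}(E)$ for every $h\in\mathcal{H}(E)$ and that $C_\varphi:\mathcal{H}(E)\to\mathcal{H}(E)$ is a compact linear operator. *)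

theory Defs
  imports "HOL-Analysis.Analysis"
begin

section \<open>Complex Hilbert spaces and compact operators on them\<close>

class chilbert_space = banach +
  fixes scaleC :: "complex \<Rightarrow> 'a \<Rightarrow> 'a"  (infixr "*\<^sub>C" 75)
    and cinner :: "'a \<Rightarrow> 'a \<Rightarrow> complex"  (infix "\<bullet>\<^sub>C" 70)
  assumes scaleC_add_right: "a *\<^sub>C (x + y) = a *\<^sub>C x + a *\<^sub>C y"
    and scaleC_add_left: "(a + b) *\<^sub>C x = a *\<^sub>C x + b *\<^sub>C x"
    and scaleC_scaleC: "a *\<^sub>C b *\<^sub>C x = (a * b) *\<^sub>C x"
    and scaleR_scaleC: "r *\<^sub>R x = complex_of_real r *\<^sub>C x"
    and cinner_commute: "x \<bullet>\<^sub>C y = cnj (y \<bullet>\<^sub>C x)"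
    and cinner_add_left: "(x + y) \<bullet>\<^sub>C z = x \<bullet>\<^sub>C z + y \<bullet>\<^sub>C z"
    and cinner_scaleC_left: "(a *\<^sub>C x) \<bullet>\<^sub>C y = a * (x \<bullet>\<^sub>C y)"
    and cinner_self: "x \<bullet>\<^sub>C x = complex_of_real ((norm x)\<^sup>2)"

definition clinear :: "('a::chilbert_space \<Rightarrow> 'b::chilbert_space) \<Rightarrow> bool" where
  "clinear A \<longleftrightarrow> (\<forall>x y. A (x + y) = A x + A y) \<and> (\<forall>a x. A (a *\<^sub>C x) = a *\<^sub>C A x)"

definition compact_operator :: "('a::chilbert_space \<Rightarrow> 'b::chilbert_space) \<Rightarrow> bool" where
  "compact_operator A \<longleftrightarrow> clinear A \<and> compact (closure (A ` cball 0 1))"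


section \<open>Hilbert spaces of functions\<close>

text \<open>
  A vector space of functions (a subspace of all complex-valued functions on a type, with the
  pointwise operations) is given by its set of elements, and the inner product only
  matters on that set.
\<close>

definition fun_norm :: "(('x \<Rightarrow> complex) \<Rightarrow> ('x \<Rightarrow> complex) \<Rightarrow> complex) \<Rightarrow> ('x \<Rightarrow> complex) \<Rightarrow> real" where
  "fun_norm ip f = sqrt (Re (ip f f))"

locale inner_function_space =
  fixes H :: "('x \<Rightarrow> complex) set"
    and ip :: "('x \<Rightarrow> complex) \<Rightarrow> ('x \<Rightarrow> complex) \<Rightarrow> complex"
  assumes zero_mem: "(\<lambda>x. 0) \<in> H"
    and add_mem: "f \<in> H \<Longrightarrow> g \<in> H \<Longrightarrow> (\<lambda>x. f x + g x) \<in> H"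
    and scale_mem: "f \<in> H \<Longrightarrow> (\<lambda>x. a * f x) \<in> H"
    and ip_commute: "f \<in> H \<Longrightarrow> g \<in> H \<Longrightarrow> ip f g = cnj (ip g f)"
    and ip_add_left:
      "f \<in> H \<Longrightarrow> g \<in> H \<Longrightarrow> h \<in> H \<Longrightarrow> ip (\<lambda>x. f x + g x) h = ip f h + ip g h"
    and ip_scale_left: "f \<in> H \<Longrightarrow> g \<in> H \<Longrightarrow> ip (\<lambda>x. a * f x) g = a * ip f g"
    and ip_nonneg: "f \<in> H \<Longrightarrow> 0 \<le> Re (ip f f)"
    and ip_definite: "f \<in> H \<Longrightarrow> ip f f = 0 \<Longrightarrow> f = (\<lambda>x. 0)"

text \<open>The reproducing kernel Hilbert space with kernel \<open>K\<close>: the kernel functions are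
  \<open>K\<^sub>w = K(\<cdot>, w)\<close>, and \<open>f(w) = \<langle>f, K\<^sub>w\<rangle>\<close>.\<close>

locale rkhs = inner_function_space H ip
  for H :: "('x \<Rightarrow> complex) set" and ip +
  fixes K :: "'x \<Rightarrow> 'x \<Rightarrow> complex"
  assumes complete:
      "(\<And>n. s n \<in> H) \<Longrightarrow>
        (\<And>e. 0 < e \<Longrightarrow> \<exists>N. \<forall>m\<ge>N. \<forall>n\<ge>N. fun_norm ip (\<lambda>x. s m x - s n x) < e) \<Longrightarrow>
        \<exists>f\<in>H. (\<lambda>n. fun_norm ip (\<lambda>x. s n x - f x)) \<longlonglongrightarrow> 0"
    and kernel_mem: "(\<lambda>z. K z w) \<in> H"
    and reproducing: "f \<in> H \<Longrightarrow> ip f (\<lambda>z. K z w) = f w"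

text \<open>\<open>H\<close> with the inner product \<open>ip\<close> is the Segal-Bargmann space over \<open>'a\<close>. The locale is
  inhabited for every complex Hilbert space \<open>'a\<close>, see \<open>segal_bargmann_exists\<close>; as for every
  reproducing kernel, \<open>H\<close> and the values of \<open>ip\<close> on \<open>H\<close> are unique.\<close>

locale segal_bargmann = rkhs H ip "\<lambda>z w. exp (z \<bullet>\<^sub>C w)"
  for H :: "('a::chilbert_space \<Rightarrow> complex) set" and ip

text \<open>The rule \<open>T\<close> defines a compact linear operator from all of \<open>H\<close> to \<open>H\<close>: the image of every
  sequence in the unit ball has a subsequence that converges in \<open>H\<close>. The values of \<open>T\<close> outside
  \<open>H\<close> are irrelevant.\<close>

definition compact_operator_on ::
  "('x \<Rightarrow> complex) set \<Rightarrow> (('x \<Rightarrow> complex) \<Rightarrow> ('x \<Rightarrow> complex) \<Rightarrow> complex)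
    \<Rightarrow> (('x \<Rightarrow> complex) \<Rightarrow> ('x \<Rightarrow> complex)) \<Rightarrow> bool" where
  "compact_operator_on H ip T \<longleftrightarrow>
    (\<forall>f\<in>H. T f \<in> H) \<and>
    (\<forall>f\<in>H. \<forall>g\<in>H. T (\<lambda>x. f x + g x) = (\<lambda>x. T f x + T g x)) \<and>
    (\<forall>f\<in>H. \<forall>a. T (\<lambda>x. a * f x) = (\<lambda>x. a * T f x)) \<and>
    (\<forall>s :: nat \<Rightarrow> 'x \<Rightarrow> complex. (\<forall>n. s n \<in> H \<and> fun_norm ip (s n) \<le> 1) \<longrightarrow>
      (\<exists>g\<in>H. \<exists>r :: nat \<Rightarrow> nat. strict_mono r \<and>
        (\<lambda>n. fun_norm ip (\<lambda>x. T (s (r n)) x - g x)) \<longlonglongrightarrow> 0))"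

definition composition_operator :: "('x \<Rightarrow> 'x) \<Rightarrow> ('x \<Rightarrow> complex) \<Rightarrow> ('x \<Rightarrow> complex)" where
  "composition_operator \<phi> h = h \<circ> \<phi>"


section \<open>Existence of the Segal-Bargmann space\<close>

text \<open>The Moore-Aronszajn theorem: the completion of the span of the kernel functions, realised
  as the pointwise limits of Cauchy sequences of finite combinations. A finite combination
  of kernel functions is a list of coefficient/point pairs.\<close>

locale pd_kernel =
  fixes K :: "'x \<Rightarrow> 'x \<Rightarrow> complex"
  assumes herm: "K z w = cnj (K w z)"
    and psd: "0 \<le> Re (\<Sum>i<n::nat. \<Sum>j<n. c i * cnj (c j) * K (p i) (p j))"
begin

definition B :: "(complex \<times> 'x) list \<Rightarrow> (complex \<times> 'x) list \<Rightarrow> complex" where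
  "B u v = (\<Sum>(c,z)\<leftarrow>u. \<Sum>(d,w)\<leftarrow>v. c * cnj d * K w z)"

definition sc :: "complex \<Rightarrow> (complex \<times> 'x) list \<Rightarrow> (complex \<times> 'x) list" where
  "sc a u = map (\<lambda>(c,z). (a * c, z)) u"

definition sub (infixl "\<ominus>" 65) where "u \<ominus> v = u @ sc (-1) v"

definition nm where "nm u = sqrt (Re (B u u))"

lemma B_nth: "B u v = (\<Sum>i<length u. \<Sum>j<length v.
    fst (u!i) * cnj (fst (v!j)) * K (snd (v!j)) (snd (u!i)))"
  by (simp add: B_def sum_list_sum_nth atLeast0LessThan case_prod_beta)

lemma B_commute: "B u v = cnj (B v u)"
proof -
  have "cnj (B v u) = (\<Sum>i<length v. \<Sum>j<length u.
    fst (u!j) * cnj (fst (v!i)) * K (snd (v!i)) (snd (u!j)))"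
    unfolding B_nth cnj_sum by (intro sum.cong refl) (simp add: herm[symmetric] mult_ac)
  also have "\<dots> = B u v" unfolding B_nth by (rule sum.swap)
  finally show ?thesis by simp
qed

lemma B_app_left [simp]: "B (u @ u') v = B u v + B u' v"
  by (simp add: B_def)

lemma B_sc_left [simp]: "B (sc a u) v = a * B u v"
  by (simp add: B_nth sc_def case_prod_beta sum_distrib_left mult.assoc)

lemma B_app_right [simp]: "B v (u @ u') = B v u + B v u'"
  by (metis B_app_left B_commute complex_cnj_add)

lemma B_sc_right [simp]: "B v (sc a u) = cnj a * B v u"
  by (metis B_sc_left B_commute complex_cnj_mult)

lemma B_self: "B u u = complex_of_real (Re (B u u))"
  using B_commute[of u u] by (simp add: complex_eq_iff)

lemma B_nonneg: "0 \<le> Re (B u u)"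
proof -
  have "B u u = (\<Sum>i<length u. \<Sum>j<length u.
      cnj (fst (u!i)) * cnj (cnj (fst (u!j))) * K (snd (u!i)) (snd (u!j)))"
    unfolding B_nth by (subst sum.swap) (simp add: mult_ac)
  then show ?thesis
    using psd[where c = "\<lambda>i. cnj (fst (u!i))" and p = "\<lambda>i. snd (u!i)" and n = "length u"]
    by simp
qed

lemma nm_nonneg [simp]: "0 \<le> nm u"
  by (simp add: nm_def B_nonneg)

lemma nm_sq: "(nm u)\<^sup>2 = Re (B u u)"
  by (simp add: nm_def B_nonneg)

lemma CS: "cmod (B u v) \<le> nm u * nm v"
proof -
  have exp: "Re (B u u) + 2 * Re (cnj a * B u v) + (cmod a)\<^sup>2 * Re (B v v) \<ge> 0" for a
  proof -
    have "Re (B (u @ sc a v) (u @ sc a v)) =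
        Re (B u u) + Re (cnj a * B u v) + Re (a * B v u) + Re (a * cnj a * B v v)"
      by (simp add: algebra_simps)
    also have "Re (a * B v u) = Re (cnj a * B u v)"
      by (subst B_commute) simp
    also have "Re (a * cnj a * B v v) = (cmod a)\<^sup>2 * Re (B v v)"
      by (subst complex_norm_square[symmetric]) simp
    finally show ?thesis using B_nonneg[of "u @ sc a v"] by simp
  qed
  let ?b = "B u v"
  have cb: "Re (cnj ?b * ?b) = (cmod ?b)\<^sup>2"
    by (metis Re_complex_of_real complex_norm_square mult.commute)
  have e: "Re (B u u) - 2 * t * (cmod ?b)\<^sup>2 + t\<^sup>2 * (cmod ?b)\<^sup>2 * Re (B v v) \<ge> 0" for t :: real
  proof -
    have "Re (cnj (complex_of_real (-t) * ?b) * ?b) = - t * Re (cnj ?b * ?b)"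
      by (simp add: algebra_simps)
    moreover have "(cmod (complex_of_real (-t) * ?b))\<^sup>2 = t\<^sup>2 * (cmod ?b)\<^sup>2"
      by (simp add: norm_mult power_mult_distrib)
    ultimately show ?thesis
      using exp[of "complex_of_real (-t) * ?b"] unfolding cb by simp
  qed
  have "(cmod ?b)\<^sup>2 \<le> Re (B u u) * Re (B v v)"
  proof (cases "Re (B v v) = 0")
    case True
    have "(cmod ?b)\<^sup>2 = 0"
    proof (rule ccontr)
      assume "(cmod ?b)\<^sup>2 \<noteq> 0"
      then show False
        using e[of "(Re (B u u) + 1) / (2 * (cmod ?b)\<^sup>2)"] True by (simp add: field_simps)
    qed
    with True show ?thesis by simp
  next
    case False
    then have "Re (B v v) > 0" using B_nonneg[of v] by linarith
    then show ?thesis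
      using e[of "1 / Re (B v v)"] by (simp add: field_simps power2_eq_square)
  qed
  then have "(cmod ?b)\<^sup>2 \<le> (nm u * nm v)\<^sup>2"
    by (simp add: power_mult_distrib nm_sq)
  then show ?thesis by (meson nm_nonneg mult_nonneg_nonneg power2_le_imp_le)
qed

lemma nm_app: "nm (u @ v) \<le> nm u + nm v"
proof -
  have "(nm (u @ v))\<^sup>2 = (nm u)\<^sup>2 + (nm v)\<^sup>2 + Re (B u v) + Re (B v u)"
    by (simp add: nm_sq)
  also have "Re (B v u) = Re (B u v)" by (subst B_commute) simp
  also have "Re (B u v) \<le> nm u * nm v" using CS[of u v] complex_Re_le_cmod order_trans by blast
  finally have "(nm (u @ v))\<^sup>2 \<le> (nm u + nm v)\<^sup>2"
    by (simp add: power2_sum)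
  then show ?thesis by (meson nm_nonneg add_nonneg_nonneg power2_le_imp_le)
qed

lemma nm_sub_triangle: "nm (u \<ominus> w) \<le> nm (u \<ominus> v) + nm (v \<ominus> w)"
proof -
  have "nm (u \<ominus> w) = nm ((u \<ominus> v) @ (v \<ominus> w))"
    by (simp add: nm_def sub_def)
  then show ?thesis using nm_app[of "u \<ominus> v" "v \<ominus> w"] by simp
qed

lemma nm_sub_commute: "nm (u \<ominus> v) = nm (v \<ominus> u)"
  by (simp add: nm_def sub_def)

lemma nm_sc: "nm (sc a u) = cmod a * nm u"
proof -
  have "B (sc a u) (sc a u) = complex_of_real ((cmod a)\<^sup>2) * B u u"
    by (simp only: complex_norm_square B_sc_left B_sc_right mult_ac)
  then have "Re (B (sc a u) (sc a u)) = (cmod a)\<^sup>2 * Re (B u u)"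
    by (simp only: Re_complex_of_real times_complex.sel Im_complex_of_real)
  then show ?thesis by (simp only: nm_def real_sqrt_mult real_sqrt_abs abs_norm_cancel)
qed

lemma nm_le_sub: "nm u \<le> nm v + nm (u \<ominus> v)"
proof -
  have "nm u = nm (v @ (u \<ominus> v))" by (simp add: nm_def sub_def)
  then show ?thesis using nm_app[of v "u \<ominus> v"] by simp
qed

definition CC where
  "CC X \<longleftrightarrow> (\<forall>e>0. \<exists>N::nat. \<forall>m\<ge>N. \<forall>n\<ge>N. nm (X m \<ominus> X n) < e)"

lemma CC_D: "CC X \<Longrightarrow> 0 < e \<Longrightarrow> \<exists>N. \<forall>m\<ge>N. \<forall>n\<ge>N. nm (X m \<ominus> X n) < e"
  by (simp add: CC_def)

lemma CC_const [simp]: "CC (\<lambda>n. u)"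
  by (auto simp: CC_def nm_def sub_def)

lemma CC_bounded:
  assumes "CC X" obtains M where "M > 0" "\<And>n. nm (X n) \<le> M"
proof -
  obtain N where N: "\<forall>m\<ge>N. \<forall>n\<ge>N. nm (X m \<ominus> X n) < 1"
    using CC_D[OF assms, of 1] by auto
  define M where "M = Max ((\<lambda>n. nm (X n)) ` {..N}) + 1"
  have le: "nm (X n) \<le> M - 1" if "n \<le> N" for n
    unfolding M_def using that by simp
  show thesis
  proof
    show "M > 0" using le[of N] nm_nonneg[of "X N"] by linarith
    show "nm (X n) \<le> M" for n
    proof (cases "n \<le> N")
      case True then show ?thesis using le[of n] by simp
    next
      case False
      then have "nm (X n \<ominus> X N) < 1" using N by auto
      then show ?thesis using nm_le_sub[of "X n" "X N"] le[of N] by simp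
    qed
  qed
qed

lemma CC_app: assumes "CC X" "CC Y" shows "CC (\<lambda>n. X n @ Y n)"
  unfolding CC_def
proof (intro allI impI)
  fix e :: real assume "e > 0"
  then have "e/2 > 0" by simp
  obtain N1 where 1: "\<forall>m\<ge>N1. \<forall>n\<ge>N1. nm (X m \<ominus> X n) < e/2" using CC_D[OF assms(1) \<open>e/2>0\<close>] by auto
  obtain N2 where 2: "\<forall>m\<ge>N2. \<forall>n\<ge>N2. nm (Y m \<ominus> Y n) < e/2" using CC_D[OF assms(2) \<open>e/2>0\<close>] by auto
  have "nm ((X m @ Y m) \<ominus> (X n @ Y n)) < e" if "m \<ge> max N1 N2" "n \<ge> max N1 N2" for m n
  proof -
    have "nm ((X m @ Y m) \<ominus> (X n @ Y n)) = nm ((X m \<ominus> X n) @ (Y m \<ominus> Y n))"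
      by (simp add: nm_def sub_def algebra_simps)
    also have "\<dots> \<le> nm (X m \<ominus> X n) + nm (Y m \<ominus> Y n)" by (rule nm_app)
    finally show ?thesis using 1 2 that by (smt (verit) field_sum_of_halves max.bounded_iff)
  qed
  then show "\<exists>N. \<forall>m\<ge>N. \<forall>n\<ge>N. nm ((X m @ Y m) \<ominus> (X n @ Y n)) < e" by blast
qed

lemma CC_sc: assumes "CC X" shows "CC (\<lambda>n. sc a (X n))"
  unfolding CC_def
proof (intro allI impI)
  fix e :: real assume "e > 0"
  then have "e / (cmod a + 1) > 0" by (simp add: add_nonneg_pos)
  then obtain N where N: "\<forall>m\<ge>N. \<forall>n\<ge>N. nm (X m \<ominus> X n) < e / (cmod a + 1)"
    using CC_D[OF assms] by blast
  have "nm (sc a (X m) \<ominus> sc a (X n)) < e" if "m \<ge> N" "n \<ge> N" for m n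
  proof -
    have "nm (sc a (X m) \<ominus> sc a (X n)) = nm (sc a (X m \<ominus> X n))"
      by (simp add: nm_def sub_def algebra_simps)
    also have "\<dots> = cmod a * nm (X m \<ominus> X n)" by (rule nm_sc)
    also have "\<dots> \<le> (cmod a + 1) * nm (X m \<ominus> X n)" by (simp add: mult_right_mono)
    also have "\<dots> < e"
    proof -
      have "nm (X m \<ominus> X n) < e / (cmod a + 1)" using N that by blast
      moreover have "0 < cmod a + 1" by (simp add: add_nonneg_pos)
      ultimately show ?thesis by (metis pos_less_divide_eq mult.commute)
    qed
    finally show ?thesis .
  qed
  then show "\<exists>N. \<forall>m\<ge>N. \<forall>n\<ge>N. nm (sc a (X m) \<ominus> sc a (X n)) < e" by blast
qed

lemma CC_sub: "CC X \<Longrightarrow> CC Y \<Longrightarrow> CC (\<lambda>n. X n \<ominus> Y n)"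
  unfolding sub_def by (intro CC_app CC_sc)

definition L where "L X Y = lim (\<lambda>n. B (X n) (Y n))"

lemma L_lim: assumes "CC X" "CC Y" shows "(\<lambda>n. B (X n) (Y n)) \<longlonglongrightarrow> L X Y"
proof -
  obtain M1 where M1: "M1 > 0" "\<And>n. nm (X n) \<le> M1" using CC_bounded[OF assms(1)] by blast
  obtain M2 where M2: "M2 > 0" "\<And>n. nm (Y n) \<le> M2" using CC_bounded[OF assms(2)] by blast
  have "Cauchy (\<lambda>n. B (X n) (Y n))"
  proof (rule metric_CauchyI)
    fix e :: real assume "e > 0"
    then have p: "e/2/M2 > 0" "e/2/M1 > 0" using M1(1) M2(1) by auto
    obtain N1 where 1: "\<forall>m\<ge>N1. \<forall>n\<ge>N1. nm (X m \<ominus> X n) < e/2/M2" using CC_D[OF assms(1) p(1)] by auto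
    obtain N2 where 2: "\<forall>m\<ge>N2. \<forall>n\<ge>N2. nm (Y m \<ominus> Y n) < e/2/M1" using CC_D[OF assms(2) p(2)] by auto
    have "dist (B (X m) (Y m)) (B (X n) (Y n)) < e" if "m \<ge> max N1 N2" "n \<ge> max N1 N2" for m n
    proof -
      have "B (X m) (Y m) - B (X n) (Y n) = B (X m \<ominus> X n) (Y m) + B (X n) (Y m \<ominus> Y n)"
        by (simp add: sub_def)
      then have "cmod (B (X m) (Y m) - B (X n) (Y n)) \<le>
          cmod (B (X m \<ominus> X n) (Y m)) + cmod (B (X n) (Y m \<ominus> Y n))"
        by (metis norm_triangle_ineq)
      also have "cmod (B (X m \<ominus> X n) (Y m)) \<le> nm (X m \<ominus> X n) * M2"
        by (rule order_trans[OF CS]) (simp add: mult_left_mono M2)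
      also have "nm (X m \<ominus> X n) * M2 < e/2"
        using 1 that by (intro iffD1[OF pos_less_divide_eq[OF M2(1)]]) auto
      also have "cmod (B (X n) (Y m \<ominus> Y n)) \<le> M1 * nm (Y m \<ominus> Y n)"
        by (rule order_trans[OF CS]) (simp add: mult_right_mono M1)
      also have "M1 * nm (Y m \<ominus> Y n) < e/2"
        unfolding mult.commute[of M1]
        using 2 that by (intro iffD1[OF pos_less_divide_eq[OF M1(1)]]) auto
      finally show ?thesis by (simp add: dist_norm)
    qed
    then show "\<exists>N. \<forall>m\<ge>N. \<forall>n\<ge>N. dist (B (X m) (Y m)) (B (X n) (Y n)) < e" by blast
  qed
  then show ?thesis unfolding L_def by (simp add: Cauchy_convergent_iff convergent_LIMSEQ_iff)
qed

lemma L_app: "CC X \<Longrightarrow> CC Y \<Longrightarrow> CC Z \<Longrightarrow> L (\<lambda>n. X n @ Y n) Z = L X Z + L Y Z"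
  using LIMSEQ_unique[OF L_lim[OF CC_app], of X Y Z] tendsto_add[OF L_lim L_lim, of X Z Y Z]
  by simp

lemma L_sc: "CC X \<Longrightarrow> CC Z \<Longrightarrow> L (\<lambda>n. sc a (X n)) Z = a * L X Z"
  using LIMSEQ_unique[OF L_lim[OF CC_sc], of X Z a] tendsto_mult_left[OF L_lim, of X Z a]
  by simp

lemma L_sub: "CC X \<Longrightarrow> CC Y \<Longrightarrow> CC Z \<Longrightarrow> L (\<lambda>n. X n \<ominus> Y n) Z = L X Z - L Y Z"
  unfolding sub_def by (simp add: L_app L_sc CC_sc)

lemma L_commute: assumes "CC X" "CC Y" shows "L X Y = cnj (L Y X)"
proof (rule LIMSEQ_unique[OF L_lim[OF assms]])
  have "(\<lambda>n. cnj (B (Y n) (X n))) \<longlonglongrightarrow> cnj (L Y X)"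
    by (intro tendsto_cnj L_lim assms)
  then show "(\<lambda>n. B (X n) (Y n)) \<longlonglongrightarrow> cnj (L Y X)" by (simp flip: B_commute)
qed

lemma nm_lim: assumes "CC X" shows "(\<lambda>n. nm (X n)) \<longlonglongrightarrow> sqrt (Re (L X X))"
  unfolding nm_def by (intro tendsto_real_sqrt tendsto_Re L_lim assms)

definition F where "F X z = L X (\<lambda>n. [(1, z)])"

lemma B_combination: "B u v = (\<Sum>(d,w)\<leftarrow>v. cnj d * B u [(1,w)])"
proof (induction v)
  case Nil then show ?case by (simp add: B_nth)
next
  case (Cons p v)
  obtain d w where p: "p = (d,w)" by (cases p)
  have "B u (p # v) = B u (sc d [(1,w)] @ v)" by (simp add: sc_def p)
  then show ?case using Cons unfolding B_app_right B_sc_right by (simp add: p)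
qed

lemma tendsto_sum_list_zero:
  "(\<And>x. x \<in> set xs \<Longrightarrow> (\<lambda>n. f n x) \<longlonglongrightarrow> (0::complex)) \<Longrightarrow> (\<lambda>n. \<Sum>x\<leftarrow>xs. f n x) \<longlonglongrightarrow> 0"
  by (induction xs) (auto intro: tendsto_add_zero)

lemma L_F_zero: assumes X: "CC X" and Y: "CC Y" and F: "\<And>z. F X z = 0" shows "L X Y = 0"
proof -
  obtain M where M: "M > 0" "\<And>n. nm (X n) \<le> M" using CC_bounded[OF X] by blast
  have "(\<lambda>n. B (X n) [(1,w)]) \<longlonglongrightarrow> 0" for w
    using L_lim[OF X CC_const, of "[(1,w)]"] F[of w] by (simp add: F_def)
  then have 0: "(\<lambda>n. B (X n) v) \<longlonglongrightarrow> 0" for v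
    unfolding B_combination[of _ v]
    by (intro tendsto_sum_list_zero) (auto intro!: tendsto_mult_right_zero)
  have "(\<lambda>n. B (X n) (Y n)) \<longlonglongrightarrow> 0"
  proof (rule LIMSEQ_I)
    fix e :: real assume e: "e > 0"
    then have p: "e/2/M > 0" using M by simp
    obtain N where N: "\<forall>m\<ge>N. \<forall>n\<ge>N. nm (Y m \<ominus> Y n) < e/2/M" using CC_D[OF Y p] by auto
    obtain N' where N': "\<forall>n\<ge>N'. cmod (B (X n) (Y N)) < e/2"
      using LIMSEQ_D[OF 0[of "Y N"], of "e/2"] e by auto
    have "cmod (B (X n) (Y n)) < e" if "n \<ge> max N N'" for n
    proof -
      have "B (X n) (Y n) = B (X n) (Y N) + B (X n) (Y n \<ominus> Y N)" by (simp add: sub_def)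
      then have "cmod (B (X n) (Y n)) \<le> cmod (B (X n) (Y N)) + cmod (B (X n) (Y n \<ominus> Y N))"
        by (metis norm_triangle_ineq)
      also have "cmod (B (X n) (Y n \<ominus> Y N)) \<le> M * nm (Y n \<ominus> Y N)"
        by (rule order_trans[OF CS]) (simp add: mult_right_mono M)
      also have "M * nm (Y n \<ominus> Y N) < e/2"
        unfolding mult.commute[of M]
        using N that by (intro iffD1[OF pos_less_divide_eq[OF M(1)]]) auto
      also have "cmod (B (X n) (Y N)) < e/2" using N' that by simp
      finally show ?thesis by simp
    qed
    then show "\<exists>N. \<forall>n\<ge>N. norm (B (X n) (Y n) - 0) < e" unfolding diff_zero by blast
  qed
  then show ?thesis using LIMSEQ_unique L_lim[OF X Y] by blast
qed

lemma F_app: "CC X \<Longrightarrow> CC Y \<Longrightarrow> F (\<lambda>n. X n @ Y n) = (\<lambda>z. F X z + F Y z)"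
  by (auto simp: F_def L_app)

lemma F_sc: "CC X \<Longrightarrow> F (\<lambda>n. sc a (X n)) = (\<lambda>z. a * F X z)"
  by (auto simp: F_def L_sc)

lemma F_sub: "CC X \<Longrightarrow> CC Y \<Longrightarrow> F (\<lambda>n. X n \<ominus> Y n) = (\<lambda>z. F X z - F Y z)"
  by (auto simp: F_def L_sub)

lemma F_const: "F (\<lambda>n. [(1,w)]) = (\<lambda>z. K z w)"
  by (rule ext) (simp add: F_def L_def B_def)

lemma L_F_cong_left:
  assumes "CC X" "CC X'" "CC Y" "F X = F X'" shows "L X Y = L X' Y"
proof -
  have "L (\<lambda>n. X n \<ominus> X' n) Y = 0"
    by (rule L_F_zero) (use assms in \<open>auto simp: F_sub intro: CC_sub\<close>)
  then show ?thesis using assms by (simp add: L_sub)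
qed

lemma L_F_cong:
  assumes "CC X" "CC X'" "CC Y" "CC Y'" "F X = F X'" "F Y = F Y'" shows "L X Y = L X' Y'"
  by (metis L_F_cong_left L_commute assms)

definition HH where "HH = {F X |X. CC X}"
definition rep where "rep f = (SOME X. CC X \<and> F X = f)"
definition ipp where "ipp f g = L (rep f) (rep g)"

lemma rep: "f \<in> HH \<Longrightarrow> CC (rep f)" "f \<in> HH \<Longrightarrow> F (rep f) = f"
  unfolding HH_def rep_def by (smt (verit, ccfv_SIG) mem_Collect_eq someI)+

lemma F_mem: "CC X \<Longrightarrow> F X \<in> HH"
  by (auto simp: HH_def)

lemma ipp_F: "CC X \<Longrightarrow> CC Y \<Longrightarrow> ipp (F X) (F Y) = L X Y"
  unfolding ipp_def by (intro L_F_cong rep F_mem)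

lemma HH_E: assumes "f \<in> HH" obtains X where "CC X" "f = F X"
  using assms by (auto simp: HH_def)

lemma norm_lim: assumes "CC X" "CC Y"
  shows "(\<lambda>n. nm (X n \<ominus> Y n)) \<longlonglongrightarrow> fun_norm ipp (\<lambda>z. F X z - F Y z)"
  using nm_lim[OF CC_sub[OF assms]]
  by (simp add: fun_norm_def ipp_F CC_sub assms flip: F_sub)

lemma L_self_nonneg: "CC X \<Longrightarrow> 0 \<le> Re (L X X)"
  by (rule LIMSEQ_le_const[OF tendsto_Re[OF L_lim]]) (auto simp: B_nonneg)

lemma L_definite: assumes X: "CC X" and 0: "L X X = 0" shows "F X z = 0"
proof -
  have "(\<lambda>n. nm (X n) * nm [(1,z)]) \<longlonglongrightarrow> 0"
    using tendsto_mult_right[OF nm_lim[OF X], of "nm [(1,z)]"] 0 by simp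
  then have "(\<lambda>n. B (X n) [(1,z)]) \<longlonglongrightarrow> 0"
    by (rule Lim_null_comparison[rotated]) (simp add: CS)
  then show ?thesis
    using LIMSEQ_unique[OF L_lim[OF X CC_const]] by (simp add: F_def)
qed

lemma complete_HH:
  assumes s: "\<And>n::nat. s n \<in> HH"
    and C: "\<And>e. 0 < e \<Longrightarrow> \<exists>N. \<forall>m\<ge>N. \<forall>n\<ge>N. fun_norm ipp (\<lambda>x. s m x - s n x) < e"
  shows "\<exists>f\<in>HH. (\<lambda>n. fun_norm ipp (\<lambda>x. s n x - f x)) \<longlonglongrightarrow> 0"
proof -
  define X where "X = (\<lambda>k. rep (s k))"
  have X: "CC (X k)" "F (X k) = s k" for k by (simp_all add: X_def rep s)
  have "\<exists>N. \<forall>m\<ge>N. nm (X k m \<ominus> X k N) < 1 / Suc k" for k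
    using CC_D[OF X(1)[of k], of "1 / Suc k"] by auto
  then obtain i where i: "\<And>k m. m \<ge> i k \<Longrightarrow> nm (X k m \<ominus> X k (i k)) < 1 / Suc k" by metis
  define y where "y = (\<lambda>k. X k (i k))"
  have iy: "nm (X k m \<ominus> y k) < 1 / Suc k" if "m \<ge> i k" for k m
    using i that by (simp add: y_def)
  have yy: "nm (y k \<ominus> y l) \<le> 1 / Suc k + fun_norm ipp (\<lambda>x. s k x - s l x) + 1 / Suc l" for k l
  proof (rule LIMSEQ_le_const)
    show "(\<lambda>m. 1 / Suc k + nm (X k m \<ominus> X l m) + 1 / Suc l)
        \<longlonglongrightarrow> 1 / Suc k + fun_norm ipp (\<lambda>x. s k x - s l x) + 1 / Suc l"
      using norm_lim[OF X(1) X(1), of k l] by (intro tendsto_intros) (simp add: X)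
    have "nm (y k \<ominus> y l) \<le> 1 / Suc k + nm (X k m \<ominus> X l m) + 1 / Suc l"
      if "m \<ge> max (i k) (i l)" for m
      using nm_sub_triangle[of "y k" "y l" "X k m"] nm_sub_triangle[of "X k m" "y l" "X l m"]
        iy[of k m] iy[of l m] nm_sub_commute[of "y k" "X k m"] that by simp
    then show "\<exists>N. \<forall>m\<ge>N. nm (y k \<ominus> y l) \<le> 1 / Suc k + nm (X k m \<ominus> X l m) + 1 / Suc l"
      by blast
  qed
  have small: "\<exists>N. \<forall>k\<ge>N. 1 / Suc k < e" if "e > 0" for e :: real
    using LIMSEQ_D[OF LIMSEQ_inverse_real_of_nat that] by (auto simp: inverse_eq_divide)
  have y: "CC y"
    unfolding CC_def
  proof (intro allI impI)
    fix e :: real assume "e > 0"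
    then have "e/3 > 0" by simp
    obtain N1 where 1: "\<forall>k\<ge>N1. 1 / Suc k < e/3" using small[OF \<open>e/3>0\<close>] by blast
    obtain N2 where 2: "\<forall>m\<ge>N2. \<forall>n\<ge>N2. fun_norm ipp (\<lambda>x. s m x - s n x) < e/3"
      using C[OF \<open>e/3>0\<close>] by blast
    have "nm (y k \<ominus> y l) < e" if "k \<ge> max N1 N2" "l \<ge> max N1 N2" for k l
    proof -
      have "1 / Suc k < e/3" "1 / Suc l < e/3" "fun_norm ipp (\<lambda>x. s k x - s l x) < e/3"
        using 1 2 that by auto
      then show ?thesis using yy[of k l] by linarith
    qed
    then show "\<exists>N. \<forall>m\<ge>N. \<forall>n\<ge>N. nm (y m \<ominus> y n) < e" by blast
  qed
  have "(\<lambda>n. fun_norm ipp (\<lambda>x. s n x - F y x)) \<longlonglongrightarrow> 0"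
  proof (rule LIMSEQ_I)
    fix e :: real assume "e > 0"
    then have "e/3 > 0" by simp
    obtain N1 where 1: "\<forall>k\<ge>N1. 1 / Suc k < e/3" using small[OF \<open>e/3>0\<close>] by blast
    obtain N2 where 2: "\<forall>m\<ge>N2. \<forall>n\<ge>N2. nm (y m \<ominus> y n) < e/3"
      using CC_D[OF y \<open>e/3>0\<close>] by blast
    have "norm (fun_norm ipp (\<lambda>x. s k x - F y x) - 0) < e" if k: "k \<ge> max N1 N2" for k
    proof -
      have lim: "(\<lambda>m. nm (X k m \<ominus> y m)) \<longlonglongrightarrow> fun_norm ipp (\<lambda>x. s k x - F y x)"
        using norm_lim[OF X(1) y, of k] by (simp add: X)
      have "fun_norm ipp (\<lambda>x. s k x - F y x) \<le> e/3 + e/3"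
      proof (rule LIMSEQ_le_const2[OF lim])
        have "nm (X k m \<ominus> y m) \<le> e/3 + e/3" if m: "m \<ge> max (i k) N2" for m
        proof -
          have "nm (y k \<ominus> y m) < e/3" using 2 k m by auto
          moreover have "1 / Suc k < e/3" using 1 k by auto
          moreover have "nm (X k m \<ominus> y k) < 1 / Suc k" using iy m by auto
          ultimately show ?thesis using nm_sub_triangle[of "X k m" "y m" "y k"] by linarith
        qed
        then show "\<exists>N. \<forall>m\<ge>N. nm (X k m \<ominus> y m) \<le> e/3 + e/3" by blast
      qed
      moreover have "0 \<le> fun_norm ipp (\<lambda>x. s k x - F y x)"
        by (rule LIMSEQ_le_const[OF lim]) auto
      ultimately show ?thesis using \<open>e > 0\<close> by simp
    qed
    then show "\<exists>N. \<forall>n\<ge>N. norm (fun_norm ipp (\<lambda>x. s n x - F y x) - 0) < e" by blast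
  qed
  with F_mem[OF y] show ?thesis by blast
qed

theorem moore_aronszajn: "rkhs HH ipp K"
proof
  have "F (\<lambda>n. []) = (\<lambda>z. 0)" by (rule ext) (simp add: F_def L_def B_def)
  then show "(\<lambda>z. 0) \<in> HH" using F_mem[OF CC_const, of "[]"] by simp
next
  fix f g assume "f \<in> HH" "g \<in> HH"
  then obtain X Y where "CC X" "f = F X" "CC Y" "g = F Y" by (blast elim: HH_E)
  then show "(\<lambda>x. f x + g x) \<in> HH"
    using F_mem[OF CC_app, of X Y] by (simp add: F_app)
next
  fix f a assume "f \<in> HH"
  then obtain X where "CC X" "f = F X" by (blast elim: HH_E)
  then show "(\<lambda>x. a * f x) \<in> HH"
    using F_mem[OF CC_sc, of X a] by (simp add: F_sc)
next
  fix f g assume "f \<in> HH" "g \<in> HH"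
  then show "ipp f g = cnj (ipp g f)"
    unfolding ipp_def by (intro L_commute rep)
next
  fix f g h assume "f \<in> HH" "g \<in> HH" "h \<in> HH"
  then obtain X Y Z where "CC X" "f = F X" "CC Y" "g = F Y" "CC Z" "h = F Z" by (blast elim: HH_E)
  then show "ipp (\<lambda>x. f x + g x) h = ipp f h + ipp g h"
    by (simp add: ipp_F L_app CC_app flip: F_app)
next
  fix f g a assume "f \<in> HH" "g \<in> HH"
  then obtain X Y where "CC X" "f = F X" "CC Y" "g = F Y" by (blast elim: HH_E)
  then show "ipp (\<lambda>x. a * f x) g = a * ipp f g"
    by (simp add: ipp_F L_sc CC_sc flip: F_sc)
next
  fix f assume "f \<in> HH"
  then show "0 \<le> Re (ipp f f)" unfolding ipp_def by (intro L_self_nonneg rep)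
next
  fix f assume f: "f \<in> HH" and "ipp f f = 0"
  then have "F (rep f) z = 0" for z by (intro L_definite rep) (simp_all add: ipp_def)
  then show "f = (\<lambda>x. 0)" using rep(2)[OF f] by auto
next
  fix s :: "nat \<Rightarrow> 'x \<Rightarrow> complex"
  assume "\<And>n. s n \<in> HH"
    "\<And>e. 0 < e \<Longrightarrow> \<exists>N. \<forall>m\<ge>N. \<forall>n\<ge>N. fun_norm ipp (\<lambda>x. s m x - s n x) < e"
  then show "\<exists>f\<in>HH. (\<lambda>n. fun_norm ipp (\<lambda>x. s n x - f x)) \<longlonglongrightarrow> 0"
    by (rule complete_HH)
next
  show "(\<lambda>z. K z w) \<in> HH" for w using F_mem[OF CC_const, of "[(1,w)]"] by (simp add: F_const)
next
  fix f w assume "f \<in> HH"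
  then obtain X where "CC X" "f = F X" by (blast elim: HH_E)
  then have "ipp f (F (\<lambda>n. [(1,w)])) = f w" by (simp add: ipp_F F_def)
  then show "ipp f (\<lambda>z. K z w) = f w" by (simp add: F_const)
qed

end

text \<open>Finite Gram matrices are sums of rank-one matrices (Cholesky decomposition).\<close>

lemma gram_decomposition:
  fixes f :: "'i \<Rightarrow> 'a::chilbert_space"
  assumes "finite S"
  shows "\<exists>us :: ('i \<Rightarrow> complex) list. \<forall>i\<in>S. \<forall>j\<in>S. f i \<bullet>\<^sub>C f j = (\<Sum>u\<leftarrow>us. u i * cnj (u j))"
  using assms
proof (induction S arbitrary: f rule: finite_induct)
  case empty then show ?case by simp
next
  case (insert a S)
  have add_right: "x \<bullet>\<^sub>C (y + z) = x \<bullet>\<^sub>C y + x \<bullet>\<^sub>C z" for x y z :: 'a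
    by (metis cinner_commute cinner_add_left complex_cnj_add)
  have scale_right: "x \<bullet>\<^sub>C (c *\<^sub>C y) = cnj c * (x \<bullet>\<^sub>C y)" for x y :: 'a and c
    by (metis cinner_commute cinner_scaleC_left complex_cnj_mult)
  define r where "r = norm (f a)"
  define c where "c i = (f i \<bullet>\<^sub>C f a) / complex_of_real (r\<^sup>2)" for i
  define f' where "f' i = f i + (- c i) *\<^sub>C f a" for i
  have zero_left: "(0::'a) \<bullet>\<^sub>C x = 0" for x using cinner_add_left[of 0 0 x] by simp
  have zero_right: "x \<bullet>\<^sub>C (0::'a) = 0" for x using add_right[of x 0 0] by simp
  have aa: "f a \<bullet>\<^sub>C f a = complex_of_real (r\<^sup>2)" by (simp add: cinner_self r_def)
  define u0 where "u0 i = (f i \<bullet>\<^sub>C f a) / complex_of_real r" for i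
  have main: "f i \<bullet>\<^sub>C f j = u0 i * cnj (u0 j) + f' i \<bullet>\<^sub>C f' j" for i j
  proof (cases "r = 0")
    case True
    then have "f a = 0" by (simp add: r_def)
    then show ?thesis using True by (simp add: u0_def f'_def c_def zero_left zero_right cinner_add_left add_right scale_right cinner_scaleC_left)
  next
    case False
    have ja: "f a \<bullet>\<^sub>C f j = cnj (f j \<bullet>\<^sub>C f a)" by (rule cinner_commute)
    show ?thesis using False
      by (simp add: u0_def f'_def c_def cinner_add_left add_right scale_right
          cinner_scaleC_left aa ja field_simps power2_eq_square)
  qed
  have fa: "f' a = 0 \<or> r = 0"
  proof (cases "r = 0")
    case False
    then have "c a = 1" by (simp add: c_def aa)
    then show ?thesis
      using scaleR_scaleC[of "-1" "f a"]
      by (simp add: f'_def) (metis add.right_inverse)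
  qed simp
  have f'a: "f' a = 0"
  proof (cases "r = 0")
    case True
    then have "f a = 0" by (simp add: r_def)
    moreover have "x *\<^sub>C (0::'a) = 0" for x using scaleC_add_right[of x 0 0] by simp
    ultimately show ?thesis by (simp add: f'_def)
  qed (use fa in simp)
  obtain us where us: "\<forall>i\<in>S. \<forall>j\<in>S. f' i \<bullet>\<^sub>C f' j = (\<Sum>u\<leftarrow>us. u i * cnj (u j))"
    using insert.IH[of f'] by blast
  define vs where "vs = u0 # map (\<lambda>u. u(a := 0)) us"
  have "f i \<bullet>\<^sub>C f j = (\<Sum>u\<leftarrow>vs. u i * cnj (u j))" if "i \<in> insert a S" "j \<in> insert a S" for i j
  proof -
    have "f' i \<bullet>\<^sub>C f' j = (\<Sum>u\<leftarrow>us. (u(a := 0)) i * cnj ((u(a := 0)) j))"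
    proof (cases "i = a \<or> j = a")
      case True
      then show ?thesis by (auto simp: f'a zero_left zero_right)
    next
      case False
      then show ?thesis using us that by auto
    qed
    then show ?thesis unfolding main by (simp add: vs_def o_def)
  qed
  then show ?case by blast
qed

lemma cinner_power_psd:
  fixes z :: "nat \<Rightarrow> 'a::chilbert_space"
  shows "0 \<le> Re (\<Sum>i<n. \<Sum>j<n. c i * cnj (c j) * (z i \<bullet>\<^sub>C z j) ^ m)"
proof (induction m arbitrary: c)
  case 0
  have "(\<Sum>i<n. \<Sum>j<n. c i * cnj (c j)) = (\<Sum>i<n. c i) * cnj (\<Sum>i<n. c i)"
    by (simp add: sum_product)
  also have "\<dots> = complex_of_real ((cmod (\<Sum>i<n. c i))\<^sup>2)"
    by (metis complex_norm_square)
  finally show ?case by simp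
next
  case (Suc m)
  obtain us where us: "\<forall>i\<in>{..<n}. \<forall>j\<in>{..<n}. z i \<bullet>\<^sub>C z j = (\<Sum>u\<leftarrow>us. u i * cnj (u j))"
    using gram_decomposition[of "{..<n}" z] by auto
  have swap: "(\<Sum>i<n. \<Sum>j<n. \<Sum>u\<leftarrow>us. g u i j) = (\<Sum>u\<leftarrow>us. \<Sum>i<n. \<Sum>j<n. g u i j)"
    for g :: "(nat \<Rightarrow> complex) \<Rightarrow> nat \<Rightarrow> nat \<Rightarrow> complex" and us
    by (induction us) (auto simp: sum.distrib)
  have "(\<Sum>i<n. \<Sum>j<n. c i * cnj (c j) * (z i \<bullet>\<^sub>C z j) ^ Suc m) =
     (\<Sum>i<n. \<Sum>j<n. \<Sum>u\<leftarrow>us. (c i * u i) * cnj (c j * u j) * (z i \<bullet>\<^sub>C z j) ^ m)"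
  proof (intro sum.cong refl)
    fix i j assume "i \<in> {..<n}" "j \<in> {..<n}"
    then have e: "z i \<bullet>\<^sub>C z j = (\<Sum>u\<leftarrow>us. u i * cnj (u j))" using us by blast
    have "c i * cnj (c j) * (z i \<bullet>\<^sub>C z j) ^ Suc m
        = (c i * cnj (c j) * (z i \<bullet>\<^sub>C z j) ^ m) * (\<Sum>u\<leftarrow>us. u i * cnj (u j))"
      by (simp flip: e)
    then show "c i * cnj (c j) * (z i \<bullet>\<^sub>C z j) ^ Suc m
        = (\<Sum>u\<leftarrow>us. (c i * u i) * cnj (c j * u j) * (z i \<bullet>\<^sub>C z j) ^ m)"
      by (simp add: mult_ac flip: sum_list_const_mult)
  qed
  also have "\<dots> = (\<Sum>u\<leftarrow>us. \<Sum>i<n. \<Sum>j<n. (c i * u i) * cnj (c j * u j) * (z i \<bullet>\<^sub>C z j) ^ m)"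
    by (rule swap)
  finally have eq: "(\<Sum>i<n. \<Sum>j<n. c i * cnj (c j) * (z i \<bullet>\<^sub>C z j) ^ Suc m) = \<dots>" .
  have Re_list: "Re (\<Sum>u\<leftarrow>us. h u) = (\<Sum>u\<leftarrow>us. Re (h u))" for h :: "(nat \<Rightarrow> complex) \<Rightarrow> complex" and us
    by (induction us) auto
  show ?case unfolding eq Re_list using Suc.IH by (intro sum_list_nonneg) (force simp only: set_map)
qed

lemma pd_kernel_exp: "pd_kernel (\<lambda>z w :: 'a::chilbert_space. exp (z \<bullet>\<^sub>C w))"
proof
  show "exp (z \<bullet>\<^sub>C w) = cnj (exp (w \<bullet>\<^sub>C z))" for z w :: 'a
    by (metis cinner_commute exp_cnj)
next
  fix n c and z :: "nat \<Rightarrow> 'a"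
  have "(\<lambda>m. \<Sum>i<n. \<Sum>j<n. c i * cnj (c j) * ((z i \<bullet>\<^sub>C z j) ^ m /\<^sub>R fact m))
      sums (\<Sum>i<n. \<Sum>j<n. c i * cnj (c j) * exp (z i \<bullet>\<^sub>C z j))"
    by (intro sums_sum sums_mult exp_converges)
  then have s: "(\<lambda>m. Re (\<Sum>i<n. \<Sum>j<n. c i * cnj (c j) * ((z i \<bullet>\<^sub>C z j) ^ m /\<^sub>R fact m)))
      sums Re (\<Sum>i<n. \<Sum>j<n. c i * cnj (c j) * exp (z i \<bullet>\<^sub>C z j))"
    by (rule sums_Re)
  have "0 \<le> Re (\<Sum>i<n. \<Sum>j<n. c i * cnj (c j) * ((z i \<bullet>\<^sub>C z j) ^ m /\<^sub>R fact m))" for m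
  proof -
    have "(\<Sum>i<n. \<Sum>j<n. c i * cnj (c j) * ((z i \<bullet>\<^sub>C z j) ^ m /\<^sub>R fact m)) =
        (\<Sum>i<n. \<Sum>j<n. c i * cnj (c j) * (z i \<bullet>\<^sub>C z j) ^ m) /\<^sub>R fact m"
      by (simp only: scaleR_sum_right mult_scaleR_right)
    then show ?thesis using cinner_power_psd[of c z m n] by simp
  qed
  then show "0 \<le> Re (\<Sum>i<n. \<Sum>j<n. c i * cnj (c j) * exp (z i \<bullet>\<^sub>C z j))"
    using sums_le[OF _ sums_zero s] by blast
qed

theorem segal_bargmann_exists:
  "\<exists>H ip. segal_bargmann (H :: ('a::chilbert_space \<Rightarrow> complex) set) ip"
  using pd_kernel.moore_aronszajn[OF pd_kernel_exp] unfolding segal_bargmann_def by blast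

end

theory Submission
  imports Defs "HOL-Complex_Analysis.Complex_Analysis"
begin

text \<open>
  Sufficiency is a comparison of kernels in the order of positive definiteness \<open>\<preceq>\<close>. The
  operator \<open>C\<^sub>\<phi>\<close> is compact as soon as, for every \<open>\<epsilon> > 0\<close>, the pulled-back kernel
  \<open>K(\<phi> w, \<phi> z)\<close> is \<open>\<preceq> \<epsilon> K\<close> plus a finite rank kernel, by a Riesz representation argument and a
  diagonal sequence. For \<open>\<phi> z = A z + b\<close> and \<open>\<kappa>(w, z) = \<langle>\<phi> w, \<phi> z\<rangle>\<close>, \<open>\<sigma>(w, z) = \<langle>w, z\<rangle> + r\<close>, the
  bound \<open>\<parallel>A\<parallel> < 1\<close> gives \<open>\<kappa> \<preceq> q \<sigma>\<close> with \<open>q < 1\<close> for suitable \<open>r\<close>, and compactness of \<open>A\<close> gives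
  \<open>\<kappa> \<preceq> \<epsilon> \<sigma>\<close> plus finite rank. The latter passes to powers by Schur products, and the former
  makes the tail of the series of \<open>exp \<kappa>\<close> small against \<open>exp \<sigma> = exp r \<cdot> K\<close>.

  Conversely, since \<open>\<parallel>K\<^sub>w\<parallel>\<^sup>2 = exp \<parallel>w\<parallel>\<^sup>2\<close>, boundedness of \<open>C\<^sub>\<phi>\<close> forces
  \<open>\<parallel>\<phi> w\<parallel>\<^sup>2 \<le> \<parallel>w\<parallel>\<^sup>2 + C\<close>. The functions \<open>\<langle>\<phi>(\<cdot>), a\<rangle>\<close> lie in the space, so they are entire on complex
  lines, and of linear growth; hence \<open>\<phi>\<close> is affine. Compactness improves the growth bound to
  \<open>\<parallel>w\<parallel>\<^sup>2 - \<parallel>\<phi> w\<parallel>\<^sup>2 \<rightarrow> \<infinity>\<close>, which excludes \<open>\<parallel>A\<parallel> \<ge> 1\<close>.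
\<close>

section \<open>Domination of kernels\<close>

text \<open>For a reproducing kernel this is the squared norm of \<Sum> c K_z, which fixes the index
  order \<open>k w z\<close> against \<open>c * cnj d\<close>. The list encodes a finitely supported
  family of coefficients; entries at a repeated point simply add up.\<close>

definition kernel_form :: "('x \<Rightarrow> 'x \<Rightarrow> complex) \<Rightarrow> (complex \<times> 'x) list \<Rightarrow> complex" where
  "kernel_form k u = (\<Sum>(c,z)\<leftarrow>u. \<Sum>(d,w)\<leftarrow>u. c * cnj d * k w z)"

definition kernel_le :: "('x \<Rightarrow> 'x \<Rightarrow> complex) \<Rightarrow> ('x \<Rightarrow> 'x \<Rightarrow> complex) \<Rightarrow> bool"  (infix "\<preceq>" 50) where
  "k \<preceq> l \<longleftrightarrow> (\<forall>u. Re (kernel_form k u) \<le> Re (kernel_form l u))"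

abbreviation rank_one :: "('x \<Rightarrow> complex) \<Rightarrow> 'x \<Rightarrow> 'x \<Rightarrow> complex" where
  "rank_one g \<equiv> \<lambda>w z. g w * cnj (g z)"

lemma kernel_form_add:
  "kernel_form (\<lambda>w z. k w z + l w z) u = kernel_form k u + kernel_form l u"
  unfolding kernel_form_def case_prod_unfold by (simp add: distrib_left sum_list_addf)

lemma kernel_form_mult_const:
  "kernel_form (\<lambda>w z. a * k w z) u = a * kernel_form k u"
  unfolding kernel_form_def case_prod_unfold sum_list_const_mult[symmetric] by (simp only: mult_ac)

lemma kernel_form_zero: "kernel_form (\<lambda>w z. 0) u = 0"
  using kernel_form_mult_const[of 0 "\<lambda>w z. 0" u] by simp

lemma kernel_form_sum_list:
  "kernel_form (\<lambda>w z. \<Sum>g\<leftarrow>gs. k g w z) u = (\<Sum>g\<leftarrow>gs. kernel_form (k g) u)"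
  by (induction gs) (simp_all add: kernel_form_add kernel_form_zero)

text \<open>The factors \<open>g w\<close> and \<open>cnj (g z)\<close> are absorbed into the
  coefficients. Hence multiplication by a rank-one kernel preserves
  \<open>\<preceq>\<close>.\<close>

lemma kernel_form_rank_one_mult:
  "kernel_form (\<lambda>w z. g w * cnj (g z) * k w z) u
    = kernel_form k (map (\<lambda>(c,z). (c * cnj (g z), z)) u)"
  unfolding kernel_form_def by (simp add: case_prod_unfold o_def mult_ac)

lemma kernel_form_rank_one:
  "kernel_form (rank_one g) u = of_real ((cmod (\<Sum>(c,z)\<leftarrow>u. cnj c * g z))\<^sup>2)"
proof -
  have cnj_list: "cnj (\<Sum>x\<leftarrow>xs. h x) = (\<Sum>x\<leftarrow>xs. cnj (h x))" for h :: "'c \<Rightarrow> complex" and xs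
    by (induction xs) auto
  have "kernel_form (rank_one g) u = (\<Sum>(c,z)\<leftarrow>u. c * cnj (g z)) * (\<Sum>(d,w)\<leftarrow>u. cnj d * g w)"
    unfolding kernel_form_def case_prod_unfold
    unfolding sum_list_mult_const[symmetric] unfolding sum_list_const_mult[symmetric]
    by (simp only: mult_ac)
  also have "(\<Sum>(c,z)\<leftarrow>u. c * cnj (g z)) = cnj (\<Sum>(d,w)\<leftarrow>u. cnj d * g w)"
    by (simp add: cnj_list case_prod_unfold)
  finally show ?thesis by (simp only: complex_norm_square mult.commute)
qed

text \<open>For a fixed list the form is a finite sum, so pointwise convergent series pass through
  it; this carries domination over to the exponential series.\<close>

lemma kernel_form_sums:
  assumes "\<And>w z. (\<lambda>m. k m w z) sums l w z"
  shows "(\<lambda>m. kernel_form (k m) u) sums kernel_form l u"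
proof -
  have list: "(\<lambda>m. \<Sum>x\<leftarrow>xs. h m x) sums (\<Sum>x\<leftarrow>xs. s x)" if "\<And>x. (\<lambda>m. h m x) sums s x"
    for h :: "nat \<Rightarrow> 'c \<Rightarrow> complex" and s xs
    by (induction xs) (auto intro!: sums_add that)
  show ?thesis unfolding kernel_form_def case_prod_unfold
    by (intro list sums_mult assms)
qed

lemma kernel_le_refl [simp]: "k \<preceq> k"
  by (simp add: kernel_le_def)

lemma kernel_le_trans: "k \<preceq> l \<Longrightarrow> l \<preceq> m \<Longrightarrow> k \<preceq> m"
  unfolding kernel_le_def using order_trans by blast

lemma kernel_le_add:
  "k \<preceq> l \<Longrightarrow> k' \<preceq> l' \<Longrightarrow> (\<lambda>w z. k w z + k' w z) \<preceq> (\<lambda>w z. l w z + l' w z)"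
  by (simp add: kernel_le_def kernel_form_add add_mono)

lemma kernel_le_scale:
  "k \<preceq> l \<Longrightarrow> 0 \<le> r \<Longrightarrow> (\<lambda>w z. of_real r * k w z) \<preceq> (\<lambda>w z. of_real r * l w z)"
  by (simp add: kernel_le_def kernel_form_mult_const mult_left_mono)

lemma kernel_le_scale_mono:
  "(\<lambda>w z. 0) \<preceq> k \<Longrightarrow> r \<le> s \<Longrightarrow> (\<lambda>w z. of_real r * k w z) \<preceq> (\<lambda>w z. of_real s * k w z)"
  by (simp add: kernel_le_def kernel_form_mult_const kernel_form_zero mult_right_mono)

lemma kernel_le_sum_list:
  "(\<And>g. g \<in> set gs \<Longrightarrow> k g \<preceq> l g) \<Longrightarrow> (\<lambda>w z. \<Sum>g\<leftarrow>gs. k g w z) \<preceq> (\<lambda>w z. \<Sum>g\<leftarrow>gs. l g w z)"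
  by (induction gs) (simp_all add: kernel_le_add)

lemma kernel_le_sums:
  assumes "\<And>m. k m \<preceq> l m" "\<And>w z. (\<lambda>m. k m w z) sums k' w z" "\<And>w z. (\<lambda>m. l m w z) sums l' w z"
  shows "k' \<preceq> l'"
  unfolding kernel_le_def
proof
  fix u
  show "Re (kernel_form k' u) \<le> Re (kernel_form l' u)"
    using sums_le[OF _ sums_Re[OF kernel_form_sums[of k k' u]] sums_Re[OF kernel_form_sums[of l l' u]]]
      assms by (simp add: kernel_le_def)
qed

lemma rank_one_nonneg: "(\<lambda>w z. 0) \<preceq> rank_one g"
  by (simp add: kernel_le_def kernel_form_zero kernel_form_rank_one)

lemma kernel_le_rank_one_mult:
  "k \<preceq> l \<Longrightarrow> (\<lambda>w z. rank_one g w z * k w z) \<preceq> (\<lambda>w z. rank_one g w z * l w z)"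
  by (simp add: kernel_le_def kernel_form_rank_one_mult)

lemma kernel_le_comp:
  fixes \<phi> :: "'x \<Rightarrow> 'y"
  assumes "k \<preceq> l" shows "(\<lambda>w z. k (\<phi> w) (\<phi> z)) \<preceq> (\<lambda>w z. l (\<phi> w) (\<phi> z))"
proof -
  have "kernel_form (\<lambda>w z. m (\<phi> w) (\<phi> z)) u = kernel_form m (map (\<lambda>(c,z). (c, \<phi> z)) u)"
    for m :: "'y \<Rightarrow> 'y \<Rightarrow> complex" and u
    unfolding kernel_form_def by (simp add: case_prod_unfold o_def)
  then show ?thesis using assms by (simp add: kernel_le_def)
qed

text \<open>The conclusion of the Schur product theorem taken as a definition. In this form closure
  under sums, products and powers is immediate, and a matrix decomposition is used only once, for
  Gram kernels.\<close>

definition mult_monotone :: "('x \<Rightarrow> 'x \<Rightarrow> complex) \<Rightarrow> bool" where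
  "mult_monotone k \<longleftrightarrow> (\<forall>l l'. l \<preceq> l' \<longrightarrow> (\<lambda>w z. k w z * l w z) \<preceq> (\<lambda>w z. k w z * l' w z))"

lemma mult_monotoneD:
  "mult_monotone k \<Longrightarrow> l \<preceq> l' \<Longrightarrow> (\<lambda>w z. k w z * l w z) \<preceq> (\<lambda>w z. k w z * l' w z)"
  by (simp add: mult_monotone_def)

text \<open>On the finitely many points of a list the Gram matrix of \<psi> is a sum of rank-one
  matrices, and each of these is absorbed into the coefficients.\<close>

lemma mult_monotone_cinner:
  fixes \<psi> :: "'x \<Rightarrow> 'a::chilbert_space"
  shows "mult_monotone (\<lambda>w z. \<psi> w \<bullet>\<^sub>C \<psi> z)"
  unfolding mult_monotone_def kernel_le_def
proof (intro allI impI)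
  fix l l' :: "'x \<Rightarrow> 'x \<Rightarrow> complex" and u :: "(complex \<times> 'x) list"
  assume le: "\<forall>u. Re (kernel_form l u) \<le> Re (kernel_form l' u)"
  obtain vs where vs: "\<forall>w\<in>snd ` set u. \<forall>z\<in>snd ` set u. \<psi> w \<bullet>\<^sub>C \<psi> z = (\<Sum>v\<leftarrow>vs. v w * cnj (v z))"
    using gram_decomposition[of "snd ` set u" \<psi>] by auto
  have eq: "kernel_form (\<lambda>w z. \<psi> w \<bullet>\<^sub>C \<psi> z * k w z) u =
      (\<Sum>v\<leftarrow>vs. kernel_form k (map (\<lambda>(c,z). (c * cnj (v z), z)) u))" for k :: "'x \<Rightarrow> 'x \<Rightarrow> complex"
  proof -
    have "kernel_form (\<lambda>w z. \<psi> w \<bullet>\<^sub>C \<psi> z * k w z) u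
        = kernel_form (\<lambda>w z. \<Sum>v\<leftarrow>vs. v w * cnj (v z) * k w z) u"
      unfolding kernel_form_def case_prod_unfold
    proof (intro arg_cong[where f = sum_list] map_cong refl)
      fix x y assume "x \<in> set u" "y \<in> set u"
      then have "\<psi> (snd y) \<bullet>\<^sub>C \<psi> (snd x) = (\<Sum>v\<leftarrow>vs. v (snd y) * cnj (v (snd x)))"
        using vs by blast
      then show "fst x * cnj (fst y) * (\<psi> (snd y) \<bullet>\<^sub>C \<psi> (snd x) * k (snd y) (snd x)) =
          fst x * cnj (fst y) * (\<Sum>v\<leftarrow>vs. v (snd y) * cnj (v (snd x)) * k (snd y) (snd x))"
        by (simp add: sum_list_mult_const)
    qed
    then show ?thesis by (simp only: kernel_form_sum_list kernel_form_rank_one_mult)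
  qed
  have Re_list: "Re (\<Sum>v\<leftarrow>vs. h v) = (\<Sum>v\<leftarrow>vs. Re (h v))" for h :: "('x \<Rightarrow> complex) \<Rightarrow> complex"
    by (induction vs) auto
  show "Re (kernel_form (\<lambda>w z. \<psi> w \<bullet>\<^sub>C \<psi> z * l w z) u) \<le> Re (kernel_form (\<lambda>w z. \<psi> w \<bullet>\<^sub>C \<psi> z * l' w z) u)"
    unfolding eq Re_list using le by (intro sum_list_mono) simp
qed

lemma mult_monotone_of_real: "0 \<le> r \<Longrightarrow> mult_monotone (\<lambda>w z. of_real r)"
  by (simp add: mult_monotone_def kernel_le_scale)

lemma mult_monotone_add:
  "mult_monotone k \<Longrightarrow> mult_monotone l \<Longrightarrow> mult_monotone (\<lambda>w z. k w z + l w z)"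
  by (simp add: mult_monotone_def distrib_right kernel_le_add)

lemma mult_monotone_mult:
  assumes "mult_monotone k" "mult_monotone l"
  shows "mult_monotone (\<lambda>w z. k w z * l w z)"
  unfolding mult_monotone_def mult.assoc
  by (intro allI impI mult_monotoneD[OF assms(1)] mult_monotoneD[OF assms(2)])

lemma mult_monotone_power: "mult_monotone k \<Longrightarrow> mult_monotone (\<lambda>w z. k w z ^ m)"
proof (induction m)
  case 0 then show ?case using mult_monotone_of_real[of 1] by simp
next
  case (Suc m) then show ?case using mult_monotone_mult[of k "\<lambda>w z. k w z ^ m"] by simp
qed

text \<open>The constant kernel 1 is rank one, hence nonnegative; multiply 0 \<preceq> 1 by
  \<open>k\<close>.\<close>

lemma mult_monotone_nonneg: "mult_monotone k \<Longrightarrow> (\<lambda>w z. 0) \<preceq> k"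
  using mult_monotoneD[of k "\<lambda>w z. 0" "rank_one (\<lambda>w. 1)"] rank_one_nonneg[of "\<lambda>w. 1"] by simp

text \<open>The comparison passes through \<open>k * l'\<close>: first \<open>k\<close> stays fixed
  while the other factor grows, then \<open>l'\<close> stays fixed. This is why monotonicity is
  assumed of exactly these two.\<close>

lemma kernel_le_mult:
  assumes "mult_monotone k" "mult_monotone l'" "k \<preceq> l" "k' \<preceq> l'"
  shows "(\<lambda>w z. k w z * k' w z) \<preceq> (\<lambda>w z. l w z * l' w z)"
proof -
  have "(\<lambda>w z. k w z * l' w z) \<preceq> (\<lambda>w z. l w z * l' w z)"
    using mult_monotoneD[OF assms(2,3)] unfolding mult.commute[of "l' w z" for w z] .
  with mult_monotoneD[OF assms(1,4)] show ?thesis by (rule kernel_le_trans)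
qed

lemma kernel_le_power:
  assumes "mult_monotone k" "mult_monotone l" "k \<preceq> l"
  shows "(\<lambda>w z. k w z ^ m) \<preceq> (\<lambda>w z. l w z ^ m)"
proof (induction m)
  case (Suc m)
  then show ?case
    using kernel_le_mult[where k' = "\<lambda>w z. k w z ^ m" and l' = "\<lambda>w z. l w z ^ m",
        OF assms(1) mult_monotone_power assms(3)] assms(2)
    by simp
next
  case 0 show ?case by simp
qed

section \<open>Compact domination\<close>

text \<open>For reproducing kernels \<open>\<tau>\<close> this says that the inclusion of the space with kernel \<open>\<kappa>\<close> into the
  space with kernel \<open>\<tau>\<close> is compact: up to \<open>\<epsilon>\<close>, the form of \<open>\<kappa>\<close> is a form of finite rank.\<close>

definition compactly_dominated ::
  "('x \<Rightarrow> 'x \<Rightarrow> complex) \<Rightarrow> ('x \<Rightarrow> 'x \<Rightarrow> complex) \<Rightarrow> bool" where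
  "compactly_dominated \<kappa> \<tau> \<longleftrightarrow> (\<forall>\<epsilon>>0. \<exists>gs.
    \<kappa> \<preceq> (\<lambda>w z. of_real \<epsilon> * \<tau> w z + (\<Sum>g\<leftarrow>gs. rank_one g w z)) \<and>
    (\<forall>g\<in>set gs. \<exists>C\<ge>0. rank_one g \<preceq> (\<lambda>w z. of_real C * \<tau> w z)))"

lemma compactly_dominatedE:
  assumes "compactly_dominated \<kappa> \<tau>" "0 < \<epsilon>"
  obtains gs where "\<kappa> \<preceq> (\<lambda>w z. of_real \<epsilon> * \<tau> w z + (\<Sum>g\<leftarrow>gs. rank_one g w z))"
    "\<And>g. g \<in> set gs \<Longrightarrow> \<exists>C\<ge>0. rank_one g \<preceq> (\<lambda>w z. of_real C * \<tau> w z)"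
  using assms unfolding compactly_dominated_def by blast

lemma compactly_dominated_add:
  assumes "compactly_dominated k \<tau>" "compactly_dominated l \<tau>"
  shows "compactly_dominated (\<lambda>w z. k w z + l w z) \<tau>"
  unfolding compactly_dominated_def
proof (intro allI impI)
  fix \<epsilon> :: real assume "\<epsilon> > 0"
  then have e: "\<epsilon>/2 > 0" by simp
  obtain gs where gs: "k \<preceq> (\<lambda>w z. of_real (\<epsilon>/2) * \<tau> w z + (\<Sum>g\<leftarrow>gs. rank_one g w z))"
    "\<And>g. g \<in> set gs \<Longrightarrow> \<exists>C\<ge>0. rank_one g \<preceq> (\<lambda>w z. of_real C * \<tau> w z)"
    using compactly_dominatedE[OF assms(1) e] by blast
  obtain hs where hs: "l \<preceq> (\<lambda>w z. of_real (\<epsilon>/2) * \<tau> w z + (\<Sum>g\<leftarrow>hs. rank_one g w z))"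
    "\<And>g. g \<in> set hs \<Longrightarrow> \<exists>C\<ge>0. rank_one g \<preceq> (\<lambda>w z. of_real C * \<tau> w z)"
    using compactly_dominatedE[OF assms(2) e] by blast
  have "(\<lambda>w z. of_real (\<epsilon>/2) * \<tau> w z + (\<Sum>g\<leftarrow>gs. rank_one g w z) + (of_real (\<epsilon>/2) * \<tau> w z + (\<Sum>g\<leftarrow>hs. rank_one g w z)))
     = (\<lambda>w z. of_real \<epsilon> * \<tau> w z + (\<Sum>g\<leftarrow>gs @ hs. rank_one g w z))"
    by (intro ext) (simp add: field_simps)
  then show "\<exists>gs. (\<lambda>w z. k w z + l w z) \<preceq> (\<lambda>w z. of_real \<epsilon> * \<tau> w z + (\<Sum>g\<leftarrow>gs. rank_one g w z)) \<and>
    (\<forall>g\<in>set gs. \<exists>C\<ge>0. rank_one g \<preceq> (\<lambda>w z. of_real C * \<tau> w z))"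
    using kernel_le_add[OF gs(1) hs(1)] gs(2) hs(2) by (intro exI[of _ "gs @ hs"]) auto
qed

lemma compactly_dominated_mono:
  assumes "compactly_dominated k \<tau>" "\<tau> \<preceq> (\<lambda>w z. of_real D * \<tau>' w z)" "0 < D"
  shows "compactly_dominated k \<tau>'"
  unfolding compactly_dominated_def
proof (intro allI impI)
  fix \<epsilon> :: real assume "\<epsilon> > 0"
  then have e: "\<epsilon>/D > 0" using assms by simp
  have le: "(\<lambda>w z. of_real C * \<tau> w z) \<preceq> (\<lambda>w z. of_real (C * D) * \<tau>' w z)" if "C \<ge> 0" for C
    using kernel_le_scale[OF assms(2) that] by (simp add: mult.assoc)
  obtain gs where gs: "k \<preceq> (\<lambda>w z. of_real (\<epsilon>/D) * \<tau> w z + (\<Sum>g\<leftarrow>gs. rank_one g w z))"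
    "\<And>g. g \<in> set gs \<Longrightarrow> \<exists>C\<ge>0. rank_one g \<preceq> (\<lambda>w z. of_real C * \<tau> w z)"
    using compactly_dominatedE[OF assms(1) e] by blast
  have "(\<lambda>w z. of_real (\<epsilon>/D) * \<tau> w z) \<preceq> (\<lambda>w z. of_real \<epsilon> * \<tau>' w z)"
    using le[of "\<epsilon>/D"] e assms(3) by simp
  then have 1: "k \<preceq> (\<lambda>w z. of_real \<epsilon> * \<tau>' w z + (\<Sum>g\<leftarrow>gs. rank_one g w z))"
    by (intro kernel_le_trans[OF gs(1)] kernel_le_add) auto
  have 2: "\<exists>C\<ge>0. rank_one g \<preceq> (\<lambda>w z. of_real C * \<tau>' w z)" if g: "g \<in> set gs" for g
  proof -
    obtain C where C: "C \<ge> 0" "rank_one g \<preceq> (\<lambda>w z. of_real C * \<tau> w z)" using gs(2)[OF g] by blast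
    show ?thesis
      using kernel_le_trans[OF C(2) le[OF C(1)]] C(1) assms(3) by (intro exI[of _ "C * D"]) simp
  qed
  show "\<exists>gs. k \<preceq> (\<lambda>w z. of_real \<epsilon> * \<tau>' w z + (\<Sum>g\<leftarrow>gs. rank_one g w z)) \<and>
    (\<forall>g\<in>set gs. \<exists>C\<ge>0. rank_one g \<preceq> (\<lambda>w z. of_real C * \<tau>' w z))"
    using 1 2 by blast
qed

text \<open>Half of \<epsilon> pays for replacing \<open>k\<close> by \<open>k'\<close>, half for
  the finite rank approximation of \<open>k'\<close>. It is the counterpart of the closedness of
  compact operators under norm limits.\<close>

lemma compactly_dominated_approx:
  assumes "\<And>\<epsilon>. 0 < \<epsilon> \<Longrightarrow> \<exists>k'. compactly_dominated k' \<tau> \<and> k \<preceq> (\<lambda>w z. of_real \<epsilon> * \<tau> w z + k' w z)"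
  shows "compactly_dominated k \<tau>"
  unfolding compactly_dominated_def
proof (intro allI impI)
  fix \<epsilon> :: real assume "\<epsilon> > 0"
  then have e: "\<epsilon>/2 > 0" by simp
  obtain k' where k': "compactly_dominated k' \<tau>" "k \<preceq> (\<lambda>w z. of_real (\<epsilon>/2) * \<tau> w z + k' w z)"
    using assms[OF e] by blast
  obtain gs where gs: "k' \<preceq> (\<lambda>w z. of_real (\<epsilon>/2) * \<tau> w z + (\<Sum>g\<leftarrow>gs. rank_one g w z))"
    "\<And>g. g \<in> set gs \<Longrightarrow> \<exists>C\<ge>0. rank_one g \<preceq> (\<lambda>w z. of_real C * \<tau> w z)"
    using compactly_dominatedE[OF k'(1) e] by blast
  have "(\<lambda>w z. of_real (\<epsilon>/2) * \<tau> w z + (of_real (\<epsilon>/2) * \<tau> w z + (\<Sum>g\<leftarrow>gs. rank_one g w z)))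
     = (\<lambda>w z. of_real \<epsilon> * \<tau> w z + (\<Sum>g\<leftarrow>gs. rank_one g w z))"
    by (intro ext) (simp add: field_simps)
  then have "k \<preceq> (\<lambda>w z. of_real \<epsilon> * \<tau> w z + (\<Sum>g\<leftarrow>gs. rank_one g w z))"
    using kernel_le_trans[OF k'(2) kernel_le_add[OF kernel_le_refl gs(1)]] by simp
  then show "\<exists>gs. k \<preceq> (\<lambda>w z. of_real \<epsilon> * \<tau> w z + (\<Sum>g\<leftarrow>gs. rank_one g w z)) \<and>
    (\<forall>g\<in>set gs. \<exists>C\<ge>0. rank_one g \<preceq> (\<lambda>w z. of_real C * \<tau> w z))"
    using gs(2) by blast
qed

lemma compactly_dominated_le:
  assumes "compactly_dominated l \<tau>" "k \<preceq> l"
  shows "compactly_dominated k \<tau>"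
  using assms(1) kernel_le_trans[OF assms(2)] unfolding compactly_dominated_def by blast

lemma sum_list_concat_product:
  "(\<Sum>h\<leftarrow>concat (map (\<lambda>l. map (f l) gs) ls). F h) = (\<Sum>l\<leftarrow>ls. \<Sum>g\<leftarrow>gs. F (f l g))"
  by (induction ls) (simp_all add: o_def)

text \<open>The factors are approximated in turn. Expanding \<kappa>' leaves an error \<delta>
  \<tau>' \<kappa>, controlled by \<kappa> \<preceq> a \<tau>, and finitely many products of a
  rank-one kernel with \<kappa>. Only in those products is \<kappa> expanded, so the finite rank
  part consists of the rank-one kernels of the functions \<open>l * g\<close>.\<close>

lemma compactly_dominated_mult:
  assumes \<kappa>: "compactly_dominated \<kappa> \<tau>" and \<kappa>': "compactly_dominated \<kappa>' \<tau>'"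
    and mono: "mult_monotone \<kappa>" "mult_monotone \<tau>" "mult_monotone \<tau>'"
    and le: "\<kappa> \<preceq> (\<lambda>w z. of_real a * \<tau> w z)" "0 \<le> a"
  shows "compactly_dominated (\<lambda>w z. \<kappa> w z * \<kappa>' w z) (\<lambda>w z. \<tau> w z * \<tau>' w z)"
  unfolding compactly_dominated_def
proof (intro allI impI)
  fix \<epsilon> :: real assume \<epsilon>: "\<epsilon> > 0"
  \<comment> \<open>Chosen so that the first error, \<delta> a \<tau> \<tau>', stays below half of
    \<epsilon>; the summand 1 keeps the denominator positive for a = 0.\<close>
  define \<delta> where "\<delta> = \<epsilon> / (2 * (a + 1))"
  have \<delta>: "\<delta> > 0" "\<delta> * a \<le> \<epsilon> / 2"
  proof -
    show "\<delta> > 0" using \<epsilon> le(2) by (simp add: \<delta>_def)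
    have "\<delta> * a \<le> \<delta> * (a + 1)" using \<open>\<delta> > 0\<close> by simp
    also have "\<dots> = \<epsilon> / 2" using le(2) by (simp add: \<delta>_def field_simps)
    finally show "\<delta> * a \<le> \<epsilon> / 2" .
  qed
  obtain ls where ls: "\<kappa>' \<preceq> (\<lambda>w z. of_real \<delta> * \<tau>' w z + (\<Sum>l\<leftarrow>ls. rank_one l w z))"
    "\<And>l. l \<in> set ls \<Longrightarrow> \<exists>C\<ge>0. rank_one l \<preceq> (\<lambda>w z. of_real C * \<tau>' w z)"
    using compactly_dominatedE[OF \<kappa>' \<delta>(1)] by blast
  then have "\<forall>l\<in>set ls. \<exists>C. 0 \<le> C \<and> rank_one l \<preceq> (\<lambda>w z. of_real C * \<tau>' w z)" by blast
  from bchoice[OF this] obtain C where C: "\<And>l. l \<in> set ls \<Longrightarrow> 0 \<le> C l"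
    "\<And>l. l \<in> set ls \<Longrightarrow> rank_one l \<preceq> (\<lambda>w z. of_real (C l) * \<tau>' w z)"
    by blast
  define S where "S = (\<Sum>l\<leftarrow>ls. C l)"
  have S: "0 \<le> S" unfolding S_def using C(1) by (intro sum_list_nonneg) auto
  \<comment> \<open>The accuracy for \<kappa> is fixed only now, since the constants
    \<open>C l\<close> summed up in \<open>S\<close> depend on the list \<open>ls\<close> and thus
    on \<delta>.\<close>
  define \<eta> where "\<eta> = \<epsilon> / (2 * (S + 1))"
  have \<eta>: "\<eta> > 0" "\<eta> * S \<le> \<epsilon> / 2"
  proof -
    show "\<eta> > 0" using \<epsilon> S by (simp add: \<eta>_def)
    have "\<eta> * S \<le> \<eta> * (S + 1)" using \<open>\<eta> > 0\<close> by simp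
    also have "\<dots> = \<epsilon> / 2" using S by (simp add: \<eta>_def field_simps)
    finally show "\<eta> * S \<le> \<epsilon> / 2" .
  qed
  obtain gs where gs: "\<kappa> \<preceq> (\<lambda>w z. of_real \<eta> * \<tau> w z + (\<Sum>g\<leftarrow>gs. rank_one g w z))"
    "\<And>g. g \<in> set gs \<Longrightarrow> \<exists>D\<ge>0. rank_one g \<preceq> (\<lambda>w z. of_real D * \<tau> w z)"
    using compactly_dominatedE[OF \<kappa> \<eta>(1)] by blast
  define hs where "hs = concat (map (\<lambda>l. map (\<lambda>g x. l x * g x) gs) ls)"
  let ?t = "\<lambda>w z. \<tau> w z * \<tau>' w z"
  have \<tau>l: "(\<lambda>w z. \<tau> w z * rank_one l w z) \<preceq> (\<lambda>w z. of_real (C l) * ?t w z)" if "l \<in> set ls" for l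
    using mult_monotoneD[OF mono(2) C(2)[OF that]] by (simp add: mult_ac)
  have \<kappa>l: "(\<lambda>w z. rank_one l w z * \<kappa> w z) \<preceq>
      (\<lambda>w z. of_real \<eta> * (of_real (C l) * ?t w z) + (\<Sum>g\<leftarrow>gs. rank_one (\<lambda>x. l x * g x) w z))"
    if l: "l \<in> set ls" for l
  proof -
    have "(\<lambda>w z. rank_one l w z * \<kappa> w z) \<preceq>
        (\<lambda>w z. rank_one l w z * (of_real \<eta> * \<tau> w z + (\<Sum>g\<leftarrow>gs. rank_one g w z)))"
      by (rule kernel_le_rank_one_mult[OF gs(1)])
    moreover have "(\<lambda>w z. rank_one l w z * (of_real \<eta> * \<tau> w z + (\<Sum>g\<leftarrow>gs. rank_one g w z))) =
        (\<lambda>w z. of_real \<eta> * (\<tau> w z * rank_one l w z) + (\<Sum>g\<leftarrow>gs. rank_one (\<lambda>x. l x * g x) w z))"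
      by (intro ext) (simp add: algebra_simps flip: sum_list_const_mult)
    moreover have "\<dots> \<preceq> (\<lambda>w z. of_real \<eta> * (of_real (C l) * ?t w z) + (\<Sum>g\<leftarrow>gs. rank_one (\<lambda>x. l x * g x) w z))"
      using \<eta>(1) by (intro kernel_le_add kernel_le_refl kernel_le_scale \<tau>l l) simp
    ultimately show ?thesis by (simp only:) (rule kernel_le_trans)
  qed
  have 1: "(\<lambda>w z. \<kappa> w z * \<kappa>' w z) \<preceq> (\<lambda>w z. of_real \<epsilon> * ?t w z + (\<Sum>h\<leftarrow>hs. rank_one h w z))"
  proof (rule kernel_le_trans)
    show "(\<lambda>w z. \<kappa> w z * \<kappa>' w z) \<preceq> (\<lambda>w z. \<kappa> w z * (of_real \<delta> * \<tau>' w z + (\<Sum>l\<leftarrow>ls. rank_one l w z)))"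
      by (rule mult_monotoneD[OF mono(1) ls(1)])
    have e: "(\<lambda>w z. \<kappa> w z * (of_real \<delta> * \<tau>' w z + (\<Sum>l\<leftarrow>ls. rank_one l w z))) =
        (\<lambda>w z. of_real \<delta> * (\<tau>' w z * \<kappa> w z) + (\<Sum>l\<leftarrow>ls. rank_one l w z * \<kappa> w z))"
      by (intro ext) (simp add: algebra_simps flip: sum_list_const_mult)
    have "(\<lambda>w z. of_real \<delta> * (\<tau>' w z * \<kappa> w z) + (\<Sum>l\<leftarrow>ls. rank_one l w z * \<kappa> w z)) \<preceq>
      (\<lambda>w z. of_real \<delta> * (\<tau>' w z * (of_real a * \<tau> w z)) +
        (\<Sum>l\<leftarrow>ls. of_real \<eta> * (of_real (C l) * ?t w z) + (\<Sum>g\<leftarrow>gs. rank_one (\<lambda>x. l x * g x) w z)))"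
      using \<delta>(1) by (intro kernel_le_add kernel_le_scale mult_monotoneD[OF mono(3) le(1)]
        kernel_le_sum_list \<kappa>l) simp_all
    moreover have "(\<lambda>w z. of_real \<delta> * (\<tau>' w z * (of_real a * \<tau> w z)) +
        (\<Sum>l\<leftarrow>ls. of_real \<eta> * (of_real (C l) * ?t w z) + (\<Sum>g\<leftarrow>gs. rank_one (\<lambda>x. l x * g x) w z)))
      = (\<lambda>w z. of_real (\<delta> * a + \<eta> * S) * ?t w z + (\<Sum>h\<leftarrow>hs. rank_one h w z))"
    proof (intro ext)
      fix w z
      have "of_real S = (\<Sum>l\<leftarrow>ls. complex_of_real (C l))"
        unfolding S_def by (induction ls) auto
      then have "(\<Sum>l\<leftarrow>ls. of_real \<eta> * (of_real (C l) * ?t w z)) = of_real (\<eta> * S) * ?t w z"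
        by (simp add: sum_list_mult_const sum_list_const_mult mult.assoc)
      moreover have "(\<Sum>l\<leftarrow>ls. \<Sum>g\<leftarrow>gs. rank_one (\<lambda>x. l x * g x) w z) = (\<Sum>h\<leftarrow>hs. rank_one h w z)"
        unfolding hs_def sum_list_concat_product ..
      ultimately show "of_real \<delta> * (\<tau>' w z * (of_real a * \<tau> w z)) +
        (\<Sum>l\<leftarrow>ls. of_real \<eta> * (of_real (C l) * ?t w z) + (\<Sum>g\<leftarrow>gs. rank_one (\<lambda>x. l x * g x) w z))
        = of_real (\<delta> * a + \<eta> * S) * ?t w z + (\<Sum>h\<leftarrow>hs. rank_one h w z)"
        unfolding sum_list_addf by (simp add: algebra_simps)
    qed
    moreover have "\<dots> \<preceq> (\<lambda>w z. of_real \<epsilon> * ?t w z + (\<Sum>h\<leftarrow>hs. rank_one h w z))"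
      using \<delta>(2) \<eta>(2) mult_monotone_nonneg[OF mult_monotone_mult[OF mono(2,3)]]
      by (intro kernel_le_add kernel_le_scale_mono kernel_le_refl) simp_all
    ultimately show "(\<lambda>w z. \<kappa> w z * (of_real \<delta> * \<tau>' w z + (\<Sum>l\<leftarrow>ls. rank_one l w z))) \<preceq>
        (\<lambda>w z. of_real \<epsilon> * ?t w z + (\<Sum>h\<leftarrow>hs. rank_one h w z))"
      unfolding e by (simp only:) (rule kernel_le_trans)
  qed
  have 2: "\<exists>D\<ge>0. rank_one h \<preceq> (\<lambda>w z. of_real D * ?t w z)" if "h \<in> set hs" for h
  proof -
    from that obtain l g where h: "l \<in> set ls" "g \<in> set gs" "h = (\<lambda>x. l x * g x)"
      by (auto simp: hs_def)
    obtain D where D: "D \<ge> 0" "rank_one g \<preceq> (\<lambda>w z. of_real D * \<tau> w z)" using gs(2) h(2) by blast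
    have "(\<lambda>w z. rank_one l w z * rank_one g w z) \<preceq> (\<lambda>w z. rank_one l w z * (of_real D * \<tau> w z))"
      by (rule kernel_le_rank_one_mult[OF D(2)])
    moreover have "(\<lambda>w z. of_real D * (\<tau> w z * rank_one l w z)) \<preceq> (\<lambda>w z. of_real D * (of_real (C l) * ?t w z))"
      by (intro kernel_le_scale \<tau>l h D)
    moreover have "(\<lambda>w z. rank_one l w z * (of_real D * \<tau> w z)) = (\<lambda>w z. of_real D * (\<tau> w z * rank_one l w z))"
      "rank_one h = (\<lambda>w z. rank_one l w z * rank_one g w z)"
      "(\<lambda>w z. of_real D * (of_real (C l) * ?t w z)) = (\<lambda>w z. of_real (D * C l) * ?t w z)"
      by (auto simp: h(3) mult_ac intro!: ext)
    ultimately have "rank_one h \<preceq> (\<lambda>w z. of_real (D * C l) * ?t w z)"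
      by (simp only:) (rule kernel_le_trans)
    then show ?thesis using D(1) C(1)[OF h(1)] by (intro exI[of _ "D * C l"]) simp
  qed
  show "\<exists>gs. (\<lambda>w z. \<kappa> w z * \<kappa>' w z) \<preceq> (\<lambda>w z. of_real \<epsilon> * ?t w z + (\<Sum>g\<leftarrow>gs. rank_one g w z)) \<and>
    (\<forall>g\<in>set gs. \<exists>C\<ge>0. rank_one g \<preceq> (\<lambda>w z. of_real C * ?t w z))"
    using 1 2 by blast
qed

section \<open>Powers and exponentials of kernels\<close>

lemma compactly_dominated_power:
  assumes "mult_monotone \<kappa>" "mult_monotone \<sigma>" "compactly_dominated \<kappa> \<sigma>"
    and "\<kappa> \<preceq> (\<lambda>w z. of_real q * \<sigma> w z)" "0 \<le> q"
  shows "compactly_dominated (\<lambda>w z. \<kappa> w z ^ m) (\<lambda>w z. \<sigma> w z ^ m)"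
proof (induction m)
  case 0
  \<comment> \<open>The zeroth power is the constant kernel 1, which is its own finite rank part;
    the term with \<epsilon> is a nonnegative surplus.\<close>
  have "(\<lambda>w z. 0) \<preceq> (\<lambda>w z. of_real \<epsilon>)" if "\<epsilon> > 0" for \<epsilon>
    using that by (intro mult_monotone_nonneg mult_monotone_of_real) simp
  then have "(\<lambda>w z. 1) \<preceq> (\<lambda>w z. of_real \<epsilon> + 1)" if "\<epsilon> > 0" for \<epsilon>
    using kernel_le_add[OF _ kernel_le_refl[of "\<lambda>w z. 1"]] that by force
  then show ?case
    unfolding compactly_dominated_def
    by (intro allI impI exI[of _ "[\<lambda>x. 1]"]) (auto intro!: exI[of _ 1])
next
  case (Suc m)
  show ?case
    using compactly_dominated_mult[OF assms(3) Suc assms(1,2) mult_monotone_power[OF assms(2)] assms(4,5)]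
    by simp
qed

text \<open>All terms of the exponential series are nonnegative kernels, so a single one lies below
  the sum.\<close>

lemma kernel_le_exp_term:
  assumes "mult_monotone \<sigma>"
  shows "(\<lambda>w z. \<sigma> w z ^ m) \<preceq> (\<lambda>w z. of_real (fact m) * exp (\<sigma> w z))"
proof -
  define t where "t n = (\<lambda>w z. of_real (1 / fact n) * \<sigma> w z ^ n)" for n
  have t: "(\<lambda>w z. 0) \<preceq> t n" for n
    unfolding t_def
    by (intro mult_monotone_nonneg mult_monotone_mult mult_monotone_of_real mult_monotone_power assms) simp
  have "t m \<preceq> (\<lambda>w z. exp (\<sigma> w z))"
  proof (rule kernel_le_sums)
    \<comment> \<open>The single term is written as a series with one nonzero entry, so that the two
      series can be compared entry by entry.\<close>
    show "(\<lambda>w z. if n = m then t m w z else 0) \<preceq> t n" for n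
      using t[of n] by (cases "n = m") simp_all
    show "(\<lambda>n. if n = m then t m w z else 0) sums t m w z" for w z
      using sums_single[of m "\<lambda>n. t m w z"] by simp
    show "(\<lambda>n. t n w z) sums exp (\<sigma> w z)" for w z
      using exp_converges[of "\<sigma> w z"] by (simp add: t_def scaleR_conv_of_real divide_inverse)
  qed
  from kernel_le_scale[OF this, of "fact m"] show ?thesis by (simp add: t_def)
qed

text \<open>The partial sums of exp \<kappa> are compactly dominated, because powers are and
  \<sigma>^n is dominated by a multiple of exp \<sigma>. The terms of the tail satisfy \<kappa>^n
  \<preceq> q^n \<sigma>^n with q^n \<le> q^M, so the tail is at most q^M exp \<sigma>.\<close>

lemma compactly_dominated_exp:
  assumes mono: "mult_monotone \<kappa>" "mult_monotone \<sigma>" and cd: "compactly_dominated \<kappa> \<sigma>"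
    and le: "\<kappa> \<preceq> (\<lambda>w z. of_real q * \<sigma> w z)" and q: "0 \<le> q" "q < 1"
  shows "compactly_dominated (\<lambda>w z. exp (\<kappa> w z)) (\<lambda>w z. exp (\<sigma> w z))"
proof (rule compactly_dominated_approx)
  fix \<epsilon> :: real assume "\<epsilon> > 0"
  define t where "t k n = (\<lambda>w z. of_real (1 / fact n) * k w z ^ n)" for k :: "'a \<Rightarrow> 'a \<Rightarrow> complex" and n
  have t_sums: "(\<lambda>n. t k n w z) sums exp (k w z)" for k w z
    using exp_converges[of "k w z"] by (simp add: t_def scaleR_conv_of_real divide_inverse)
  have t_nonneg: "(\<lambda>w z. 0) \<preceq> t k n" if "mult_monotone k" for k n
    unfolding t_def
    by (intro mult_monotone_nonneg mult_monotone_mult mult_monotone_of_real mult_monotone_power that) simp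
  have t_cd: "compactly_dominated (t \<kappa> n) (\<lambda>w z. exp (\<sigma> w z))" for n
  proof (rule compactly_dominated_le)
    show "compactly_dominated (\<lambda>w z. \<kappa> w z ^ n) (\<lambda>w z. exp (\<sigma> w z))"
      by (rule compactly_dominated_mono[OF compactly_dominated_power[OF mono cd le q(1)]
            kernel_le_exp_term[OF mono(2)]]) simp
    show "t \<kappa> n \<preceq> (\<lambda>w z. \<kappa> w z ^ n)"
      using kernel_le_scale_mono[OF mult_monotone_nonneg[OF mult_monotone_power[OF mono(1)]], of "1 / fact n" 1 n]
      by (simp add: t_def)
  qed
  define p where "p M = (\<lambda>w z. \<Sum>n<M. t \<kappa> n w z)" for M
  have p: "compactly_dominated (p M) (\<lambda>w z. exp (\<sigma> w z))" for M
  proof (induction M)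
    case 0
    have "p 0 \<preceq> t \<kappa> 0" using t_nonneg[OF mono(1)] by (simp add: p_def)
    then show ?case by (rule compactly_dominated_le[OF t_cd])
  next
    case (Suc M)
    then show ?case using compactly_dominated_add[OF Suc t_cd] by (simp add: p_def)
  qed
  obtain M where "q ^ M < \<epsilon>"
    using LIMSEQ_D[OF LIMSEQ_realpow_zero[OF q], of \<epsilon>] \<open>\<epsilon> > 0\<close> q(1) by auto
  have t_le: "t \<kappa> n \<preceq> (\<lambda>w z. of_real (q ^ n) * t \<sigma> n w z)" for n
  proof -
    have "(\<lambda>w z. \<kappa> w z ^ n) \<preceq> (\<lambda>w z. (of_real q * \<sigma> w z) ^ n)"
      by (intro kernel_le_power mono le mult_monotone_mult mult_monotone_of_real q)
    from kernel_le_scale[OF this, of "1 / fact n"] show ?thesis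
      by (simp add: t_def power_mult_distrib mult_ac)
  qed
  have "(\<lambda>w z. exp (\<kappa> w z)) \<preceq> (\<lambda>w z. of_real (q ^ M) * exp (\<sigma> w z) + p M w z)"
  proof (rule kernel_le_sums)
    \<comment> \<open>Below \<open>M\<close> the whole term is kept in the partial sum and the part
      with \<sigma> is a nonnegative surplus; from \<open>M\<close> on the part with \<sigma> alone
      suffices.\<close>
    show "t \<kappa> n \<preceq> (\<lambda>w z. of_real (q ^ M) * t \<sigma> n w z + (if n < M then t \<kappa> n w z else 0))" for n
    proof (cases "n < M")
      case True
      have "(\<lambda>w z. 0) \<preceq> (\<lambda>w z. of_real (q ^ M) * t \<sigma> n w z)"
        using kernel_le_scale[OF t_nonneg[OF mono(2)], of "q ^ M" n] q by simp
      from kernel_le_add[OF this kernel_le_refl[of "t \<kappa> n"]] True show ?thesis by simp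
    next
      case False
      then have "q ^ n \<le> q ^ M" using q by (intro power_decreasing) auto
      then have "(\<lambda>w z. of_real (q ^ n) * t \<sigma> n w z) \<preceq> (\<lambda>w z. of_real (q ^ M) * t \<sigma> n w z)"
        by (rule kernel_le_scale_mono[OF t_nonneg[OF mono(2)]])
      from kernel_le_trans[OF t_le this] False show ?thesis by simp
    qed
    show "(\<lambda>n. t \<kappa> n w z) sums exp (\<kappa> w z)" for w z by (rule t_sums)
    have "(\<lambda>n. if n < M then t \<kappa> n w z else 0) sums p M w z" for w z
      using sums_If_finite_set[of "{..<M}" "\<lambda>n. t \<kappa> n w z"] by (simp add: p_def)
    then show "(\<lambda>n. of_real (q ^ M) * t \<sigma> n w z + (if n < M then t \<kappa> n w z else 0)) sums
        (of_real (q ^ M) * exp (\<sigma> w z) + p M w z)" for w z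
      by (intro sums_add sums_mult t_sums)
  qed
  moreover have "(\<lambda>w z. of_real (q ^ M) * exp (\<sigma> w z) + p M w z) \<preceq> (\<lambda>w z. of_real \<epsilon> * exp (\<sigma> w z) + p M w z)"
  proof (intro kernel_le_add kernel_le_refl kernel_le_scale_mono)
    show "(\<lambda>w z. 0) \<preceq> (\<lambda>w z. exp (\<sigma> w z))"
      using t_nonneg[OF mono(2), of 0] kernel_le_exp_term[OF mono(2), of 0] kernel_le_trans
      by (fastforce simp: t_def)
  qed (use \<open>q ^ M < \<epsilon>\<close> in simp)
  ultimately have "(\<lambda>w z. exp (\<kappa> w z)) \<preceq> (\<lambda>w z. of_real \<epsilon> * exp (\<sigma> w z) + p M w z)"
    by (rule kernel_le_trans)
  with p show "\<exists>k'. compactly_dominated k' (\<lambda>w z. exp (\<sigma> w z)) \<and>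
      (\<lambda>w z. exp (\<kappa> w z)) \<preceq> (\<lambda>w z. of_real \<epsilon> * exp (\<sigma> w z) + k' w z)"
    by blast
qed

section \<open>Reproducing kernel Hilbert spaces\<close>

context inner_function_space
begin

lemma diff_mem: "f \<in> H \<Longrightarrow> g \<in> H \<Longrightarrow> (\<lambda>x. f x - g x) \<in> H"
  using add_mem[of f "\<lambda>x. (-1) * g x"] scale_mem[of g "-1"] by simp

lemma ip_diff_left:
  "f \<in> H \<Longrightarrow> g \<in> H \<Longrightarrow> h \<in> H \<Longrightarrow> ip (\<lambda>x. f x - g x) h = ip f h - ip g h"
  using ip_add_left[of f "\<lambda>x. (-1) * g x" h] ip_scale_left[of g h "-1"] scale_mem[of g "-1"] by simp

lemma ip_add_right:
  "f \<in> H \<Longrightarrow> g \<in> H \<Longrightarrow> h \<in> H \<Longrightarrow> ip h (\<lambda>x. f x + g x) = ip h f + ip h g"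
  by (simp add: ip_commute[of h] add_mem ip_add_left)

lemma ip_diff_right:
  "f \<in> H \<Longrightarrow> g \<in> H \<Longrightarrow> h \<in> H \<Longrightarrow> ip h (\<lambda>x. f x - g x) = ip h f - ip h g"
  by (simp add: ip_commute[of h] diff_mem ip_diff_left)

lemma ip_scale_right: "f \<in> H \<Longrightarrow> g \<in> H \<Longrightarrow> ip f (\<lambda>x. a * g x) = cnj a * ip f g"
  by (simp add: ip_commute[of f] scale_mem ip_scale_left)

lemma ip_zero_left: "g \<in> H \<Longrightarrow> ip (\<lambda>x. 0) g = 0"
  using ip_scale_left[of g g 0] by simp

lemma fun_norm_nonneg: "f \<in> H \<Longrightarrow> 0 \<le> fun_norm ip f"
  by (simp add: fun_norm_def ip_nonneg)

lemma fun_norm_sq: "f \<in> H \<Longrightarrow> (fun_norm ip f)\<^sup>2 = Re (ip f f)"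
  by (simp add: fun_norm_def ip_nonneg)

lemma ip_self: "f \<in> H \<Longrightarrow> ip f f = of_real ((fun_norm ip f)\<^sup>2)"
  using ip_commute[of f f] by (simp add: fun_norm_sq complex_eq_iff)

lemma fun_norm_scale: "f \<in> H \<Longrightarrow> fun_norm ip (\<lambda>x. a * f x) = cmod a * fun_norm ip f"
proof -
  assume f: "f \<in> H"
  have "ip (\<lambda>x. a * f x) (\<lambda>x. a * f x) = of_real ((cmod a)\<^sup>2) * ip f f"
    unfolding complex_norm_square using f by (simp add: ip_scale_left ip_scale_right scale_mem mult_ac)
  then have "Re (ip (\<lambda>x. a * f x) (\<lambda>x. a * f x)) = (cmod a)\<^sup>2 * Re (ip f f)"
    by (simp only: Re_complex_of_real times_complex.sel Im_complex_of_real)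
  then show ?thesis by (simp add: fun_norm_def real_sqrt_mult)
qed

lemma fun_norm_add_sq:
  assumes "f \<in> H" "g \<in> H"
  shows "(fun_norm ip (\<lambda>x. f x + g x))\<^sup>2 = (fun_norm ip f)\<^sup>2 + (fun_norm ip g)\<^sup>2 + 2 * Re (ip f g)"
  using assms ip_commute[OF assms] by (simp add: fun_norm_sq add_mem ip_add_left ip_add_right)

lemma fun_norm_diff_sq:
  assumes "f \<in> H" "g \<in> H"
  shows "(fun_norm ip (\<lambda>x. f x - g x))\<^sup>2 = (fun_norm ip f)\<^sup>2 + (fun_norm ip g)\<^sup>2 - 2 * Re (ip f g)"
  using assms ip_commute[OF assms] by (simp add: fun_norm_sq diff_mem ip_diff_left ip_diff_right)

lemma fun_norm_diff_commute:
  assumes "f \<in> H" "g \<in> H"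
  shows "fun_norm ip (\<lambda>x. f x - g x) = fun_norm ip (\<lambda>x. g x - f x)"
  using fun_norm_scale[OF diff_mem[OF assms], of "-1"] by simp

lemma ip_Cauchy_Schwarz:
  assumes f: "f \<in> H" and g: "g \<in> H"
  shows "cmod (ip f g) \<le> fun_norm ip f * fun_norm ip g"
proof (cases "fun_norm ip g = 0")
  case True
  then have "g = (\<lambda>x. 0)" using ip_self[OF g] ip_definite[OF g] by simp
  then have "ip f g = 0" using ip_commute[OF f g] ip_zero_left[OF f] by simp
  then show ?thesis by (simp add: True)
next
  case False
  then have pos: "fun_norm ip g > 0" using fun_norm_nonneg[OF g] by simp
  define a where "a = ip f g / of_real ((fun_norm ip g)\<^sup>2)"
  have "0 \<le> (fun_norm ip (\<lambda>x. f x - a * g x))\<^sup>2" by simp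
  also have "\<dots> = (fun_norm ip f)\<^sup>2 + (cmod a * fun_norm ip g)\<^sup>2 - 2 * Re (cnj a * ip f g)"
    using fun_norm_diff_sq[OF f scale_mem[OF g], of a]
    by (simp add: fun_norm_scale ip_scale_right f g)
  also have "cnj a * ip f g = of_real ((cmod (ip f g))\<^sup>2 / (fun_norm ip g)\<^sup>2)"
    unfolding a_def by (simp add: complex_norm_square mult.commute del: of_real_power)
  also have "cmod a * fun_norm ip g = cmod (ip f g) / fun_norm ip g"
    using pos by (simp add: a_def norm_divide norm_mult power2_eq_square)
  finally have "(cmod (ip f g) / fun_norm ip g)\<^sup>2 \<le> (fun_norm ip f)\<^sup>2"
    by (simp only: Re_complex_of_real) (simp add: power_divide)
  then have "cmod (ip f g) / fun_norm ip g \<le> fun_norm ip f"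
    using fun_norm_nonneg[OF f] power2_le_imp_le by blast
  then show ?thesis using pos by (simp add: field_simps)
qed

lemma fun_norm_triangle:
  assumes "f \<in> H" "g \<in> H"
  shows "fun_norm ip (\<lambda>x. f x + g x) \<le> fun_norm ip f + fun_norm ip g"
proof (rule power2_le_imp_le)
  show "(fun_norm ip (\<lambda>x. f x + g x))\<^sup>2 \<le> (fun_norm ip f + fun_norm ip g)\<^sup>2"
    using fun_norm_add_sq[OF assms] ip_Cauchy_Schwarz[OF assms] complex_Re_le_cmod[of "ip f g"]
    by (simp add: power2_sum)
qed (simp add: fun_norm_nonneg assms)

lemma fun_norm_triangle_diff:
  assumes "f \<in> H" "g \<in> H" "h \<in> H"
  shows "fun_norm ip (\<lambda>x. f x - h x) \<le> fun_norm ip (\<lambda>x. f x - g x) + fun_norm ip (\<lambda>x. g x - h x)"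
  using fun_norm_triangle[OF diff_mem[OF assms(1,2)] diff_mem[OF assms(2,3)]] by simp

lemma tendsto_ip_left:
  assumes "\<And>n. s n \<in> H" "f \<in> H" "g \<in> H" "(\<lambda>n. fun_norm ip (\<lambda>x. s n x - f x)) \<longlonglongrightarrow> 0"
  shows "(\<lambda>n. ip (s n) g) \<longlonglongrightarrow> ip f g"
proof (rule LIM_zero_cancel)
  have "(\<lambda>n. fun_norm ip (\<lambda>x. s n x - f x) * fun_norm ip g) \<longlonglongrightarrow> 0"
    by (rule tendsto_mult_left_zero[OF assms(4)])
  then show "(\<lambda>n. ip (s n) g - ip f g) \<longlonglongrightarrow> 0"
  proof (rule Lim_null_comparison[rotated], intro always_eventually allI)
    fix n
    show "norm (ip (s n) g - ip f g) \<le> fun_norm ip (\<lambda>x. s n x - f x) * fun_norm ip g"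
      using ip_Cauchy_Schwarz[OF diff_mem[OF assms(1)[of n] assms(2)] assms(3)]
      by (simp add: ip_diff_left assms)
  qed
qed

lemma tendsto_ip_right:
  assumes "\<And>n. s n \<in> H" "f \<in> H" "g \<in> H" "(\<lambda>n. fun_norm ip (\<lambda>x. s n x - f x)) \<longlonglongrightarrow> 0"
  shows "(\<lambda>n. ip g (s n)) \<longlonglongrightarrow> ip g f"
  using tendsto_cnj[OF tendsto_ip_left[OF assms]]
  by (simp only: ip_commute[OF assms(3,1)] ip_commute[OF assms(3,2)])

lemma tendsto_fun_norm:
  assumes s: "\<And>n. s n \<in> H" and f: "f \<in> H" and lim: "(\<lambda>n. fun_norm ip (\<lambda>x. s n x - f x)) \<longlonglongrightarrow> 0"
  shows "(\<lambda>n. fun_norm ip (s n)) \<longlonglongrightarrow> fun_norm ip f"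
proof (rule LIM_zero_cancel, rule Lim_null_comparison[OF _ lim], intro always_eventually allI)
  fix n
  have "fun_norm ip (s n) \<le> fun_norm ip (\<lambda>x. s n x - f x) + fun_norm ip f"
    using fun_norm_triangle[OF diff_mem[OF s f] f, of n] by simp
  moreover have "fun_norm ip f \<le> fun_norm ip (\<lambda>x. s n x - f x) + fun_norm ip (s n)"
    using fun_norm_triangle[OF diff_mem[OF f s] s, of n n] fun_norm_diff_commute[OF s f, of n] by simp
  ultimately show "norm (fun_norm ip (s n) - fun_norm ip f) \<le> fun_norm ip (\<lambda>x. s n x - f x)"
    by (simp add: abs_le_iff)
qed

end

section \<open>Kernel combinations and membership by domination\<close>

context rkhs
begin

lemma kernel_hermitian: "K z w = cnj (K w z)"
  using ip_commute[OF kernel_mem kernel_mem, of w z] by (simp add: reproducing kernel_mem)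

lemma fun_norm_kernel_sq: "K w w = of_real ((fun_norm ip (\<lambda>z. K z w))\<^sup>2)"
  using ip_self[OF kernel_mem[of w]] reproducing[OF kernel_mem[of w], of w] by simp

lemma point_bound: "f \<in> H \<Longrightarrow> cmod (f w) \<le> fun_norm ip f * fun_norm ip (\<lambda>z. K z w)"
  using ip_Cauchy_Schwarz[OF _ kernel_mem[of w]] by (simp add: reproducing)

definition kernel_comb :: "(complex \<times> 'x) list \<Rightarrow> 'x \<Rightarrow> complex" where
  "kernel_comb u = (\<lambda>x. \<Sum>(c,z)\<leftarrow>u. c * K x z)"

lemma kernel_comb_Nil: "kernel_comb [] = (\<lambda>x. 0)"
  by (simp add: kernel_comb_def)

lemma kernel_comb_Cons: "kernel_comb ((c, z) # u) = (\<lambda>x. c * K x z + kernel_comb u x)"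
  by (simp add: kernel_comb_def)

lemma kernel_comb_append: "kernel_comb (u @ v) = (\<lambda>x. kernel_comb u x + kernel_comb v x)"
  by (simp add: kernel_comb_def)

lemma kernel_comb_mem: "kernel_comb u \<in> H"
proof (induction u)
  case Nil then show ?case by (simp add: kernel_comb_Nil zero_mem)
next
  case (Cons p u)
  then show ?case
    using add_mem[OF scale_mem[OF kernel_mem]] by (cases p) (simp add: kernel_comb_Cons)
qed

lemma ip_kernel_comb_right: "f \<in> H \<Longrightarrow> ip f (kernel_comb u) = (\<Sum>(c,z)\<leftarrow>u. cnj c * f z)"
proof (induction u)
  case Nil
  then show ?case using ip_scale_right[of f f 0] by (simp add: kernel_comb_Nil)
next
  case (Cons p u)
  then show ?case
    by (cases p) (simp add: kernel_comb_Cons ip_add_right ip_scale_right scale_mem kernel_mem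
      kernel_comb_mem reproducing)
qed

text \<open>By the reproducing property. Domination by a multiple of \<open>K\<close> therefore
  becomes a norm estimate on combinations of kernel functions.\<close>

lemma kernel_form_kernel: "kernel_form K u = of_real ((fun_norm ip (kernel_comb u))\<^sup>2)"
proof -
  have cnj_list: "cnj (\<Sum>x\<leftarrow>xs. h x) = (\<Sum>x\<leftarrow>xs. cnj (h x))" for h :: "'c \<Rightarrow> complex" and xs
    by (induction xs) auto
  have "cnj (kernel_form K u) = ip (kernel_comb u) (kernel_comb u)"
    unfolding ip_kernel_comb_right[OF kernel_comb_mem] unfolding kernel_form_def kernel_comb_def
      cnj_list case_prod_unfold sum_list_const_mult[symmetric]
    by (simp add: mult.assoc flip: kernel_hermitian)
  then show ?thesis
    by (metis ip_self kernel_comb_mem complex_cnj_cnj complex_cnj_complex_of_real)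
qed

text \<open>The form of \<open>rank_one h\<close> is the squared modulus of \<langle>h, F\<rangle>
  for the kernel combination F, so this is Cauchy-Schwarz. With the converse
  \<open>mem_if_rank_one_le\<close>, norm balls of \<open>H\<close> are described purely by
  domination.\<close>

lemma rank_one_le_kernel:
  assumes h: "h \<in> H" shows "rank_one h \<preceq> (\<lambda>w z. of_real ((fun_norm ip h)\<^sup>2) * K w z)"
  unfolding kernel_le_def
proof
  fix u
  have "(cmod (ip h (kernel_comb u)))\<^sup>2 \<le> (fun_norm ip h * fun_norm ip (kernel_comb u))\<^sup>2"
    by (intro power_mono ip_Cauchy_Schwarz h kernel_comb_mem) simp
  then show "Re (kernel_form (rank_one h) u)
      \<le> Re (kernel_form (\<lambda>w z. of_real ((fun_norm ip h)\<^sup>2) * K w z) u)"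
    unfolding kernel_form_mult_const kernel_form_rank_one kernel_form_kernel
    by (simp add: ip_kernel_comb_right[OF h] power_mult_distrib flip: of_real_power)
qed

text \<open>The Riesz representation argument: a minimising sequence of
  \<open>\<parallel>F\<parallel>\<^sup>2 - 2 Re \<Lambda> F\<close> over the combinations \<open>F = \<Sum> c\<^sub>i K\<^sub>z\<^sub>i\<close>, where \<open>\<Lambda> F = \<Sum> cnj c\<^sub>i h z\<^sub>i\<close>, is
  Cauchy by the parallelogram law, and its limit is \<open>h\<close>.\<close>

lemma kernel_comb_approx:
  assumes le: "rank_one h \<preceq> (\<lambda>w z. of_real C * K w z)" and C: "0 \<le> C"
  obtains us where "h \<in> H" "(\<lambda>n. fun_norm ip (\<lambda>x. kernel_comb (us n) x - h x)) \<longlonglongrightarrow> 0"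
proof -
  define N where "N u = fun_norm ip (kernel_comb u)" for u
  define \<Lambda> where "\<Lambda> u = (\<Sum>(c,z)\<leftarrow>u. cnj c * h z)" for u
  define J where "J u = (N u)\<^sup>2 - 2 * Re (\<Lambda> u)" for u
  have N0: "0 \<le> N u" for u by (simp add: N_def fun_norm_nonneg kernel_comb_mem)
  have \<Lambda>_bound: "cmod (\<Lambda> u) \<le> sqrt C * N u" for u
  proof (rule power2_le_imp_le)
    have "Re (kernel_form (rank_one h) u) \<le> Re (kernel_form (\<lambda>w z. of_real C * K w z) u)"
      using le by (simp add: kernel_le_def)
    then show "(cmod (\<Lambda> u))\<^sup>2 \<le> (sqrt C * N u)\<^sup>2"
      unfolding kernel_form_mult_const kernel_form_rank_one kernel_form_kernel
      using C by (simp add: \<Lambda>_def N_def power_mult_distrib flip: of_real_power)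
  qed (use C N0 in simp)
  have J_bound: "- C \<le> J u" for u
  proof -
    have "Re (\<Lambda> u) \<le> sqrt C * N u" using \<Lambda>_bound[of u] complex_Re_le_cmod order_trans by blast
    moreover have "0 \<le> (N u - sqrt C)\<^sup>2" by simp
    then have "2 * (sqrt C * N u) \<le> (N u)\<^sup>2 + C" using C by (simp add: power2_diff mult_ac)
    ultimately show ?thesis unfolding J_def by linarith
  qed
  define d where "d = Inf (range J)"
  have bdd: "bdd_below (range J)" using J_bound by (intro bdd_belowI[of _ "- C"]) auto
  have d_le: "d \<le> J u" for u unfolding d_def by (rule cInf_lower[OF _ bdd]) simp
  have "\<exists>u. J u < d + 1 / Suc n" for n
    using cInf_lessD[of "range J" "d + 1 / Suc n"] unfolding d_def by auto
  then obtain us where us: "\<And>n. J (us n) < d + 1 / Suc n" by metis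
  \<comment> \<open>Concatenation adds combinations, so \<open>half (u @ v)\<close> represents their
    midpoint.\<close>
  define half where "half u = map (\<lambda>(c,z). (c / 2, z :: 'x)) u" for u :: "(complex \<times> 'x) list"
  have half: "kernel_comb (half u) = (\<lambda>x. 1/2 * kernel_comb u x)" "\<Lambda> (half u) = \<Lambda> u / 2" for u
  proof -
    have "kernel_comb (half u) x = 1/2 * kernel_comb u x" for x
      by (induction u) (auto simp: half_def kernel_comb_def add_divide_distrib)
    then show "kernel_comb (half u) = (\<lambda>x. 1/2 * kernel_comb u x)" by (rule ext)
    show "\<Lambda> (half u) = \<Lambda> u / 2"
      by (induction u) (auto simp: half_def \<Lambda>_def add_divide_distrib)
  qed
  \<comment> \<open>At the midpoint \<open>J\<close> is still at least \<open>d\<close>, so the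
    parallelogram law bounds the distance of two combinations by their excess over the
    infimum.\<close>
  have par: "(fun_norm ip (\<lambda>x. kernel_comb u x - kernel_comb v x))\<^sup>2 \<le> 2 * (J u - d) + 2 * (J v - d)" for u v
  proof -
    have "J (half (u @ v)) = (fun_norm ip (\<lambda>x. kernel_comb u x + kernel_comb v x))\<^sup>2 / 4 - Re (\<Lambda> u) - Re (\<Lambda> v)"
      unfolding J_def N_def half fun_norm_scale[OF kernel_comb_mem]
      by (simp add: kernel_comb_append \<Lambda>_def power_divide add_divide_distrib)
    with d_le[of "half (u @ v)"] have
      "d \<le> (fun_norm ip (\<lambda>x. kernel_comb u x + kernel_comb v x))\<^sup>2 / 4 - Re (\<Lambda> u) - Re (\<Lambda> v)"
      by simp
    \<comment> \<open>The argument in real numbers: \<open>a\<close> and \<open>b\<close> stand for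
      the squared norms, \<open>p\<close> for the real part of the inner product, \<open>x\<close>
      and \<open>y\<close> for the real parts of \<Lambda>.\<close>
    moreover have "D \<le> 2 * (a - 2 * x - d) + 2 * (b - 2 * y - d)"
      if "d \<le> S / 4 - x - y" "S = a + b + 2 * p" "D = a + b - 2 * p" for a b S D p x y :: real
      using that by (simp add: field_simps)
    ultimately show ?thesis
      using fun_norm_add_sq[OF kernel_comb_mem kernel_comb_mem, of u v]
        fun_norm_diff_sq[OF kernel_comb_mem kernel_comb_mem, of u v]
      unfolding J_def N_def by blast
  qed
  have "\<exists>f\<in>H. (\<lambda>n. fun_norm ip (\<lambda>x. kernel_comb (us n) x - f x)) \<longlonglongrightarrow> 0"
  proof (rule complete)
    fix e :: real assume "0 < e"
    then have "e\<^sup>2 / 4 > 0" by simp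
    then obtain M where M: "1 / Suc M < e\<^sup>2 / 4" using reals_Archimedean by (metis inverse_eq_divide)
    have "fun_norm ip (\<lambda>x. kernel_comb (us m) x - kernel_comb (us n) x) < e" if "m \<ge> M" "n \<ge> M" for m n
    proof (rule power2_less_imp_less)
      have "1 / Suc m \<le> 1 / Suc M" "1 / Suc n \<le> 1 / Suc M" using that by (auto simp: field_simps)
      then have "2 * (J (us m) - d) + 2 * (J (us n) - d) < e\<^sup>2" using us[of m] us[of n] M by argo
      with par show "(fun_norm ip (\<lambda>x. kernel_comb (us m) x - kernel_comb (us n) x))\<^sup>2 < e\<^sup>2"
        by (rule order.strict_trans1)
    qed (use \<open>0 < e\<close> in simp)
    then show "\<exists>M. \<forall>m\<ge>M. \<forall>n\<ge>M. fun_norm ip (\<lambda>x. kernel_comb (us m) x - kernel_comb (us n) x) < e"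
      by blast
  qed (rule kernel_comb_mem)
  then obtain f where f: "f \<in> H" "(\<lambda>n. fun_norm ip (\<lambda>x. kernel_comb (us n) x - f x)) \<longlonglongrightarrow> 0"
    by blast
  have "f w = h w" for w
  proof -
    define k where "k = (fun_norm ip (\<lambda>z. K z w))\<^sup>2"
    have k: "0 \<le> k" by (simp add: k_def)
    have F: "(\<lambda>n. kernel_comb (us n) w) \<longlonglongrightarrow> f w"
      using tendsto_ip_left[OF kernel_comb_mem f(1) kernel_mem f(2), of w]
      by (simp add: reproducing kernel_comb_mem f)
    \<comment> \<open>The first variation at the minimum. Adding t K_w to the n-th combination
      cannot lower \<open>J\<close> by more than 1/(n+1), and the combinations converge to
      \<open>f\<close> at \<open>w\<close>.\<close>
    have ge: "0 \<le> (cmod t)\<^sup>2 * k + 2 * Re (cnj t * (f w - h w))" for t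
    proof (rule LIMSEQ_le_const)
      show "(\<lambda>n. 1 / Suc n + (cmod t)\<^sup>2 * k + 2 * Re (cnj t * (kernel_comb (us n) w - h w)))
          \<longlonglongrightarrow> (cmod t)\<^sup>2 * k + 2 * Re (cnj t * (f w - h w))"
      proof -
        have inv: "(\<lambda>n. 1 / real (Suc n)) \<longlonglongrightarrow> 0"
          using LIMSEQ_inverse_real_of_nat by (simp add: inverse_eq_divide)
        have "(\<lambda>n. 1 / Suc n + (cmod t)\<^sup>2 * k + 2 * Re (cnj t * (kernel_comb (us n) w - h w)))
          \<longlonglongrightarrow> 0 + (cmod t)\<^sup>2 * k + 2 * Re (cnj t * (f w - h w))"
          by (intro tendsto_intros inv F)
        then show ?thesis by simp
      qed
      have "0 \<le> 1 / Suc n + (cmod t)\<^sup>2 * k + 2 * Re (cnj t * (kernel_comb (us n) w - h w))" for n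
      proof -
        have "kernel_comb (us n @ [(t, w)]) = (\<lambda>x. kernel_comb (us n) x + t * K x w)"
          by (simp add: kernel_comb_append kernel_comb_Cons kernel_comb_Nil)
        then have "(N (us n @ [(t, w)]))\<^sup>2 = (N (us n))\<^sup>2 + (cmod t)\<^sup>2 * k + 2 * Re (cnj t * kernel_comb (us n) w)"
          using fun_norm_add_sq[OF kernel_comb_mem scale_mem[OF kernel_mem], of "us n" t w]
          by (simp add: N_def k_def fun_norm_scale kernel_mem power_mult_distrib ip_scale_right
              kernel_comb_mem reproducing)
        moreover have "\<Lambda> (us n @ [(t, w)]) = \<Lambda> (us n) + cnj t * h w" by (simp add: \<Lambda>_def)
        ultimately have "J (us n @ [(t, w)]) = J (us n) + (cmod t)\<^sup>2 * k + 2 * Re (cnj t * (kernel_comb (us n) w - h w))"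
          by (simp add: J_def algebra_simps)
        then show ?thesis using d_le[of "us n @ [(t, w)]"] us[of n] by linarith
      qed
      then show "\<exists>N. \<forall>n\<ge>N. 0 \<le> 1 / Suc n + (cmod t)\<^sup>2 * k + 2 * Re (cnj t * (kernel_comb (us n) w - h w))"
        by blast
    qed
    \<comment> \<open>Take t = - s (f w - h w). Since s k \<le> 1, the quadratic term is at most s
      E, while the linear term is - 2 s E; this forces E = 0.\<close>
    define s where "s = 1 / (k + 1)"
    define E where "E = (cmod (f w - h w))\<^sup>2"
    have s: "s > 0" "s * k \<le> 1" using k by (auto simp: s_def)
    have "Re (cnj (- of_real s * e) * e) = - s * (cmod e)\<^sup>2" for e
      unfolding cmod_power2 by (simp add: algebra_simps power2_eq_square)
    then have "Re (cnj (- of_real s * (f w - h w)) * (f w - h w)) = - s * E"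
      unfolding E_def by blast
    moreover have "(cmod (- of_real s * (f w - h w)))\<^sup>2 = s\<^sup>2 * E"
      by (simp add: E_def norm_mult power_mult_distrib)
    ultimately have "0 \<le> s\<^sup>2 * E * k - 2 * (s * E)"
      using ge[of "- of_real s * (f w - h w)"] by simp
    also have "s\<^sup>2 * E * k = (s * E) * (s * k)" by (simp add: power2_eq_square)
    also have "\<dots> \<le> (s * E) * 1" using s by (intro mult_left_mono) (auto simp: E_def)
    finally have "s * E \<le> 0" by (simp add: mult.commute)
    then have "E \<le> 0" using s by (simp add: mult_le_0_iff)
    then show ?thesis by (simp add: E_def)
  qed
  then have "f = h" by (rule ext)
  with f that show ?thesis by blast
qed

text \<open>Membership is the Riesz argument. For the norm, domination bounds \<langle>h, F\<rangle>
  by sqrt C \<parallel>F\<parallel> on combinations F; letting F tend to \<open>h\<close> and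
  cancelling one factor \<parallel>h\<parallel> gives the bound.\<close>

lemma mem_if_rank_one_le:
  assumes "rank_one h \<preceq> (\<lambda>w z. of_real C * K w z)" "0 \<le> C"
  shows "h \<in> H" "fun_norm ip h \<le> sqrt C"
proof -
  obtain us where us: "h \<in> H" "(\<lambda>n. fun_norm ip (\<lambda>x. kernel_comb (us n) x - h x)) \<longlonglongrightarrow> 0"
    using kernel_comb_approx[OF assms] by blast
  show h: "h \<in> H" by (rule us)
  have "cmod (ip h (kernel_comb u)) \<le> sqrt C * fun_norm ip (kernel_comb u)" for u
  proof (rule power2_le_imp_le)
    have "Re (kernel_form (rank_one h) u) \<le> Re (kernel_form (\<lambda>w z. of_real C * K w z) u)"
      using assms(1) by (simp add: kernel_le_def)
    then show "(cmod (ip h (kernel_comb u)))\<^sup>2 \<le> (sqrt C * fun_norm ip (kernel_comb u))\<^sup>2"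
      unfolding kernel_form_mult_const kernel_form_rank_one kernel_form_kernel
      using assms(2) by (simp add: ip_kernel_comb_right[OF h] power_mult_distrib flip: of_real_power)
  qed (simp add: assms(2) fun_norm_nonneg kernel_comb_mem)
  then have "cmod (ip h h) \<le> sqrt C * fun_norm ip h"
    by (intro LIMSEQ_le[OF tendsto_norm[OF tendsto_ip_right[OF kernel_comb_mem h h us(2)]]
      tendsto_mult_left[OF tendsto_fun_norm[OF kernel_comb_mem h us(2)]]]) blast
  then have "fun_norm ip h * fun_norm ip h \<le> sqrt C * fun_norm ip h"
    unfolding ip_self[OF h] by (simp add: power2_eq_square flip: of_real_mult)
  then show "fun_norm ip h \<le> sqrt C"
    using fun_norm_nonneg[OF h] assms(2) by (cases "fun_norm ip h = 0") auto
qed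

end

lemma tendsto_sum_list:
  fixes f :: "'b \<Rightarrow> 'a \<Rightarrow> 'c::topological_monoid_add"
  shows "(\<And>x. x \<in> set xs \<Longrightarrow> (f x \<longlongrightarrow> l x) F) \<Longrightarrow> ((\<lambda>n. \<Sum>x\<leftarrow>xs. f x n) \<longlongrightarrow> (\<Sum>x\<leftarrow>xs. l x)) F"
  by (induction xs) (auto intro!: tendsto_add)

section \<open>Bounded and compact composition operators\<close>

context rkhs
begin

text \<open>Pulling back \<open>rank_one f\<close> \<preceq> \<parallel>f\<parallel>^2 K along
  \<phi> and inserting the hypothesis bounds \<open>rank_one (f \<circ> \<phi>)\<close> by a
  multiple of \<open>K\<close>, which is the criterion for membership with a norm bound.\<close>

lemma composition_bounded:
  assumes le: "(\<lambda>w z. K (\<phi> w) (\<phi> z)) \<preceq> (\<lambda>w z. of_real M * K w z)" "0 \<le> M" and f: "f \<in> H"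
  shows "f \<circ> \<phi> \<in> H" "fun_norm ip (f \<circ> \<phi>) \<le> sqrt M * fun_norm ip f"
proof -
  have 1: "rank_one (f \<circ> \<phi>) \<preceq> (\<lambda>w z. of_real ((fun_norm ip f)\<^sup>2) * K (\<phi> w) (\<phi> z))"
    using kernel_le_comp[OF rank_one_le_kernel[OF f], of \<phi>] by (simp add: o_def)
  have 2: "(\<lambda>w z. of_real ((fun_norm ip f)\<^sup>2) * K (\<phi> w) (\<phi> z)) \<preceq>
      (\<lambda>w z. of_real ((fun_norm ip f)\<^sup>2 * M) * K w z)"
    using kernel_le_scale[OF le(1), of "(fun_norm ip f)\<^sup>2"] by (simp add: mult.assoc)
  have 3: "0 \<le> (fun_norm ip f)\<^sup>2 * M" using le(2) by simp
  show "f \<circ> \<phi> \<in> H" by (rule mem_if_rank_one_le(1)[OF kernel_le_trans[OF 1 2] 3])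
  show "fun_norm ip (f \<circ> \<phi>) \<le> sqrt M * fun_norm ip f"
    using mem_if_rank_one_le(2)[OF kernel_le_trans[OF 1 2] 3] fun_norm_nonneg[OF f]
    by (simp add: real_sqrt_mult mult.commute o_def)
qed

text \<open>Evaluated on a combination F, domination bounds |\<langle>h, F\<rangle>|^2 by
  \<parallel>f\<parallel>^2 (\<epsilon> \<parallel>F\<parallel>^2 + \<Sum> |\<langle>g,
  F\<rangle>|^2), where h is the composite. Letting F tend to h turns the left side into
  \<parallel>h\<parallel>^4; this avoids the adjoint of the composition operator.\<close>

lemma composition_norm_power4:
  assumes le: "(\<lambda>w z. K (\<phi> w) (\<phi> z)) \<preceq> (\<lambda>w z. of_real \<epsilon> * K w z + (\<Sum>g\<leftarrow>gs. rank_one g w z))"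
    and gs: "set gs \<subseteq> H" and f: "f \<in> H" and h: "f \<circ> \<phi> \<in> H"
  shows "(fun_norm ip (f \<circ> \<phi>)) ^ 4 \<le> (fun_norm ip f)\<^sup>2 *
    (\<epsilon> * (fun_norm ip (f \<circ> \<phi>))\<^sup>2 + (\<Sum>g\<leftarrow>gs. (cmod (ip g (f \<circ> \<phi>)))\<^sup>2))"
proof -
  let ?h = "f \<circ> \<phi>"
  have 1: "rank_one ?h \<preceq> (\<lambda>w z. of_real ((fun_norm ip f)\<^sup>2) * K (\<phi> w) (\<phi> z))"
    using kernel_le_comp[OF rank_one_le_kernel[OF f], of \<phi>] by (simp add: o_def)
  have 2: "rank_one ?h \<preceq> (\<lambda>w z. of_real ((fun_norm ip f)\<^sup>2) *
      (of_real \<epsilon> * K w z + (\<Sum>g\<leftarrow>gs. rank_one g w z)))"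
    by (rule kernel_le_trans[OF 1 kernel_le_scale[OF le]]) simp
  have Re_list: "Re (\<Sum>x\<leftarrow>xs. of_real (h x)) = (\<Sum>x\<leftarrow>xs. h x)" for h :: "('x \<Rightarrow> complex) \<Rightarrow> real" and xs
    by (induction xs) auto
  have comb: "(cmod (ip ?h (kernel_comb u)))\<^sup>2 \<le> (fun_norm ip f)\<^sup>2 *
    (\<epsilon> * (fun_norm ip (kernel_comb u))\<^sup>2 + (\<Sum>g\<leftarrow>gs. (cmod (ip g (kernel_comb u)))\<^sup>2))" for u
  proof -
    have rk: "kernel_form (rank_one g) u = of_real ((cmod (ip g (kernel_comb u)))\<^sup>2)" if "g \<in> H" for g
      unfolding kernel_form_rank_one ip_kernel_comb_right[OF that] ..
    have "(\<Sum>g\<leftarrow>gs. kernel_form (rank_one g) u) = (\<Sum>g\<leftarrow>gs. of_real ((cmod (ip g (kernel_comb u)))\<^sup>2))"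
      using gs by (intro arg_cong[where f = sum_list] map_cong refl rk) auto
    then have r: "kernel_form (\<lambda>w z. of_real ((fun_norm ip f)\<^sup>2) *
      (of_real \<epsilon> * K w z + (\<Sum>g\<leftarrow>gs. rank_one g w z))) u = of_real ((fun_norm ip f)\<^sup>2) *
      (of_real \<epsilon> * of_real ((fun_norm ip (kernel_comb u))\<^sup>2) +
        (\<Sum>g\<leftarrow>gs. of_real ((cmod (ip g (kernel_comb u)))\<^sup>2)))"
      unfolding kernel_form_mult_const kernel_form_add kernel_form_sum_list kernel_form_kernel by simp
    have "Re (kernel_form (rank_one ?h) u) \<le> Re (kernel_form (\<lambda>w z. of_real ((fun_norm ip f)\<^sup>2) *
      (of_real \<epsilon> * K w z + (\<Sum>g\<leftarrow>gs. rank_one g w z))) u)"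
      using 2 by (simp add: kernel_le_def)
    then show ?thesis
      unfolding r rk[OF h] by (simp add: Re_list del: of_real_power)
  qed
  have "rank_one ?h \<preceq> (\<lambda>w z. of_real ((fun_norm ip ?h)\<^sup>2) * K w z)" by (rule rank_one_le_kernel[OF h])
  then obtain us where us: "(\<lambda>n. fun_norm ip (\<lambda>x. kernel_comb (us n) x - ?h x)) \<longlonglongrightarrow> 0"
    by (rule kernel_comb_approx) simp
  note lim = tendsto_ip_right[OF kernel_comb_mem h _ us]
  have "(cmod (ip ?h ?h))\<^sup>2 \<le> (fun_norm ip f)\<^sup>2 *
    (\<epsilon> * (fun_norm ip ?h)\<^sup>2 + (\<Sum>g\<leftarrow>gs. (cmod (ip g ?h))\<^sup>2))"
  proof (rule LIMSEQ_le)
    show "(\<lambda>n. (cmod (ip ?h (kernel_comb (us n))))\<^sup>2) \<longlonglongrightarrow> (cmod (ip ?h ?h))\<^sup>2"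
      by (intro tendsto_intros lim h)
    show "(\<lambda>n. (fun_norm ip f)\<^sup>2 * (\<epsilon> * (fun_norm ip (kernel_comb (us n)))\<^sup>2 +
        (\<Sum>g\<leftarrow>gs. (cmod (ip g (kernel_comb (us n))))\<^sup>2)))
      \<longlonglongrightarrow> (fun_norm ip f)\<^sup>2 * (\<epsilon> * (fun_norm ip ?h)\<^sup>2 + (\<Sum>g\<leftarrow>gs. (cmod (ip g ?h))\<^sup>2))"
      using gs by (intro tendsto_intros tendsto_sum_list tendsto_fun_norm[OF kernel_comb_mem h us] lim) auto
  qed (use comb in blast)
  moreover have "(cmod (ip ?h ?h))\<^sup>2 = fun_norm ip ?h ^ 4"
    unfolding ip_self[OF h] by (simp add: norm_power flip: power_mult)
  ultimately show ?thesis by simp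
qed

text \<open>For each \<epsilon> = 1/(j+1) only finitely many functionals enter the fourth power
  estimate, countably many in all. Along a subsequence on which all of them converge, the estimate
  applied to differences makes the composites Cauchy.\<close>

theorem compact_composition:
  assumes cd: "compactly_dominated (\<lambda>w z. K (\<phi> w) (\<phi> z)) K"
  shows "compact_operator_on H ip (composition_operator \<phi>)"
proof -
  let ?k = "\<lambda>w z. K (\<phi> w) (\<phi> z)"
  \<comment> \<open>Compact domination with \<epsilon> = 1, after adding up the constants of the
    rank-one parts, gives plain domination and hence boundedness.\<close>
  obtain M where M: "0 \<le> M" "?k \<preceq> (\<lambda>w z. of_real M * K w z)"
  proof -
    obtain gs where gs: "?k \<preceq> (\<lambda>w z. of_real 1 * K w z + (\<Sum>g\<leftarrow>gs. rank_one g w z))"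
      "\<And>g. g \<in> set gs \<Longrightarrow> \<exists>C\<ge>0. rank_one g \<preceq> (\<lambda>w z. of_real C * K w z)"
      using compactly_dominatedE[OF cd zero_less_one] by blast
    then have "\<forall>g\<in>set gs. \<exists>C. 0 \<le> C \<and> rank_one g \<preceq> (\<lambda>w z. of_real C * K w z)" by blast
    from bchoice[OF this] obtain C where C: "\<And>g. g \<in> set gs \<Longrightarrow> 0 \<le> C g"
      "\<And>g. g \<in> set gs \<Longrightarrow> rank_one g \<preceq> (\<lambda>w z. of_real (C g) * K w z)"
      by blast
    have "(\<lambda>w z. of_real 1 * K w z + (\<Sum>g\<leftarrow>gs. rank_one g w z)) \<preceq>
        (\<lambda>w z. of_real 1 * K w z + (\<Sum>g\<leftarrow>gs. of_real (C g) * K w z))"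
      by (intro kernel_le_add kernel_le_refl kernel_le_sum_list C)
    moreover have "(\<Sum>g\<leftarrow>gs. of_real (C g) * a) = of_real (\<Sum>g\<leftarrow>gs. C g) * a" for a :: complex
      by (induction gs) (auto simp: distrib_right)
    then have "(\<lambda>w z. of_real 1 * K w z + (\<Sum>g\<leftarrow>gs. of_real (C g) * K w z))
        = (\<lambda>w z. of_real (1 + (\<Sum>g\<leftarrow>gs. C g)) * K w z)"
      by (simp add: distrib_right)
    ultimately have "?k \<preceq> (\<lambda>w z. of_real (1 + (\<Sum>g\<leftarrow>gs. C g)) * K w z)"
      using kernel_le_trans[OF gs(1)] by simp
    moreover have "0 \<le> (\<Sum>g\<leftarrow>gs. C g)" using C(1) by (intro sum_list_nonneg) auto
    ultimately show ?thesis using that[of "1 + (\<Sum>g\<leftarrow>gs. C g)"] by simp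
  qed
  note bounded = composition_bounded[OF M(2,1)]
  have approx: "\<exists>gs. set gs \<subseteq> H \<and> ?k \<preceq> (\<lambda>w z. of_real \<epsilon> * K w z + (\<Sum>g\<leftarrow>gs. rank_one g w z))"
    if \<epsilon>: "\<epsilon> > 0" for \<epsilon>
  proof -
    obtain gs where gs: "?k \<preceq> (\<lambda>w z. of_real \<epsilon> * K w z + (\<Sum>g\<leftarrow>gs. rank_one g w z))"
      "\<And>g. g \<in> set gs \<Longrightarrow> \<exists>C\<ge>0. rank_one g \<preceq> (\<lambda>w z. of_real C * K w z)"
      using compactly_dominatedE[OF cd \<epsilon>] by blast
    then have "set gs \<subseteq> H" using mem_if_rank_one_le(1) by blast
    with gs(1) show ?thesis by blast
  qed
  have "\<exists>gs. set gs \<subseteq> H \<and> ?k \<preceq> (\<lambda>w z. of_real (1 / Suc j) * K w z + (\<Sum>g\<leftarrow>gs. rank_one g w z))" for j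
    by (rule approx) simp
  then have "\<forall>j. \<exists>gs. set gs \<subseteq> H \<and> ?k \<preceq> (\<lambda>w z. of_real (1 / Suc j) * K w z + (\<Sum>g\<leftarrow>gs. rank_one g w z))"
    by blast
  from choice[OF this] obtain gs where gs: "\<And>j. set (gs j) \<subseteq> H"
    "\<And>j. ?k \<preceq> (\<lambda>w z. of_real (1 / Suc j) * K w z + (\<Sum>g\<leftarrow>gs j. rank_one g w z))"
    by blast
  have "\<exists>g\<in>H. \<exists>r. strict_mono r \<and> (\<lambda>n. fun_norm ip (\<lambda>x. composition_operator \<phi> (s (r n)) x - g x)) \<longlonglongrightarrow> 0"
    if s: "\<And>n. s n \<in> H" "\<And>n. fun_norm ip (s n) \<le> 1" for s :: "nat \<Rightarrow> 'x \<Rightarrow> complex"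
  proof -
    define h where "h n = s n \<circ> \<phi>" for n
    have h: "h n \<in> H" for n by (simp add: h_def bounded s)
    have hM: "fun_norm ip (h n) \<le> sqrt M" for n
      using bounded(2)[OF s(1), of n] s(2)[of n] mult_left_mono[OF s(2)[of n], of "sqrt M"] M(1)
      by (simp add: h_def)
    define G where "G = (\<Union>j. set (gs j))"
    have G: "G \<subseteq> H" "countable G" using gs(1) by (auto simp: G_def intro: countable_finite)
    \<comment> \<open>Dividing by \<parallel>g\<parallel> + 1 makes the bound uniform over
      \<open>G\<close>, as the diagonal argument requires; the positive factor is removed again in
      \<open>conv\<close>.\<close>
    obtain r where r: "strict_mono (r :: nat \<Rightarrow> nat)"
      "\<And>g. g \<in> G \<Longrightarrow> \<exists>l. (\<lambda>n. ip g (h (r n)) / of_real (fun_norm ip g + 1)) \<longlonglongrightarrow> l"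
    proof (rule function_convergent_subsequence[OF G(2),
          where f = "\<lambda>n g. ip g (h n) / of_real (fun_norm ip g + 1)"])
      show "norm (ip g (h n) / of_real (fun_norm ip g + 1)) \<le> sqrt M" if "g \<in> G" for g n
      proof -
        have g: "g \<in> H" using that G by auto
        then have pos: "0 < fun_norm ip g + 1" using fun_norm_nonneg[OF g] by linarith
        have "cmod (ip g (h n)) \<le> fun_norm ip g * fun_norm ip (h n)" by (rule ip_Cauchy_Schwarz[OF g h])
        also have "\<dots> \<le> (fun_norm ip g + 1) * sqrt M"
          using hM fun_norm_nonneg g h by (intro mult_mono) auto
        finally have "cmod (ip g (h n)) / (fun_norm ip g + 1) \<le> sqrt M"
          using pos by (simp only: pos_divide_le_eq mult.commute)
        then show ?thesis using pos by (simp only: norm_divide norm_of_real abs_of_pos)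
      qed
    qed blast
    have conv: "Cauchy (\<lambda>n. ip g (h (r n)))" if gG: "g \<in> G" for g
    proof -
      obtain l where l: "(\<lambda>n. ip g (h (r n)) / of_real (fun_norm ip g + 1)) \<longlonglongrightarrow> l" using r(2)[OF gG] by blast
      have "fun_norm ip g + 1 > 0" using fun_norm_nonneg[of g] gG G by force
      then have "complex_of_real (fun_norm ip g + 1) \<noteq> 0" by (metis of_real_eq_0_iff less_irrefl)
      then have "(\<lambda>n. ip g (h (r n))) \<longlonglongrightarrow> l * of_real (fun_norm ip g + 1)"
        using tendsto_mult_right[OF l, of "of_real (fun_norm ip g + 1)"] by simp
      then show ?thesis by (rule LIMSEQ_imp_Cauchy)
    qed
    have "\<exists>g\<in>H. (\<lambda>n. fun_norm ip (\<lambda>x. h (r n) x - g x)) \<longlonglongrightarrow> 0"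
    proof (rule complete)
      fix e :: real assume e: "0 < e"
      define D where "D m n = (\<lambda>x. h (r m) x - h (r n) x)" for m n
      have D: "D m n \<in> H" for m n by (simp add: D_def diff_mem h)
      have DM: "fun_norm ip (D m n) \<le> 2 * sqrt M" for m n
        using fun_norm_triangle_diff[OF h zero_mem h, of "r m" "r n"] hM[of "r m"] hM[of "r n"]
          fun_norm_diff_commute[OF zero_mem h, of "r n"] by (simp add: D_def)
      have S: "fun_norm ip (\<lambda>x. s (r m) x - s (r n) x) \<le> 2" for m n
        using fun_norm_triangle_diff[OF s(1) zero_mem s(1), of "r m" "r n"] s(2)[of "r m"] s(2)[of "r n"]
          fun_norm_diff_commute[OF zero_mem s(1), of "r n"] by simp
      \<comment> \<open>The \<epsilon> part of \<open>key\<close> equals 16 M/(j+1) and shall stay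
        below e^4/2; the added 1 keeps the divisor positive.\<close>
      obtain j where j: "(16 * M + 1) / Suc j < e ^ 4 / 2"
      proof -
        have "0 < e ^ 4 / 2 / (16 * M + 1)" using e M(1) by simp
        then obtain j where "1 / Suc j < e ^ 4 / 2 / (16 * M + 1)"
          using reals_Archimedean by (metis inverse_eq_divide)
        then show ?thesis using M(1) that[of j] by (simp add: field_simps)
      qed
      \<comment> \<open>Differences of elements of the unit ball have norm at most 2, and their
        composites at most 2 sqrt M.\<close>
      have key: "fun_norm ip (D m n) ^ 4 \<le> 4 * (1 / Suc j * (2 * sqrt M)\<^sup>2 +
          (\<Sum>g\<leftarrow>gs j. (cmod (ip g (D m n)))\<^sup>2))" for m n
      proof -
        have eq: "(\<lambda>x. s (r m) x - s (r n) x) \<circ> \<phi> = D m n" by (auto simp: D_def h_def)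
        have "fun_norm ip (D m n) ^ 4 \<le> (fun_norm ip (\<lambda>x. s (r m) x - s (r n) x))\<^sup>2 *
          (1 / Suc j * (fun_norm ip (D m n))\<^sup>2 + (\<Sum>g\<leftarrow>gs j. (cmod (ip g (D m n)))\<^sup>2))"
          using composition_norm_power4[OF gs(2)[of j] gs(1) diff_mem[OF s(1) s(1)], of "r m" "r n"]
          unfolding eq using D by blast
        also have "\<dots> \<le> 2\<^sup>2 * (1 / Suc j * (2 * sqrt M)\<^sup>2 + (\<Sum>g\<leftarrow>gs j. (cmod (ip g (D m n)))\<^sup>2))"
          using S DM D fun_norm_nonneg diff_mem[OF s(1) s(1)]
          by (intro mult_mono add_mono power_mono order_refl add_nonneg_nonneg sum_list_nonneg) auto
        finally show ?thesis by simp
      qed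
      \<comment> \<open>With this \<delta> the functionals contribute at most k \<delta>^2 = e^4/8,
        hence e^4/2 after the factor 4 in \<open>key\<close>. The added 1 covers an empty
        list.\<close>
      define k where "k = real (length (gs j)) + 1"
      have k: "k > 0" by (simp add: k_def)
      define \<delta> where "\<delta> = sqrt (e ^ 4 / 8 / k)"
      have \<delta>: "\<delta> > 0" using e k by (simp add: \<delta>_def)
      have "\<forall>g\<in>set (gs j). \<exists>L. \<forall>m\<ge>L. \<forall>n\<ge>L. cmod (ip g (D m n)) < \<delta>"
      proof
        fix g assume g: "g \<in> set (gs j)"
        then have "Cauchy (\<lambda>n. ip g (h (r n)))" by (intro conv) (auto simp: G_def)
        then obtain L where "\<forall>m\<ge>L. \<forall>n\<ge>L. dist (ip g (h (r m))) (ip g (h (r n))) < \<delta>"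
          using \<delta> metric_CauchyD by blast
        moreover have "dist (ip g (h (r m))) (ip g (h (r n))) = cmod (ip g (D m n))" for m n
          using subsetD[OF gs(1) g] by (simp add: D_def dist_norm ip_diff_right h)
        ultimately show "\<exists>L. \<forall>m\<ge>L. \<forall>n\<ge>L. cmod (ip g (D m n)) < \<delta>" by auto
      qed
      from bchoice[OF this] obtain L where L: "\<forall>g\<in>set (gs j). \<forall>m\<ge>L g. \<forall>n\<ge>L g. cmod (ip g (D m n)) < \<delta>" by blast
      define N where "N = Max (insert 0 (L ` set (gs j)))"
      have N: "L g \<le> N" if "g \<in> set (gs j)" for g using that by (auto simp: N_def)
      have "fun_norm ip (D m n) < e" if "m \<ge> N" "n \<ge> N" for m n
      proof (rule power_less_imp_less_base)
        have "(\<Sum>g\<leftarrow>gs j. (cmod (ip g (D m n)))\<^sup>2) \<le> (\<Sum>g\<leftarrow>gs j. \<delta>\<^sup>2)"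
        proof (rule sum_list_mono)
          fix g assume g: "g \<in> set (gs j)"
          then have "m \<ge> L g" "n \<ge> L g" using N[OF g] that by auto
          then show "(cmod (ip g (D m n)))\<^sup>2 \<le> \<delta>\<^sup>2" using L g by (intro power_mono) (auto intro: less_imp_le)
        qed
        also have "\<dots> = length (gs j) * \<delta>\<^sup>2" by (simp add: sum_list_triv)
        also have "\<dots> \<le> k * \<delta>\<^sup>2" by (intro mult_right_mono) (auto simp: k_def)
        also have "\<dots> = e ^ 4 / 8" using e k by (simp add: \<delta>_def)
        finally have 1: "(\<Sum>g\<leftarrow>gs j. (cmod (ip g (D m n)))\<^sup>2) \<le> e ^ 4 / 8" .
        have "4 * (1 / Suc j * (2 * sqrt M)\<^sup>2) = 16 * M / Suc j" using M(1) by (simp add: power_mult_distrib)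
        also have "\<dots> \<le> (16 * M + 1) / Suc j" by (simp add: divide_right_mono)
        also note j
        finally have 2: "4 * (1 / Suc j * (2 * sqrt M)\<^sup>2) < e ^ 4 / 2" .
        have "4 * (1 / Suc j * (2 * sqrt M)\<^sup>2 + (\<Sum>g\<leftarrow>gs j. (cmod (ip g (D m n)))\<^sup>2)) < e ^ 4"
          using 1 2 by argo
        with key[of m n] show "fun_norm ip (D m n) ^ 4 < e ^ 4" by (rule order.strict_trans1)
      qed (use e in simp)
      then show "\<exists>N. \<forall>m\<ge>N. \<forall>n\<ge>N. fun_norm ip (\<lambda>x. h (r m) x - h (r n) x) < e"
        unfolding D_def by blast
    qed (rule h)
    then show ?thesis using r(1) by (auto simp: h_def composition_operator_def)
  qed
  then show ?thesis
    unfolding compact_operator_on_def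
    using bounded(1)[unfolded o_def] by (auto simp: composition_operator_def o_def)
qed

end

section \<open>Complex Hilbert spaces\<close>

lemma cinner_add_right: "x \<bullet>\<^sub>C (y + z) = x \<bullet>\<^sub>C y + x \<bullet>\<^sub>C z" for x :: "'a::chilbert_space"
  by (simp add: cinner_commute[of x] cinner_add_left)

lemma cinner_scaleC_right: "x \<bullet>\<^sub>C (a *\<^sub>C y) = cnj a * (x \<bullet>\<^sub>C y)" for x :: "'a::chilbert_space"
  by (simp add: cinner_commute[of x] cinner_scaleC_left)

lemma cinner_zero_left [simp]: "0 \<bullet>\<^sub>C x = 0" for x :: "'a::chilbert_space"
  using cinner_add_left[of 0 0 x] by simp

lemma cinner_zero_right [simp]: "x \<bullet>\<^sub>C 0 = 0" for x :: "'a::chilbert_space"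
  using cinner_add_right[of x 0 0] by simp

lemma cinner_diff_left: "(x - y) \<bullet>\<^sub>C z = x \<bullet>\<^sub>C z - y \<bullet>\<^sub>C z" for x :: "'a::chilbert_space"
  using cinner_add_left[of "x - y" y z] by simp

lemma cinner_diff_right: "z \<bullet>\<^sub>C (x - y) = z \<bullet>\<^sub>C x - z \<bullet>\<^sub>C y" for x :: "'a::chilbert_space"
  using cinner_add_right[of z "x - y" y] by simp

lemma scaleC_zero_left [simp]: "0 *\<^sub>C x = 0" for x :: "'a::chilbert_space"
  using scaleC_add_left[of 0 0 x] by simp

lemma scaleC_one [simp]: "1 *\<^sub>C x = x" for x :: "'a::chilbert_space"
  using scaleR_scaleC[of 1 x] by simp

lemma scaleC_diff_right: "a *\<^sub>C (x - y) = a *\<^sub>C x - a *\<^sub>C y" for x :: "'a::chilbert_space"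
  using scaleC_add_right[of a "x - y" y] by (simp add: algebra_simps)

lemma cinner_eqI:
  assumes "\<And>a. x \<bullet>\<^sub>C a = y \<bullet>\<^sub>C a" shows "x = (y :: 'a::chilbert_space)"
proof -
  have "(x - y) \<bullet>\<^sub>C (x - y) = 0" by (simp add: cinner_diff_left assms)
  then have "complex_of_real ((norm (x - y))\<^sup>2) = 0" by (simp only: cinner_self)
  then show ?thesis by simp
qed

lemma norm_scaleC: "norm (a *\<^sub>C x) = cmod a * norm x" for x :: "'a::chilbert_space"
proof -
  have "complex_of_real ((norm (a *\<^sub>C x))\<^sup>2) = of_real ((cmod a)\<^sup>2) * of_real ((norm x)\<^sup>2)"
    unfolding cinner_self[symmetric] complex_norm_square
    by (simp add: cinner_scaleC_left cinner_scaleC_right mult_ac)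
  then have "(norm (a *\<^sub>C x))\<^sup>2 = (cmod a * norm x)\<^sup>2"
    unfolding of_real_mult[symmetric] of_real_eq_iff power_mult_distrib .
  then show ?thesis by (rule power2_eq_imp_eq) simp_all
qed

lemma norm_add_sq_cinner: "(norm (x + y))\<^sup>2 = (norm x)\<^sup>2 + (norm y)\<^sup>2 + 2 * Re (x \<bullet>\<^sub>C y)"
  for x :: "'a::chilbert_space"
proof -
  have "Re (y \<bullet>\<^sub>C x) = Re (x \<bullet>\<^sub>C y)" by (subst cinner_commute) simp
  then have "Re ((x + y) \<bullet>\<^sub>C (x + y)) = Re (x \<bullet>\<^sub>C x) + Re (y \<bullet>\<^sub>C y) + 2 * Re (x \<bullet>\<^sub>C y)"
    by (simp add: cinner_add_left cinner_add_right)
  then show ?thesis by (simp only: cinner_self Re_complex_of_real)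
qed

lemma cinner_Cauchy_Schwarz: "cmod (x \<bullet>\<^sub>C y) \<le> norm x * norm y" for x :: "'a::chilbert_space"
proof (cases "y = 0")
  case False
  then have pos: "norm y > 0" by simp
  define a where "a = - (x \<bullet>\<^sub>C y) / of_real ((norm y)\<^sup>2)"
  have "0 \<le> (norm (x + a *\<^sub>C y))\<^sup>2" by simp
  also have "\<dots> = (norm x)\<^sup>2 + (cmod a * norm y)\<^sup>2 + 2 * Re (cnj a * (x \<bullet>\<^sub>C y))"
    by (simp add: norm_add_sq_cinner norm_scaleC cinner_scaleC_right)
  also have "cnj a * (x \<bullet>\<^sub>C y) = of_real (- ((cmod (x \<bullet>\<^sub>C y))\<^sup>2 / (norm y)\<^sup>2))"
    unfolding a_def of_real_minus of_real_divide complex_norm_square by (simp add: mult.commute)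
  also have "cmod a * norm y = cmod (x \<bullet>\<^sub>C y) / norm y"
    using pos by (simp add: a_def norm_divide norm_mult power2_eq_square)
  finally have "(cmod (x \<bullet>\<^sub>C y) / norm y)\<^sup>2 \<le> (norm x)\<^sup>2"
    by (simp only: Re_complex_of_real) (simp add: power_divide)
  then have "cmod (x \<bullet>\<^sub>C y) / norm y \<le> norm x" using power2_le_imp_le norm_ge_zero by blast
  then show ?thesis using pos by (simp add: field_simps)
qed simp

lemma clinear_diff: "clinear A \<Longrightarrow> A (x - y) = A x - A y"
  unfolding clinear_def by (metis add_diff_cancel_right' diff_add_cancel)

lemma clinear_zero: "clinear A \<Longrightarrow> A 0 = 0"
  using clinear_diff[of A 0 0] by simp

text \<open>Homogeneity is the line formula at the origin. For additivity, x + y is the midpoint of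
  2x and 2y, so the formula on the line through these two points at parameter 1/2 applies.\<close>

lemma clinear_of_affine_on_lines:
  fixes \<phi> :: "'a::chilbert_space \<Rightarrow> 'b::chilbert_space"
  assumes line: "\<And>z w \<xi>. \<phi> (z + \<xi> *\<^sub>C w) = \<phi> z + \<xi> *\<^sub>C (\<phi> (z + w) - \<phi> z)"
  shows "clinear (\<lambda>x. \<phi> x - \<phi> 0)"
proof -
  define A where "A x = \<phi> x - \<phi> 0" for x
  have scale: "A (\<xi> *\<^sub>C x) = \<xi> *\<^sub>C A x" for \<xi> x
    using line[of 0 \<xi> x] by (simp add: A_def)
  have add: "A (x + y) = A x + A y" for x y
  proof -
    define x' y' where "x' = 2 *\<^sub>C x" and "y' = 2 *\<^sub>C y"
    have x: "(1/2) *\<^sub>C x' = x" and y: "(1/2) *\<^sub>C y' = y"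
      by (simp_all add: x'_def y'_def scaleC_scaleC)
    have "x' = x + x" using scaleC_add_left[of 1 1 x] by (simp add: x'_def)
    then have mid: "x' + (1/2) *\<^sub>C (y' - x') = x + y"
      unfolding scaleC_diff_right x y by simp
    have "A (x + y) = \<phi> x' + (1/2) *\<^sub>C (\<phi> (x' + (y' - x')) - \<phi> x') - \<phi> 0"
      using line[of x' "1/2" "y' - x'"] unfolding mid by (simp add: A_def)
    also have "\<dots> = A x' + (1/2) *\<^sub>C (A y' - A x')" by (simp add: A_def)
    also have "\<dots> = A x' + (A y - A x)" by (simp only: scaleC_diff_right scale[symmetric] x y)
    also have "A x' = A x + A x" unfolding x'_def scale
      using scaleC_add_left[of 1 1 "A x"] by simp
    finally show ?thesis by simp
  qed
  show ?thesis using scale add unfolding clinear_def A_def by blast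
qed

lemma clinear_imp_linear: "clinear A \<Longrightarrow> linear A"
  by (intro linearI) (auto simp: clinear_def scaleR_scaleC)

lemma compact_operator_bounded_linear:
  assumes "compact_operator A" shows "bounded_linear A"
proof -
  have lin: "linear A" using assms by (simp add: compact_operator_def clinear_imp_linear)
  have "bounded (A ` cball 0 1)"
    using assms bounded_subset[OF compact_imp_bounded closure_subset]
    by (auto simp: compact_operator_def)
  then obtain B where "\<forall>y\<in>A ` cball 0 1. norm y \<le> B" unfolding bounded_iff by blast
  then have B: "norm (A x) \<le> B" if "norm x \<le> 1" for x using that by simp
  have "norm (A x) \<le> norm x * B" for x
  proof (cases "x = 0")
    case True then show ?thesis using linear_0[OF lin] by simp
  next
    case False
    have "norm (A (x /\<^sub>R norm x)) \<le> B" using False by (intro B) simp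
    then show ?thesis using False by (simp add: linear_scale[OF lin] field_simps)
  qed
  then show ?thesis
    using lin by (intro bounded_linear_intro) (auto simp: linear_add linear_scale)
qed

text \<open>A sequence in the closure is shadowed by one in \<open>S\<close> at distance below
  1/(n+1), and the two have the same subsequential limits.\<close>

lemma compact_closure_if_Cauchy_subseq:
  fixes S :: "'a::banach set"
  assumes "\<And>s :: nat \<Rightarrow> 'a. (\<And>n. s n \<in> S) \<Longrightarrow> \<exists>r :: nat \<Rightarrow> nat. strict_mono r \<and> Cauchy (s \<circ> r)"
  shows "compact (closure S)"
  unfolding compact_def
proof (intro allI impI)
  fix f :: "nat \<Rightarrow> 'a" assume f: "\<forall>n. f n \<in> closure S"
  have "\<exists>y\<in>S. dist y (f n) < 1 / Suc n" for n
    using f closure_approachable[of "f n" S] by simp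
  then obtain s where s: "\<And>n. s n \<in> S" "\<And>n. dist (s n) (f n) < 1 / Suc n" by metis
  obtain r :: "nat \<Rightarrow> nat" where r: "strict_mono r" "Cauchy (s \<circ> r)" using assms[of s, OF s(1)] by (elim exE conjE)
  obtain l where l: "(s \<circ> r) \<longlonglongrightarrow> l" using Cauchy_convergent[OF r(2)] unfolding convergent_def by blast
  have "(\<lambda>n. (f \<circ> r) n - (s \<circ> r) n) \<longlonglongrightarrow> 0"
  proof (rule Lim_null_comparison[OF _ LIMSEQ_inverse_real_of_nat], intro always_eventually allI)
    fix n
    have "norm ((f \<circ> r) n - (s \<circ> r) n) \<le> 1 / Suc (r n)"
      using s(2)[of "r n"] by (simp add: dist_norm norm_minus_commute less_imp_le)
    also have "\<dots> \<le> 1 / Suc n" using seq_suble[OF r(1), of n] by (simp add: field_simps)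
    finally show "norm ((f \<circ> r) n - (s \<circ> r) n) \<le> inverse (real (Suc n))" by (simp add: inverse_eq_divide)
  qed
  from tendsto_add[OF this l] have lim: "(f \<circ> r) \<longlonglongrightarrow> l" by (simp add: o_def)
  moreover have "l \<in> closure S"
    using closed_sequentially[OF closed_closure _ lim] f by simp
  ultimately show "\<exists>l\<in>closure S. \<exists>r. strict_mono r \<and> (f \<circ> r) \<longlonglongrightarrow> l" using r(1) by blast
qed

section \<open>Sufficiency\<close>

text \<open>Reduces domination between Gram kernels to norm inequalities. The coefficients appear
  conjugated because the first argument of the kernel carries \<open>cnj d\<close>.\<close>

lemma kernel_form_cinner:
  fixes \<psi> :: "'x \<Rightarrow> 'a::chilbert_space"
  shows "kernel_form (\<lambda>w z. \<psi> w \<bullet>\<^sub>C \<psi> z) u = of_real ((norm (\<Sum>(c,z)\<leftarrow>u. cnj c *\<^sub>C \<psi> z))\<^sup>2)"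
proof -
  have left: "(\<Sum>x\<leftarrow>xs. h x) \<bullet>\<^sub>C y = (\<Sum>x\<leftarrow>xs. h x \<bullet>\<^sub>C y)"
    and right: "y \<bullet>\<^sub>C (\<Sum>x\<leftarrow>xs. h x) = (\<Sum>x\<leftarrow>xs. y \<bullet>\<^sub>C h x)" for h :: "'c \<Rightarrow> 'a" and xs y
    by (induction xs) (auto simp: cinner_add_left cinner_add_right)
  show ?thesis
    unfolding cinner_self[symmetric] kernel_form_def case_prod_unfold right unfolding left
    by (simp add: cinner_scaleC_left cinner_scaleC_right mult.assoc)
qed

lemma kernel_form_of_real:
  "kernel_form (\<lambda>w z. of_real r) u = of_real (r * (cmod (\<Sum>(c,z)\<leftarrow>u. cnj c))\<^sup>2)"
  using kernel_form_mult_const[of "of_real r" "rank_one (\<lambda>z. 1)" u] kernel_form_rank_one[of "\<lambda>z. 1" u]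
  by simp

text \<open>Take a finite \<delta>-net of the image of the unit ball. For a unit vector x and y in
  the net near A x, \<parallel>A x\<parallel>^2 = \<langle>A x, A x - y\<rangle> + \<langle>A x,
  y\<rangle> is at most \<delta> + |\<langle>A x, y\<rangle>|, where \<parallel>A x\<parallel> \<le>
  1 is used. Homogeneity gives all x.\<close>

lemma compact_operator_almost_finite_rank:
  assumes A: "compact_operator A" "onorm A < 1" and \<delta>: "0 < \<delta>"
  shows "\<exists>ys. \<forall>x. (norm (A x))\<^sup>2 \<le> 2 * \<delta> * (norm x)\<^sup>2 + (\<Sum>y\<leftarrow>ys. 1 / \<delta> * (cmod (A x \<bullet>\<^sub>C y))\<^sup>2)"
proof -
  have bl: "bounded_linear A" by (rule compact_operator_bounded_linear[OF A(1)])
  have "compact (closure (A ` cball 0 1))" using A by (simp add: compact_operator_def)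
  then obtain Y where Y: "finite Y" "closure (A ` cball 0 1) \<subseteq> (\<Union>y\<in>Y. ball y \<delta>)"
    using \<delta> unfolding compact_eq_totally_bounded by blast
  obtain ys where ys: "set ys = Y" using finite_list[OF Y(1)] by blast
  have unit: "(norm (A x))\<^sup>2 \<le> 2 * \<delta> + (\<Sum>y\<leftarrow>ys. 1 / \<delta> * (cmod (A x \<bullet>\<^sub>C y))\<^sup>2)" if x: "norm x = 1" for x
  proof -
    have "A x \<in> closure (A ` cball 0 1)" using x closure_subset[of "A ` cball 0 1"] by auto
    then obtain y where y: "y \<in> Y" "dist y (A x) < \<delta>" using Y(2) by auto
    have Ax: "norm (A x) \<le> 1" using onorm[OF bl, of x] A(2) x by simp
    have "cmod (A x \<bullet>\<^sub>C (A x - y)) \<le> 1 * \<delta>"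
      using y(2) Ax \<delta> by (intro order_trans[OF cinner_Cauchy_Schwarz] mult_mono)
        (auto simp: dist_norm norm_minus_commute)
    moreover have "A x \<bullet>\<^sub>C A x = A x \<bullet>\<^sub>C (A x - y) + A x \<bullet>\<^sub>C y" by (simp add: cinner_diff_right)
    then have "cmod (of_real ((norm (A x))\<^sup>2)) \<le> cmod (A x \<bullet>\<^sub>C (A x - y)) + cmod (A x \<bullet>\<^sub>C y)"
      by (metis cinner_self norm_triangle_ineq)
    ultimately have 1: "(norm (A x))\<^sup>2 \<le> \<delta> + cmod (A x \<bullet>\<^sub>C y)" by (simp only: norm_of_real abs_power2)
    \<comment> \<open>Makes the linear term quadratic, so that the inequality is homogeneous of
      degree 2 and is one between quadratic forms.\<close>
    have 2: "t \<le> \<delta> + 1 / \<delta> * t\<^sup>2" for t :: real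
    proof -
      have "2 * t * \<delta> \<le> t\<^sup>2 + \<delta>\<^sup>2" by (rule sum_squares_bound)
      moreover have "0 \<le> t\<^sup>2 + \<delta>\<^sup>2" by simp
      ultimately have "t * \<delta> \<le> t\<^sup>2 + \<delta>\<^sup>2" by argo
      then show ?thesis using \<delta> by (simp add: field_simps power2_eq_square)
    qed
    have "1 / \<delta> * (cmod (A x \<bullet>\<^sub>C y))\<^sup>2 \<le> (\<Sum>y\<leftarrow>ys. 1 / \<delta> * (cmod (A x \<bullet>\<^sub>C y))\<^sup>2)"
      using y(1) ys \<delta> by (intro member_le_sum_list) auto
    with 1 2[of "cmod (A x \<bullet>\<^sub>C y)"] show ?thesis by linarith
  qed
  have "(norm (A x))\<^sup>2 \<le> 2 * \<delta> * (norm x)\<^sup>2 + (\<Sum>y\<leftarrow>ys. 1 / \<delta> * (cmod (A x \<bullet>\<^sub>C y))\<^sup>2)" for x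
  proof (cases "x = 0")
    case True
    then show ?thesis using \<delta> by (simp add: linear_0 bounded_linear.linear[OF bl] sum_list_triv)
  next
    case False
    define n where "n = norm x"
    have n: "n > 0" using False by (simp add: n_def)
    have A_scale: "A (x /\<^sub>R n) = A x /\<^sub>R n" by (rule linear_scale[OF bounded_linear.linear[OF bl]])
    have "(norm (A x) / n)\<^sup>2 \<le> 2 * \<delta> + (\<Sum>y\<leftarrow>ys. 1 / \<delta> * (cmod (A x \<bullet>\<^sub>C y) / n)\<^sup>2)"
    proof -
      have "norm (x /\<^sub>R n) = 1" using n by (simp add: n_def)
      moreover have "norm (A x /\<^sub>R n) = norm (A x) / n" using n by (simp add: divide_inverse mult.commute)
      moreover have "cmod ((A x /\<^sub>R n) \<bullet>\<^sub>C y) = cmod (A x \<bullet>\<^sub>C y) / n" for y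
        using n by (simp add: scaleR_scaleC cinner_scaleC_left norm_mult norm_inverse divide_inverse mult.commute)
      ultimately show ?thesis using unit[of "x /\<^sub>R n"] by (simp only: A_scale)
    qed
    then have "n\<^sup>2 * (norm (A x) / n)\<^sup>2 \<le> n\<^sup>2 * (2 * \<delta> + (\<Sum>y\<leftarrow>ys. 1 / \<delta> * (cmod (A x \<bullet>\<^sub>C y) / n)\<^sup>2))"
      by (rule mult_left_mono) (rule zero_le_power2)
    also have "n\<^sup>2 * (norm (A x) / n)\<^sup>2 = (norm (A x))\<^sup>2" using n by (simp add: power_divide)
    also have "n\<^sup>2 * (2 * \<delta> + (\<Sum>y\<leftarrow>ys. 1 / \<delta> * (cmod (A x \<bullet>\<^sub>C y) / n)\<^sup>2)) =
        2 * \<delta> * (norm x)\<^sup>2 + (\<Sum>y\<leftarrow>ys. 1 / \<delta> * (cmod (A x \<bullet>\<^sub>C y))\<^sup>2)"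
      using n by (simp add: power_divide distrib_left n_def mult_ac flip: sum_list_const_mult)
    finally show ?thesis .
  qed
  then show ?thesis by blast
qed

section \<open>The kernel of an affine map with compact linear part\<close>

context
  fixes A :: "'a::chilbert_space \<Rightarrow> 'a" and b :: 'a
  assumes A: "compact_operator A" "onorm A < 1"
begin

private lemma A_linear: "clinear A"
  using A by (simp add: compact_operator_def)

private lemma norm_A_le: "norm (A x) \<le> onorm A * norm x"
  by (rule onorm[OF compact_operator_bounded_linear[OF A(1)]])

private lemma sum_list_A:
  "A (\<Sum>(c,z)\<leftarrow>u. cnj c *\<^sub>C z) = (\<Sum>(c,z)\<leftarrow>u. cnj c *\<^sub>C A z)"
  using A_linear by (induction u) (auto simp: clinear_zero clinear_def)

text \<open>The forms below depend on a list only through the vector x = \<Sum> cnj c z and the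
  scalar t = \<Sum> cnj c. Domination thus becomes an inequality in x and t.\<close>

private lemma sum_list_affine:
  "(\<Sum>(c,z)\<leftarrow>u. cnj c *\<^sub>C (A z + b)) = A (\<Sum>(c,z)\<leftarrow>u. cnj c *\<^sub>C z) + (\<Sum>(c,z)\<leftarrow>u. cnj c) *\<^sub>C b"
  unfolding sum_list_A by (induction u) (auto simp: scaleC_add_right scaleC_add_left algebra_simps)

private lemma sum_list_A_cinner:
  "(\<Sum>(c,z)\<leftarrow>u. cnj c * (a * (A z \<bullet>\<^sub>C y))) = a * (A (\<Sum>(c,z)\<leftarrow>u. cnj c *\<^sub>C z) \<bullet>\<^sub>C y)"
  unfolding sum_list_A
  by (induction u) (auto simp: cinner_add_left cinner_scaleC_left algebra_simps)

private lemma kernel_form_shifted: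
  fixes r :: real
  shows "Re (kernel_form (\<lambda>w z. w \<bullet>\<^sub>C z + of_real r) u) =
    (norm (\<Sum>(c,z)\<leftarrow>u. cnj c *\<^sub>C z :: 'a))\<^sup>2 + r * (cmod (\<Sum>(c,z)\<leftarrow>u. cnj c))\<^sup>2"
  unfolding kernel_form_add kernel_form_of_real kernel_form_cinner[of "\<lambda>z. z"]
  by (simp only: plus_complex.sel Re_complex_of_real)

text \<open>The additive constant \<open>r\<close> in the dominating kernel absorbs the translation by \<open>b\<close>;
  after exponentiation it only contributes a factor \<open>exp r\<close>.\<close>

private lemma affine_kernel_le:
  obtains q r where "0 \<le> q" "q < 1" "0 < r"
    "(\<lambda>w z. (A w + b) \<bullet>\<^sub>C (A z + b)) \<preceq> (\<lambda>w z. of_real q * (w \<bullet>\<^sub>C z + of_real r))"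
proof -
  define q0 where "q0 = onorm A"
  have q0: "0 \<le> q0" "q0 < 1"
    using onorm_pos_le[OF compact_operator_bounded_linear[OF A(1)]] A(2) by (auto simp: q0_def)
  \<comment> \<open>Any \<open>q\<close> strictly between the square of the operator norm and 1
    leaves room for the translation; \<open>r\<close> is then large enough that q0^2 +
    \<parallel>b\<parallel>^2/r \<le> q.\<close>
  define q where "q = (1 + q0\<^sup>2) / 2"
  have "q0\<^sup>2 < 1" using q0 by (simp add: power_less_one_iff)
  then have q: "0 \<le> q" "q < 1" "q0\<^sup>2 < q" by (auto simp: q_def add_nonneg_nonneg)
  define r where "r = ((norm b)\<^sup>2 + 1) / (q - q0\<^sup>2)"
  have r: "0 < r" using q by (auto simp: r_def intro!: divide_pos_pos add_nonneg_pos)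
  have br: "(norm b)\<^sup>2 \<le> r * (q - q0\<^sup>2)" using q by (simp add: r_def)
  have le: "(norm (A x + t *\<^sub>C b))\<^sup>2 \<le> q * ((norm x)\<^sup>2 + r * (cmod t)\<^sup>2)" for x t
  proof -
    define X T \<beta> where "X = norm x" and "T = cmod t" and "\<beta> = norm b"
    have "norm (A x + t *\<^sub>C b) \<le> q0 * X + T * \<beta>"
      using norm_triangle_ineq[of "A x" "t *\<^sub>C b"] norm_A_le[of x]
      by (simp add: norm_scaleC X_def T_def \<beta>_def q0_def)
    then have 1: "(norm (A x + t *\<^sub>C b))\<^sup>2 \<le> (q0 * X + T * \<beta>)\<^sup>2" by (intro power_mono) auto
    \<comment> \<open>The defect in the Cauchy-Schwarz inequality for (q0, \<beta>/sqrt r) and (X,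
      sqrt r T), cleared of denominators.\<close>
    have "0 \<le> (q0 * r * T - \<beta> * X)\<^sup>2" by simp
    then have "r * (q0 * X + T * \<beta>)\<^sup>2 \<le> (r * q0\<^sup>2 + \<beta>\<^sup>2) * (X\<^sup>2 + r * T\<^sup>2)"
      by (simp add: power2_eq_square algebra_simps)
    also have "\<dots> \<le> (r * q) * (X\<^sup>2 + r * T\<^sup>2)"
      using br r by (intro mult_right_mono add_nonneg_nonneg) (auto simp: \<beta>_def algebra_simps)
    finally have "r * (q0 * X + T * \<beta>)\<^sup>2 \<le> r * (q * (X\<^sup>2 + r * T\<^sup>2))" by (simp add: mult.assoc)
    then have "(q0 * X + T * \<beta>)\<^sup>2 \<le> q * (X\<^sup>2 + r * T\<^sup>2)" using r by simp
    with 1 show ?thesis by (simp add: X_def T_def)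
  qed
  have "(\<lambda>w z. (A w + b) \<bullet>\<^sub>C (A z + b)) \<preceq> (\<lambda>w z. of_real q * (w \<bullet>\<^sub>C z + of_real r))"
    unfolding kernel_le_def kernel_form_mult_const kernel_form_cinner[of "\<lambda>z. A z + b"] sum_list_affine
  proof
    fix u :: "(complex \<times> 'a) list"
    have Re_mult: "Re (of_real q * k) = q * Re k" for k by simp
    show "Re (of_real ((norm (A (\<Sum>(c, z)\<leftarrow>u. cnj c *\<^sub>C z) + (\<Sum>(c, z)\<leftarrow>u. cnj c) *\<^sub>C b))\<^sup>2))
        \<le> Re (of_real q * kernel_form (\<lambda>w z. w \<bullet>\<^sub>C z + of_real r) u)"
      unfolding Re_mult kernel_form_shifted Re_complex_of_real by (rule le)
  qed
  with q r that show ?thesis by blast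
qed

text \<open>\<parallel>A x + t b\<parallel>^2 is at most 2 \<parallel>A x\<parallel>^2 + 2 |t|^2
  \<parallel>b\<parallel>^2. The first summand is almost of finite rank by compactness, the second
  is the form of a constant rank-one kernel.\<close>

private lemma affine_kernel_compactly_dominated:
  assumes r: "0 < r"
  shows "compactly_dominated (\<lambda>w z. (A w + b) \<bullet>\<^sub>C (A z + b)) (\<lambda>w z. w \<bullet>\<^sub>C z + of_real r)"
  unfolding compactly_dominated_def
proof (intro allI impI)
  fix \<epsilon> :: real assume "\<epsilon> > 0"
  \<comment> \<open>The factor 2 from splitting off \<open>b\<close> and the factor 2 in the finite
    rank estimate turn \<delta> into 4 \<delta> = \<epsilon>.\<close>
  define \<delta> where "\<delta> = \<epsilon> / 4"
  have \<delta>: "\<delta> > 0" using \<open>\<epsilon> > 0\<close> by (simp add: \<delta>_def)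
  obtain ys where ys: "\<And>x. (norm (A x))\<^sup>2 \<le> 2 * \<delta> * (norm x)\<^sup>2 + (\<Sum>y\<leftarrow>ys. 1 / \<delta> * (cmod (A x \<bullet>\<^sub>C y))\<^sup>2)"
    using compact_operator_almost_finite_rank[OF A \<delta>] by blast
  \<comment> \<open>The weights are square roots of the coefficients 2/\<delta> and 2
    \<parallel>b\<parallel>^2, since a rank-one form squares them.\<close>
  define a where "a = sqrt (2 / \<delta>)"
  have a: "a\<^sup>2 = 2 / \<delta>" using \<delta> by (simp add: a_def)
  define l0 where "l0 = (\<lambda>z::'a. complex_of_real (sqrt 2 * norm b))"
  define l where "l y z = of_real a * (A z \<bullet>\<^sub>C y)" for y z
  define gs where "gs = l0 # map l ys"
  have form_l: "kernel_form (rank_one (l y)) u = of_real (2 / \<delta> * (cmod (A (\<Sum>(c,z)\<leftarrow>u. cnj c *\<^sub>C z) \<bullet>\<^sub>C y))\<^sup>2)" for y u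
    unfolding kernel_form_rank_one l_def sum_list_A_cinner norm_mult power_mult_distrib norm_of_real power2_abs a ..
  have form_l0: "kernel_form (rank_one l0) u = of_real (2 * (norm b)\<^sup>2 * (cmod (\<Sum>(c,z)\<leftarrow>u. cnj c))\<^sup>2)" for u
  proof -
    have "rank_one l0 = (\<lambda>w z. of_real (2 * (norm b)\<^sup>2))"
      by (auto simp: l0_def power2_eq_square intro!: ext simp flip: of_real_mult)
    then show ?thesis by (simp only: kernel_form_of_real)
  qed
  have 1: "(\<lambda>w z. (A w + b) \<bullet>\<^sub>C (A z + b)) \<preceq>
      (\<lambda>w z. of_real \<epsilon> * (w \<bullet>\<^sub>C z + of_real r) + (\<Sum>g\<leftarrow>gs. rank_one g w z))"
    unfolding kernel_le_def
  proof
    fix u :: "(complex \<times> 'a) list"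
    define x where "x = (\<Sum>(c,z)\<leftarrow>u. cnj c *\<^sub>C z)"
    define t where "t = (\<Sum>(c,z)\<leftarrow>u. cnj c)"
    have "norm (A x + t *\<^sub>C b) \<le> norm (A x) + cmod t * norm b"
      using norm_triangle_ineq[of "A x" "t *\<^sub>C b"] by (simp add: norm_scaleC)
    then have "(norm (A x + t *\<^sub>C b))\<^sup>2 \<le> (norm (A x) + cmod t * norm b)\<^sup>2" by (intro power_mono) auto
    also have "\<dots> \<le> 2 * (norm (A x))\<^sup>2 + 2 * (cmod t * norm b)\<^sup>2"
      using sum_squares_bound[of "norm (A x)" "cmod t * norm b"] by (simp add: power2_sum)
    also have "\<dots> \<le> 2 * (2 * \<delta> * (norm x)\<^sup>2 + (\<Sum>y\<leftarrow>ys. 1 / \<delta> * (cmod (A x \<bullet>\<^sub>C y))\<^sup>2)) + 2 * (cmod t * norm b)\<^sup>2"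
      using ys[of x] by simp
    also have "\<dots> = \<epsilon> * (norm x)\<^sup>2 + 2 * (norm b)\<^sup>2 * (cmod t)\<^sup>2 + (\<Sum>y\<leftarrow>ys. 2 / \<delta> * (cmod (A x \<bullet>\<^sub>C y))\<^sup>2)"
      by (simp add: \<delta>_def power_mult_distrib distrib_left mult_ac flip: sum_list_const_mult)
    also have "\<dots> \<le> \<epsilon> * ((norm x)\<^sup>2 + r * (cmod t)\<^sup>2) + 2 * (norm b)\<^sup>2 * (cmod t)\<^sup>2 +
        (\<Sum>y\<leftarrow>ys. 2 / \<delta> * (cmod (A x \<bullet>\<^sub>C y))\<^sup>2)"
      using \<open>\<epsilon> > 0\<close> r by simp
    finally have le: "(norm (A x + t *\<^sub>C b))\<^sup>2 \<le> \<dots>" .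
    have Re_list: "Re (\<Sum>y\<leftarrow>ys. of_real (h y)) = (\<Sum>y\<leftarrow>ys. h y)" for h :: "'a \<Rightarrow> real"
      by (induction ys) auto
    have "(\<Sum>g\<leftarrow>gs. kernel_form (rank_one g) u) = of_real (2 * (norm b)\<^sup>2 * (cmod t)\<^sup>2) +
        (\<Sum>y\<leftarrow>ys. of_real (2 / \<delta> * (cmod (A x \<bullet>\<^sub>C y))\<^sup>2))"
      by (simp only: gs_def list.map map_map sum_list.Cons form_l0 form_l o_def x_def t_def)
    then have rhs: "Re (kernel_form (\<lambda>w z. of_real \<epsilon> * (w \<bullet>\<^sub>C z + of_real r) + (\<Sum>g\<leftarrow>gs. rank_one g w z)) u) =
        \<epsilon> * ((norm x)\<^sup>2 + r * (cmod t)\<^sup>2) + 2 * (norm b)\<^sup>2 * (cmod t)\<^sup>2 +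
        (\<Sum>y\<leftarrow>ys. 2 / \<delta> * (cmod (A x \<bullet>\<^sub>C y))\<^sup>2)"
      unfolding kernel_form_add[of _ "\<lambda>w z. \<Sum>g\<leftarrow>gs. rank_one g w z"] kernel_form_mult_const kernel_form_sum_list
      using kernel_form_shifted[of r u, folded x_def t_def]
      by (simp only: plus_complex.sel times_complex.sel Re_complex_of_real Im_complex_of_real Re_list)
    show "Re (kernel_form (\<lambda>w z. (A w + b) \<bullet>\<^sub>C (A z + b)) u) \<le>
        Re (kernel_form (\<lambda>w z. of_real \<epsilon> * (w \<bullet>\<^sub>C z + of_real r) + (\<Sum>g\<leftarrow>gs. rank_one g w z)) u)"
      unfolding rhs kernel_form_cinner[of "\<lambda>z. A z + b"] sum_list_affine Re_complex_of_real
      using le by (simp only: x_def t_def)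
  qed
  \<comment> \<open>The constant function is controlled by the summand r |t|^2, the others by
    \<parallel>x\<parallel>^2 through Cauchy-Schwarz and \<parallel>A x\<parallel> \<le>
    \<parallel>x\<parallel>.\<close>
  have 2: "\<exists>C\<ge>0. rank_one g \<preceq> (\<lambda>w z. of_real C * (w \<bullet>\<^sub>C z + of_real r))" if "g \<in> set gs" for g
  proof -
    have Re_mult: "Re (of_real C * k) = C * Re k" for C k by simp
    consider "g = l0" | y where "g = l y" using \<open>g \<in> set gs\<close> by (auto simp: gs_def)
    then show ?thesis
    proof cases
      case 1
      have "rank_one g \<preceq> (\<lambda>w z. of_real (2 * (norm b)\<^sup>2 / r) * (w \<bullet>\<^sub>C z + of_real r))"
        unfolding kernel_le_def kernel_form_mult_const Re_mult kernel_form_shifted 1 form_l0 Re_complex_of_real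
        using r by (simp add: distrib_left)
      then show ?thesis using r by (intro exI[of _ "2 * (norm b)\<^sup>2 / r"]) simp
    next
      case (2 y)
      have le: "(cmod (A x \<bullet>\<^sub>C y))\<^sup>2 \<le> (norm y)\<^sup>2 * (norm x)\<^sup>2" for x
      proof -
        have "norm (A x) \<le> norm x"
          using norm_A_le[of x] mult_right_mono[of "onorm A" 1 "norm x"] A(2) by simp
        then have "cmod (A x \<bullet>\<^sub>C y) \<le> norm y * norm x"
          using cinner_Cauchy_Schwarz[of "A x" y] mult_left_mono[of "norm (A x)" "norm x" "norm y"]
          by (simp add: mult.commute)
        then show ?thesis unfolding power_mult_distrib[symmetric] by (intro power_mono) auto
      qed
      have "rank_one g \<preceq> (\<lambda>w z. of_real (2 / \<delta> * (norm y)\<^sup>2) * (w \<bullet>\<^sub>C z + of_real r))"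
        unfolding kernel_le_def kernel_form_mult_const Re_mult kernel_form_shifted 2 form_l Re_complex_of_real
      proof
        fix u :: "(complex \<times> 'a) list"
        let ?x = "\<Sum>(c,z)\<leftarrow>u. cnj c *\<^sub>C z" and ?t = "\<Sum>(c,z)\<leftarrow>u. cnj c"
        have "2 / \<delta> * (cmod (A ?x \<bullet>\<^sub>C y))\<^sup>2 \<le> 2 / \<delta> * ((norm y)\<^sup>2 * (norm ?x)\<^sup>2)"
          using \<delta> by (intro mult_left_mono le) simp
        also have "\<dots> \<le> 2 / \<delta> * ((norm y)\<^sup>2 * ((norm ?x)\<^sup>2 + r * (cmod ?t)\<^sup>2))"
          using \<delta> r by (intro mult_left_mono) auto
        finally show "2 / \<delta> * (cmod (A ?x \<bullet>\<^sub>C y))\<^sup>2 \<le> 2 / \<delta> * (norm y)\<^sup>2 * ((norm ?x)\<^sup>2 + r * (cmod ?t)\<^sup>2)"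
          by (simp only: mult.assoc)
      qed
      then show ?thesis using \<delta> by (intro exI[of _ "2 / \<delta> * (norm y)\<^sup>2"]) simp
    qed
  qed
  show "\<exists>gs. (\<lambda>w z. (A w + b) \<bullet>\<^sub>C (A z + b)) \<preceq>
      (\<lambda>w z. of_real \<epsilon> * (w \<bullet>\<^sub>C z + of_real r) + (\<Sum>g\<leftarrow>gs. rank_one g w z)) \<and>
    (\<forall>g\<in>set gs. \<exists>C\<ge>0. rank_one g \<preceq> (\<lambda>w z. of_real C * (w \<bullet>\<^sub>C z + of_real r)))"
    using 1 2 by blast
qed

lemma exp_affine_kernel_compactly_dominated:
  "compactly_dominated (\<lambda>w z. exp ((A w + b) \<bullet>\<^sub>C (A z + b))) (\<lambda>w z. exp (w \<bullet>\<^sub>C z))"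
proof -
  obtain q r where q: "0 \<le> q" "q < 1" and r: "0 < r"
    and le: "(\<lambda>w z. (A w + b) \<bullet>\<^sub>C (A z + b)) \<preceq> (\<lambda>w z. of_real q * (w \<bullet>\<^sub>C z + of_real r))"
    by (rule affine_kernel_le)
  have "compactly_dominated (\<lambda>w z. exp ((A w + b) \<bullet>\<^sub>C (A z + b))) (\<lambda>w z. exp (w \<bullet>\<^sub>C z + of_real r))"
    using r by (intro compactly_dominated_exp[OF _ _ affine_kernel_compactly_dominated[OF r] le q]
      mult_monotone_cinner mult_monotone_add mult_monotone_of_real mult_monotone_cinner[of "\<lambda>z. z"]) auto
  then show ?thesis
  proof (rule compactly_dominated_mono)
    have "(\<lambda>w z. exp (w \<bullet>\<^sub>C z + of_real r)) = (\<lambda>w z :: 'a. of_real (exp r) * exp (w \<bullet>\<^sub>C z))"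
      by (intro ext) (simp only: exp_add exp_of_real mult.commute)
    then show "(\<lambda>w z. exp (w \<bullet>\<^sub>C z + of_real r)) \<preceq> (\<lambda>w z :: 'a. of_real (exp r) * exp (w \<bullet>\<^sub>C z))"
      by simp
  qed simp
qed

end

lemma (in segal_bargmann) compact_composition_affine:
  assumes "compact_operator A" "onorm A < 1" "\<And>z. \<phi> z = A z + b"
  shows "compact_operator_on H ip (composition_operator \<phi>)"
proof (rule compact_composition)
  show "compactly_dominated (\<lambda>w z. exp (\<phi> w \<bullet>\<^sub>C \<phi> z)) (\<lambda>z w. exp (z \<bullet>\<^sub>C w))"
    unfolding assms(3) by (rule exp_affine_kernel_compactly_dominated[OF assms(1,2)])
qed

section \<open>Necessity\<close>

text \<open>Compactness is tested on the normalised kernels \<open>K\<^bsub>\<phi>(w)\<^esub> / \<parallel>K\<^bsub>\<phi>(w)\<^esub>\<parallel>\<close>, whose composite with \<open>\<phi>\<close>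
  takes the value \<open>\<parallel>K\<^bsub>\<phi>(w)\<^esub>\<parallel>\<close> at \<open>w\<close>.\<close>

lemma (in rkhs) compact_composition_kernel_bound:
  assumes "compact_operator_on H ip (composition_operator \<phi>)"
  obtains r :: "nat \<Rightarrow> nat" and g \<delta> where "strict_mono r" "g \<in> H" "\<delta> \<longlonglongrightarrow> 0"
    "\<And>n. fun_norm ip (\<lambda>z. K z (\<phi> (w (r n)))) \<le>
      \<delta> n * fun_norm ip (\<lambda>z. K z (w (r n))) + cmod (g (w (r n)))"
proof -
  define N where "N x = fun_norm ip (\<lambda>z. K z x)" for x
  \<comment> \<open>Were the norm 0, division by zero would yield the zero function, for which
    \<open>f1\<close> and \<open>fw\<close> still hold.\<close>
  define f where "f n = (\<lambda>z. (1 / of_real (N (\<phi> (w n)))) * K z (\<phi> (w n)))" for n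
  have f: "f n \<in> H" for n unfolding f_def by (intro scale_mem kernel_mem)
  have N0: "0 \<le> N x" for x by (simp add: N_def fun_norm_nonneg kernel_mem)
  have f1: "fun_norm ip (f n) \<le> 1" for n
    unfolding f_def fun_norm_scale[OF kernel_mem] using N0 by (simp add: norm_divide flip: N_def)
  have fw: "cmod (f n (\<phi> (w n))) = N (\<phi> (w n))" for n
    unfolding f_def fun_norm_kernel_sq using N0[of "\<phi> (w n)"]
    by (simp add: norm_mult norm_divide power2_eq_square flip: N_def)
  obtain g r where g: "g \<in> H" and r: "strict_mono (r :: nat \<Rightarrow> nat)"
    and lim: "(\<lambda>n. fun_norm ip (\<lambda>x. composition_operator \<phi> (f (r n)) x - g x)) \<longlonglongrightarrow> 0"
    using assms f f1 unfolding compact_operator_on_def by blast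
  show ?thesis
  \<comment> \<open>The null sequence is the distance of the composites from their limit
    \<open>g\<close>; evaluating this distance at a point costs the norm of the kernel function
    there.\<close>
  proof (rule that[OF r g lim])
    fix n
    have mem: "composition_operator \<phi> (f (r n)) \<in> H"
      using assms f unfolding compact_operator_on_def by blast
    let ?h = "composition_operator \<phi> (f (r n))"
    have "fun_norm ip (\<lambda>z. K z (\<phi> (w (r n)))) = cmod (?h (w (r n)))"
      using fw[of "r n"] by (simp add: N_def composition_operator_def)
    also have "\<dots> \<le> cmod (g (w (r n))) + cmod (?h (w (r n)) - g (w (r n)))"
      by (rule norm_triangle_sub)
    also have "\<dots> \<le> cmod (g (w (r n))) + fun_norm ip (\<lambda>x. ?h x - g x) * fun_norm ip (\<lambda>z. K z (w (r n)))"
      by (rule add_left_mono[OF point_bound[OF diff_mem[OF mem g]]])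
    finally show "fun_norm ip (\<lambda>z. K z (\<phi> (w (r n)))) \<le>
        fun_norm ip (\<lambda>x. ?h x - g x) * fun_norm ip (\<lambda>z. K z (w (r n))) + cmod (g (w (r n)))"
      by (simp only: add.commute)
  qed
qed

section \<open>Density, decay and holomorphy in the Segal-Bargmann space\<close>

context segal_bargmann
begin

lemma fun_norm_exp_kernel: "fun_norm ip (\<lambda>z. exp (z \<bullet>\<^sub>C w)) = exp ((norm w)\<^sup>2 / 2)"
proof (rule power2_eq_imp_eq)
  have "complex_of_real ((fun_norm ip (\<lambda>z. exp (z \<bullet>\<^sub>C w)))\<^sup>2) = of_real (exp ((norm w)\<^sup>2))"
    using fun_norm_kernel_sq[of w] by (simp only: cinner_self exp_of_real)
  then have "(fun_norm ip (\<lambda>z. exp (z \<bullet>\<^sub>C w)))\<^sup>2 = exp ((norm w)\<^sup>2)" by (simp only: of_real_eq_iff)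
  also have "\<dots> = (exp ((norm w)\<^sup>2 / 2))\<^sup>2" by (simp flip: exp_double)
  finally show "(fun_norm ip (\<lambda>z. exp (z \<bullet>\<^sub>C w)))\<^sup>2 = (exp ((norm w)\<^sup>2 / 2))\<^sup>2" .
qed (simp_all add: fun_norm_nonneg kernel_mem)

lemma exp_point_bound: "f \<in> H \<Longrightarrow> cmod (f w) \<le> fun_norm ip f * exp ((norm w)\<^sup>2 / 2)"
  using point_bound[of f w] by (simp add: fun_norm_exp_kernel)

text \<open>Each element meets the membership criterion with its own squared norm as constant, and
  the Riesz argument then supplies approximating combinations: kernel functions span a dense
  subspace.\<close>

lemma kernel_comb_limit:
  assumes "f \<in> H"
  obtains us where "(\<lambda>n. fun_norm ip (\<lambda>x. kernel_comb (us n) x - f x)) \<longlonglongrightarrow> 0"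
  by (rule kernel_comb_approx[OF rank_one_le_kernel[OF assms] zero_le_power2]) (rule that)

text \<open>Cauchy-Schwarz dominates the rank-one kernel by \<parallel>a\<parallel>^2 times the
  inner product kernel, which is the first-order term of the exponential kernel.\<close>

lemma linear_functional_mem:
  "(\<lambda>z. z \<bullet>\<^sub>C a) \<in> H" "fun_norm ip (\<lambda>z. z \<bullet>\<^sub>C a) \<le> norm a"
proof -
  have 1: "rank_one (\<lambda>z. z \<bullet>\<^sub>C a) \<preceq> (\<lambda>w z. of_real ((norm a)\<^sup>2) * (w \<bullet>\<^sub>C z))"
    unfolding kernel_le_def
  proof
    fix u :: "(complex \<times> 'a) list"
    have eq: "(\<Sum>(c,z)\<leftarrow>u. cnj c * (z \<bullet>\<^sub>C a)) = (\<Sum>(c,z)\<leftarrow>u. cnj c *\<^sub>C z) \<bullet>\<^sub>C a"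
      by (induction u) (auto simp: cinner_add_left cinner_scaleC_left)
    have Re_mult: "Re (of_real C * k) = C * Re k" for C k by simp
    have "(cmod ((\<Sum>(c,z)\<leftarrow>u. cnj c *\<^sub>C z) \<bullet>\<^sub>C a))\<^sup>2 \<le> (norm a * norm (\<Sum>(c,z)\<leftarrow>u. cnj c *\<^sub>C z))\<^sup>2"
      using cinner_Cauchy_Schwarz[of "\<Sum>(c,z)\<leftarrow>u. cnj c *\<^sub>C z" a]
      by (intro power_mono) (simp_all add: mult.commute)
    then show "Re (kernel_form (rank_one (\<lambda>z. z \<bullet>\<^sub>C a)) u)
        \<le> Re (kernel_form (\<lambda>w z. of_real ((norm a)\<^sup>2) * (w \<bullet>\<^sub>C z)) u)"
      unfolding kernel_form_rank_one kernel_form_mult_const kernel_form_cinner[of "\<lambda>z. z"] eq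
        Re_mult Re_complex_of_real power_mult_distrib .
  qed
  have "(\<lambda>w z :: 'a. w \<bullet>\<^sub>C z) \<preceq> (\<lambda>w z. exp (w \<bullet>\<^sub>C z))"
    using kernel_le_exp_term[OF mult_monotone_cinner[of "\<lambda>z. z :: 'a"], of 1] by simp
  from kernel_le_scale[OF this, of "(norm a)\<^sup>2"]
  have 2: "(\<lambda>w z :: 'a. of_real ((norm a)\<^sup>2) * (w \<bullet>\<^sub>C z)) \<preceq> (\<lambda>w z. of_real ((norm a)\<^sup>2) * exp (w \<bullet>\<^sub>C z))"
    by simp
  show "(\<lambda>z. z \<bullet>\<^sub>C a) \<in> H"
    by (rule mem_if_rank_one_le(1)[OF kernel_le_trans[OF 1 2]]) simp
  show "fun_norm ip (\<lambda>z. z \<bullet>\<^sub>C a) \<le> norm a"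
    using mem_if_rank_one_le(2)[OF kernel_le_trans[OF 1 2]] by simp
qed

text \<open>Normalised kernel functions tend weakly to 0 at infinity. For combinations of kernel
  functions the Gaussian denominator wins; in general \<open>g\<close> is close in norm to such a
  combination, and the normalised point evaluations are bounded by 1.\<close>

lemma quotient_exp_kernel_tendsto_0:
  assumes g: "g \<in> H" and w: "filterlim (\<lambda>n. norm (w n)) at_top sequentially"
  shows "(\<lambda>n. cmod (g (w n)) / exp ((norm (w n))\<^sup>2 / 2)) \<longlonglongrightarrow> 0"
proof (rule LIMSEQ_I)
  fix e :: real assume e: "0 < e"
  obtain us where us: "(\<lambda>n. fun_norm ip (\<lambda>x. kernel_comb (us n) x - g x)) \<longlonglongrightarrow> 0"
    by (rule kernel_comb_limit[OF g])
  obtain k where "norm (fun_norm ip (\<lambda>x. kernel_comb (us k) x - g x) - 0) < e / 2"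
    using LIMSEQ_D[OF us, of "e / 2"] e by auto
  define u where "u = us k"
  have u: "fun_norm ip (\<lambda>x. kernel_comb u x - g x) < e / 2"
    using \<open>norm _ < e / 2\<close> by (simp add: u_def)
  define E where "E n = exp ((norm (w n))\<^sup>2 / 2)" for n
  have "(\<lambda>n. cmod (exp (w n \<bullet>\<^sub>C z)) / E n) \<longlonglongrightarrow> 0" for z
  proof (rule Lim_null_comparison)
    \<comment> \<open>The exponent of the quotient is at most - \<parallel>w\<parallel>
      (\<parallel>w\<parallel>/2 - \<parallel>z\<parallel>), which tends to minus infinity for fixed
      \<open>z\<close>.\<close>
    have "filterlim (\<lambda>n. norm (w n) * (- norm z + 1/2 * norm (w n))) at_top sequentially"
      by (intro filterlim_at_top_mult_at_top w filterlim_tendsto_add_at_top[OF tendsto_const]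
        filterlim_tendsto_pos_mult_at_top[OF tendsto_const _ w]) simp
    then have "filterlim (\<lambda>n. - (norm (w n) * (- norm z + 1/2 * norm (w n)))) at_bot sequentially"
      by (simp add: filterlim_uminus_at_top)
    from filterlim_compose[OF exp_at_bot this]
    show "(\<lambda>n. exp (- (norm (w n) * (- norm z + 1/2 * norm (w n))))) \<longlonglongrightarrow> 0" .
    show "\<forall>\<^sub>F n in sequentially. norm (cmod (exp (w n \<bullet>\<^sub>C z)) / E n)
        \<le> exp (- (norm (w n) * (- norm z + 1/2 * norm (w n))))"
    proof (intro always_eventually allI)
      fix n
      have "Re (w n \<bullet>\<^sub>C z) \<le> norm (w n) * norm z"
        using cinner_Cauchy_Schwarz[of "w n" z] complex_Re_le_cmod order_trans by blast
      then have "exp (Re (w n \<bullet>\<^sub>C z) - (norm (w n))\<^sup>2 / 2) \<le> exp (- (norm (w n) * (- norm z + 1/2 * norm (w n))))"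
        by (simp add: algebra_simps power2_eq_square)
      then show "norm (cmod (exp (w n \<bullet>\<^sub>C z)) / E n) \<le> exp (- (norm (w n) * (- norm z + 1/2 * norm (w n))))"
        by (simp add: E_def exp_diff)
    qed
  qed
  then have "(\<lambda>n. \<Sum>(c,z)\<leftarrow>u. cmod c * (cmod (exp (w n \<bullet>\<^sub>C z)) / E n)) \<longlonglongrightarrow> (\<Sum>(c,z)\<leftarrow>u. 0)"
    unfolding case_prod_unfold by (intro tendsto_sum_list tendsto_mult_right_zero)
  then have "(\<lambda>n. \<Sum>(c,z)\<leftarrow>u. cmod c * (cmod (exp (w n \<bullet>\<^sub>C z)) / E n)) \<longlonglongrightarrow> 0"
    by (simp add: case_prod_unfold)
  from order_tendstoD(2)[OF this, of "e / 2"] e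
  obtain M where M: "\<And>n. n \<ge> M \<Longrightarrow> (\<Sum>(c,z)\<leftarrow>u. cmod c * (cmod (exp (w n \<bullet>\<^sub>C z)) / E n)) < e / 2"
    unfolding eventually_sequentially by auto
  have comb: "cmod (kernel_comb u (w n)) / E n \<le> (\<Sum>(c,z)\<leftarrow>u. cmod c * (cmod (exp (w n \<bullet>\<^sub>C z)) / E n))" for n
  proof (induction u)
    case Nil
    then show ?case by (simp add: kernel_comb_Nil)
  next
    case (Cons p v)
    obtain c z where p: "p = (c, z)" by (cases p)
    have "cmod (kernel_comb (p # v) (w n)) / E n \<le> cmod c * (cmod (exp (w n \<bullet>\<^sub>C z)) / E n) + cmod (kernel_comb v (w n)) / E n"
      using norm_triangle_ineq[of "c * exp (w n \<bullet>\<^sub>C z)" "kernel_comb v (w n)"]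
      unfolding p kernel_comb_Cons times_divide_eq_right add_divide_distrib[symmetric]
      by (intro divide_right_mono) (simp_all only: norm_mult E_def exp_ge_zero)
    then show ?case using Cons by (simp add: p)
  qed
  have "norm (cmod (g (w n)) / E n - 0) < e" if "n \<ge> M" for n
  proof -
    have E: "E n > 0" by (simp add: E_def)
    have "cmod (kernel_comb u (w n) - g (w n)) \<le> fun_norm ip (\<lambda>x. kernel_comb u x - g x) * E n"
      unfolding E_def by (rule exp_point_bound[OF diff_mem[OF kernel_comb_mem g]])
    from order.strict_trans1[OF this mult_strict_right_mono[OF u E]]
    have "cmod (kernel_comb u (w n) - g (w n)) / E n < e / 2"
      unfolding pos_divide_less_eq[OF E] .
    moreover have "cmod (kernel_comb u (w n)) / E n < e / 2"
      by (rule order.strict_trans1[OF comb M[OF that]])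
    moreover have "cmod (g (w n)) / E n \<le> cmod (kernel_comb u (w n)) / E n + cmod (kernel_comb u (w n) - g (w n)) / E n"
      unfolding add_divide_distrib[symmetric] using E norm_triangle_sub[of "g (w n)" "kernel_comb u (w n)"]
      by (intro divide_right_mono) (simp_all add: norm_minus_commute)
    ultimately have "cmod (g (w n)) / E n < e" by argo
    then show ?thesis using E by simp
  qed
  then show "\<exists>M. \<forall>n\<ge>M. norm (cmod (g (w n)) / exp ((norm (w n))\<^sup>2 / 2) - 0) < e"
    unfolding E_def by blast
qed

text \<open>Kernel combinations are entire along lines, and norm convergence is uniform wherever
  \<parallel>K_w\<parallel> is bounded, in particular over discs.\<close>

lemma holomorphic_on_line:
  assumes f: "f \<in> H"
  shows "(\<lambda>\<xi>. f (z + \<xi> *\<^sub>C w)) holomorphic_on UNIV"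
proof -
  obtain us where us: "(\<lambda>n. fun_norm ip (\<lambda>x. kernel_comb (us n) x - f x)) \<longlonglongrightarrow> 0"
    by (rule kernel_comb_limit[OF f])
  show ?thesis
  proof (rule holomorphic_uniform_sequence[OF open_UNIV])
    show "(\<lambda>\<xi>. kernel_comb (us n) (z + \<xi> *\<^sub>C w)) holomorphic_on UNIV" for n
    proof -
      have "(\<lambda>\<xi>. kernel_comb u (z + \<xi> *\<^sub>C w)) holomorphic_on UNIV" for u
      proof (induction u)
        case Nil
        then show ?case by (simp add: kernel_comb_Nil)
      next
        case (Cons p u)
        then show ?case
          by (cases p) (auto simp: kernel_comb_Cons cinner_add_left cinner_scaleC_left intro!: holomorphic_intros)
      qed
      then show ?thesis .
    qed
    fix \<xi> :: complex
    \<comment> \<open>Bounds the norms of the kernel functions over the whole disc of radius 1 about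
      \<xi>.\<close>
    define E where "E = exp ((norm z + (cmod \<xi> + 1) * norm w)\<^sup>2 / 2)"
    have "uniform_limit (cball \<xi> 1) (\<lambda>n \<xi>. kernel_comb (us n) (z + \<xi> *\<^sub>C w)) (\<lambda>\<xi>. f (z + \<xi> *\<^sub>C w)) sequentially"
    proof (rule uniform_limitI)
      fix e :: real assume e: "0 < e"
      have "(\<lambda>n. fun_norm ip (\<lambda>x. kernel_comb (us n) x - f x) * E) \<longlonglongrightarrow> 0"
        by (rule tendsto_mult_left_zero[OF us])
      then have "\<forall>\<^sub>F n in sequentially. fun_norm ip (\<lambda>x. kernel_comb (us n) x - f x) * E < e"
        using e by (rule order_tendstoD(2))
      then show "\<forall>\<^sub>F n in sequentially. \<forall>\<zeta>\<in>cball \<xi> 1. dist (kernel_comb (us n) (z + \<zeta> *\<^sub>C w)) (f (z + \<zeta> *\<^sub>C w)) < e"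
      proof (rule eventually_mono, intro ballI)
        fix n \<zeta> assume n: "fun_norm ip (\<lambda>x. kernel_comb (us n) x - f x) * E < e" and \<zeta>: "\<zeta> \<in> cball \<xi> 1"
        have "cmod \<zeta> \<le> cmod \<xi> + 1"
          using \<zeta> norm_triangle_sub[of \<zeta> \<xi>] by (simp add: dist_norm norm_minus_commute)
        then have "norm (z + \<zeta> *\<^sub>C w) \<le> norm z + (cmod \<xi> + 1) * norm w"
          by (intro order_trans[OF norm_triangle_ineq] add_mono) (auto simp: norm_scaleC mult_right_mono)
        then have "exp ((norm (z + \<zeta> *\<^sub>C w))\<^sup>2 / 2) \<le> E"
          unfolding E_def by (simp add: power_mono)
        then have "fun_norm ip (\<lambda>x. kernel_comb (us n) x - f x) * exp ((norm (z + \<zeta> *\<^sub>C w))\<^sup>2 / 2)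
            \<le> fun_norm ip (\<lambda>x. kernel_comb (us n) x - f x) * E"
          by (intro mult_left_mono fun_norm_nonneg diff_mem kernel_comb_mem f)
        from order.strict_trans1[OF order_trans[OF exp_point_bound[OF diff_mem[OF kernel_comb_mem f]] this] n]
        show "dist (kernel_comb (us n) (z + \<zeta> *\<^sub>C w)) (f (z + \<zeta> *\<^sub>C w)) < e"
          unfolding dist_norm .
      qed
    qed
    then show "\<exists>d>0. cball \<xi> d \<subseteq> UNIV \<and>
        uniform_limit (cball \<xi> d) (\<lambda>n \<xi>. kernel_comb (us n) (z + \<xi> *\<^sub>C w)) (\<lambda>\<xi>. f (z + \<xi> *\<^sub>C w)) sequentially"
      by (intro exI[of _ 1]) simp
  qed
qed

end

lemma entire_linear_growth_imp_affine:
  fixes f :: "complex \<Rightarrow> complex"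
  assumes "f holomorphic_on UNIV" and "\<And>\<xi>. cmod (f \<xi>) \<le> B + C * cmod \<xi>"
  shows "f \<xi> = f 0 + \<xi> * (f 1 - f 0)"
proof -
  have "cmod (f 0) \<le> B" using assms(2)[of 0] by simp
  then have B: "0 \<le> B" by (rule order_trans[OF norm_ge_zero])
  have "norm (f \<xi>) \<le> (B + C) * norm \<xi> ^ 1" if "1 \<le> norm \<xi>" for \<xi>
    using assms(2)[of \<xi>] mult_left_mono[OF that B] by (simp add: distrib_right)
  then have "f \<xi> = (\<Sum>k\<le>1. (deriv ^^ k) f 0 / fact k * \<xi> ^ k)" for \<xi>
    by (rule Liouville_polynomial[OF assms(1)])
  from this[of \<xi>] this[of 1] show ?thesis by simp
qed

section \<open>Symbols of compact composition operators\<close>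

context segal_bargmann
begin

context
  fixes \<phi> :: "'a \<Rightarrow> 'a"
  assumes compact: "compact_operator_on H ip (composition_operator \<phi>)"
begin

text \<open>If \<parallel>\<phi> w\<parallel>^2 exceeded \<parallel>w\<parallel>^2 + n at w_n, the
  kernel bound divided by the norm of the kernel function would give exp(n/2) \<le> \<delta>_n +
  \<parallel>g\<parallel> along the subsequence, with a bounded right side.\<close>

lemma compact_composition_growth: "\<exists>C\<ge>0. \<forall>w. (norm (\<phi> w))\<^sup>2 \<le> (norm w)\<^sup>2 + C"
proof (rule ccontr)
  assume no: "\<not> (\<exists>C\<ge>0. \<forall>w. (norm (\<phi> w))\<^sup>2 \<le> (norm w)\<^sup>2 + C)"
  have "\<exists>w. (norm w)\<^sup>2 + real n < (norm (\<phi> w))\<^sup>2" for n :: nat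
    using no of_nat_0_le_iff[of n] not_le by blast
  then obtain w where w: "\<And>n :: nat. (norm (w n))\<^sup>2 + real n < (norm (\<phi> (w n)))\<^sup>2" by metis
  obtain r :: "nat \<Rightarrow> nat" and g \<delta> where r: "strict_mono r" and g: "g \<in> H" and \<delta>: "\<delta> \<longlonglongrightarrow> 0"
    and le: "\<And>n. exp ((norm (\<phi> (w (r n))))\<^sup>2 / 2) \<le> \<delta> n * exp ((norm (w (r n)))\<^sup>2 / 2) + cmod (g (w (r n)))"
    using compact_composition_kernel_bound[OF compact, of w] unfolding fun_norm_exp_kernel by blast
  have "exp (real n / 2) \<le> \<delta> n + fun_norm ip g" for n
  proof -
    let ?E = "exp ((norm (w (r n)))\<^sup>2 / 2)"
    have "real n \<le> real (r n)" using seq_suble[OF r, of n] by simp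
    then have "exp (real n / 2 + (norm (w (r n)))\<^sup>2 / 2) \<le> exp ((norm (\<phi> (w (r n))))\<^sup>2 / 2)"
      using w[of "r n"] by simp
    then have "exp (real n / 2) * ?E \<le> exp ((norm (\<phi> (w (r n))))\<^sup>2 / 2)" by (simp only: exp_add)
    also note le
    also have "\<delta> n * ?E + cmod (g (w (r n))) \<le> (\<delta> n + fun_norm ip g) * ?E"
      using exp_point_bound[OF g, of "w (r n)"] by (simp add: distrib_right)
    finally show ?thesis by simp
  qed
  moreover have "real n / 2 \<le> exp (real n / 2)" for n
    using exp_ge_add_one_self[of "real n / 2"] by linarith
  ultimately have le': "real n / 2 \<le> \<delta> n + fun_norm ip g" for n by (meson order_trans)
  obtain M where M: "\<And>n. n \<ge> M \<Longrightarrow> \<delta> n < 1"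
    using order_tendstoD(2)[OF \<delta>, of 1] unfolding eventually_sequentially by auto
  obtain k :: nat where k: "2 * (1 + fun_norm ip g) < real k" using reals_Archimedean2 by blast
  have "real (max M k) / 2 < 1 + fun_norm ip g" using le'[of "max M k"] M[of "max M k"] by simp
  moreover have "real k \<le> real (max M k)" by simp
  ultimately show False using k by argo
qed

text \<open>The ratio of the kernel norms at \<phi> w and w would stay above exp(-C/2), whereas the
  kernel bound and weak decay at infinity force it to 0 along a subsequence.\<close>

lemma compact_composition_no_expansion:
  assumes w: "filterlim (\<lambda>n. norm (w n)) at_top sequentially"
  shows "\<not> (\<forall>n. (norm (w n))\<^sup>2 \<le> (norm (\<phi> (w n)))\<^sup>2 + C)"
proof
  assume ge: "\<forall>n. (norm (w n))\<^sup>2 \<le> (norm (\<phi> (w n)))\<^sup>2 + C"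
  obtain r :: "nat \<Rightarrow> nat" and g \<delta> where r: "strict_mono r" and g: "g \<in> H" and \<delta>: "\<delta> \<longlonglongrightarrow> 0"
    and le: "\<And>n. exp ((norm (\<phi> (w (r n))))\<^sup>2 / 2) \<le> \<delta> n * exp ((norm (w (r n)))\<^sup>2 / 2) + cmod (g (w (r n)))"
    using compact_composition_kernel_bound[OF compact, of w] unfolding fun_norm_exp_kernel by blast
  define E where "E n = exp ((norm (w (r n)))\<^sup>2 / 2)" for n
  have "filterlim (\<lambda>n. norm (w (r n))) at_top sequentially"
    using filterlim_compose[OF w filterlim_subseq[OF r]] by simp
  from tendsto_add[OF \<delta> quotient_exp_kernel_tendsto_0[OF g this]]
  have lim: "(\<lambda>n. \<delta> n + cmod (g (w (r n))) / E n) \<longlonglongrightarrow> 0" by (simp add: E_def)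
  have "exp (- C / 2) \<le> \<delta> n + cmod (g (w (r n))) / E n" for n
  proof -
    have E: "E n > 0" by (simp add: E_def)
    have "exp (- C / 2) * E n = exp (- C / 2 + (norm (w (r n)))\<^sup>2 / 2)" by (simp only: E_def exp_add)
    also have "\<dots> \<le> exp ((norm (\<phi> (w (r n))))\<^sup>2 / 2)" using ge[rule_format, of "r n"] by simp
    also have "\<dots> \<le> \<delta> n * E n + cmod (g (w (r n)))" unfolding E_def by (rule le)
    also have "\<dots> = (\<delta> n + cmod (g (w (r n))) / E n) * E n" using E by (simp add: distrib_right)
    finally show ?thesis using E by simp
  qed
  then have "exp (- C / 2) \<le> 0" by (intro LIMSEQ_le_const[OF lim]) blast
  then show False by simp
qed

lemma compact_composition_affine_on_lines: "\<phi> (z + \<xi> *\<^sub>C w) = \<phi> z + \<xi> *\<^sub>C (\<phi> (z + w) - \<phi> z)"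
proof (rule cinner_eqI)
  fix a
  define f where "f \<xi> = \<phi> (z + \<xi> *\<^sub>C w) \<bullet>\<^sub>C a" for \<xi>
  obtain C where C: "0 \<le> C" "\<And>w. (norm (\<phi> w))\<^sup>2 \<le> (norm w)\<^sup>2 + C" using compact_composition_growth by blast
  have growth: "norm (\<phi> w) \<le> norm w + sqrt C" for w
  proof (rule power2_le_imp_le)
    have "0 \<le> 2 * norm w * sqrt C" using C(1) by simp
    then show "(norm (\<phi> w))\<^sup>2 \<le> (norm w + sqrt C)\<^sup>2"
      using C(2)[of w] real_sqrt_pow2[OF C(1)] unfolding power2_sum by linarith
  qed (use C in simp)
  have "composition_operator \<phi> (\<lambda>z. z \<bullet>\<^sub>C a) \<in> H"
    using compact linear_functional_mem(1) unfolding compact_operator_on_def by blast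
  from holomorphic_on_line[OF this, of z w] have hol: "f holomorphic_on UNIV"
    by (simp add: f_def[abs_def] composition_operator_def)
  have bound: "cmod (f \<xi>) \<le> (norm z + sqrt C) * norm a + (norm w * norm a) * cmod \<xi>" for \<xi>
  proof -
    have "norm (\<phi> (z + \<xi> *\<^sub>C w)) \<le> norm z + cmod \<xi> * norm w + sqrt C"
      using growth[of "z + \<xi> *\<^sub>C w"] norm_triangle_ineq[of z "\<xi> *\<^sub>C w"] by (simp add: norm_scaleC)
    from order_trans[OF cinner_Cauchy_Schwarz mult_right_mono[OF this norm_ge_zero]]
    show ?thesis by (simp add: f_def algebra_simps)
  qed
  show "\<phi> (z + \<xi> *\<^sub>C w) \<bullet>\<^sub>C a = (\<phi> z + \<xi> *\<^sub>C (\<phi> (z + w) - \<phi> z)) \<bullet>\<^sub>C a"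
    using entire_linear_growth_imp_affine[OF hol bound, of \<xi>]
    by (simp add: f_def cinner_add_left cinner_scaleC_left cinner_diff_left)
qed

lemma compact_composition_linear: "clinear (\<lambda>x. \<phi> x - \<phi> 0)"
  by (rule clinear_of_affine_on_lines) (rule compact_composition_affine_on_lines)

lemma compact_composition_onorm_less: "onorm (\<lambda>x. \<phi> x - \<phi> 0) < 1"
proof (rule ccontr)
  define A where "A x = \<phi> x - \<phi> 0" for x
  have lin: "linear A"
    using clinear_imp_linear[OF compact_composition_linear] by (simp add: A_def[abs_def])
  assume "\<not> onorm (\<lambda>x. \<phi> x - \<phi> 0) < 1"
  then have on: "1 \<le> onorm A" by (simp add: A_def[abs_def])
  have "\<exists>w. norm w = real (Suc n) \<and> (norm w)\<^sup>2 \<le> (norm (\<phi> w))\<^sup>2 + 2" for n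
  proof -
    define k where "k = real (Suc n)"
    have k: "1 \<le> k" by (simp add: k_def)
    \<comment> \<open>The norm need not be attained; since (q k)^2 = k^2 - 2 + 1/k^2, this choice
      loses at most 2 at radius \<open>k\<close>, uniformly in \<open>n\<close>.\<close>
    define q where "q = 1 - 1 / k\<^sup>2"
    have q: "0 \<le> q" "q < 1" using k by (auto simp: q_def)
    have "\<not> (\<forall>x. norm (A x) \<le> q * norm x)"
      using onorm_bound[of q A] q on by auto
    then obtain x where x: "q * norm x < norm (A x)" by (auto simp: not_le)
    then have "x \<noteq> 0" using linear_0[OF lin] by auto
    \<comment> \<open>The sign makes Re \<langle>A w, \<phi> 0\<rangle> nonnegative, so adding
      \<phi> 0 does not shorten \<open>A w\<close>.\<close>
    define s where "s = (if Re (A x \<bullet>\<^sub>C \<phi> 0) \<ge> 0 then 1 else - 1 :: real)"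
    define c where "c = s * (k / norm x)"
    define w where "w = c *\<^sub>R x"
    have abs_c: "\<bar>c\<bar> = k / norm x" using k by (simp add: c_def s_def abs_mult)
    have w: "norm w = k" using abs_c \<open>x \<noteq> 0\<close> by (simp add: w_def)
    have Aw: "A w = c *\<^sub>R A x" by (simp add: w_def linear_scale[OF lin])
    have "q * k \<le> norm (A w)"
    proof -
      have "q * k = \<bar>c\<bar> * (q * norm x)" using \<open>x \<noteq> 0\<close> by (simp add: abs_c)
      also have "\<dots> \<le> \<bar>c\<bar> * norm (A x)" using x by (intro mult_left_mono) auto
      finally show ?thesis by (simp add: Aw)
    qed
    then have "(q * k)\<^sup>2 \<le> (norm (A w))\<^sup>2" using q k by (intro power_mono) auto
    moreover have "(q * k)\<^sup>2 = k\<^sup>2 - 2 + 1 / k\<^sup>2"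
      using k by (simp add: q_def power2_eq_square field_simps)
    moreover have "0 \<le> 1 / k\<^sup>2" by simp
    moreover have "(norm (A w))\<^sup>2 \<le> (norm (\<phi> w))\<^sup>2"
    proof -
      have "Re (A w \<bullet>\<^sub>C \<phi> 0) = (k / norm x) * (s * Re (A x \<bullet>\<^sub>C \<phi> 0))"
        by (simp add: Aw scaleR_scaleC cinner_scaleC_left c_def)
      moreover have "0 \<le> s * Re (A x \<bullet>\<^sub>C \<phi> 0)" by (simp add: s_def)
      ultimately have "0 \<le> Re (A w \<bullet>\<^sub>C \<phi> 0)" using k by simp
      moreover have "\<phi> w = A w + \<phi> 0" by (simp add: A_def)
      ultimately show ?thesis by (simp add: norm_add_sq_cinner)
    qed
    ultimately have "(norm w)\<^sup>2 \<le> (norm (\<phi> w))\<^sup>2 + 2" unfolding w by argo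
    with w show ?thesis unfolding k_def by blast
  qed
  then obtain w where w: "\<And>n. norm (w n) = real (Suc n)" "\<And>n. (norm (w n))\<^sup>2 \<le> (norm (\<phi> (w n)))\<^sup>2 + 2"
    by metis
  have "filterlim (\<lambda>n. real (Suc n)) at_top sequentially"
    by (rule filterlim_compose[OF filterlim_real_sequentially filterlim_Suc])
  then have "filterlim (\<lambda>n. norm (w n)) at_top sequentially" by (simp only: w(1))
  from compact_composition_no_expansion[OF this, of 2] w(2) show False by blast
qed

text \<open>Testing \<open>C\<^sub>\<phi>\<close> on the functionals \<open>\<langle>\<cdot>, A x\<^sub>n\<rangle>\<close> yields compactness of \<open>A\<close> without recourse to the
  adjoint: \<open>\<parallel>A (x\<^sub>n - x\<^sub>m)\<parallel>\<^sup>2\<close> is a difference of two values of the image function.\<close>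

lemma compact_composition_compact_linear_part: "compact_operator (\<lambda>x. \<phi> x - \<phi> 0)"
proof -
  define A where "A x = \<phi> x - \<phi> 0" for x
  have clin: "clinear A" using compact_composition_linear by (simp add: A_def[abs_def])
  obtain C where C: "0 \<le> C" "\<And>w. (norm (\<phi> w))\<^sup>2 \<le> (norm w)\<^sup>2 + C" using compact_composition_growth by blast
  \<comment> \<open>A bound for \<open>A\<close> on the unit ball, made positive by the added 1, so
    that the functionals divided by \<open>R\<close> lie in the unit ball of
    \<open>H\<close>.\<close>
  define R where "R = sqrt (1 + C) + norm (\<phi> 0) + 1"
  have R: "0 < R" using C(1) by (auto simp: R_def intro!: add_nonneg_pos add_nonneg_nonneg)
  have A_le: "norm (A x) \<le> R" if x: "norm x \<le> 1" for x
  proof -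
    have "(norm x)\<^sup>2 \<le> 1" using x by (simp add: power_le_one)
    then have "norm (\<phi> x) \<le> sqrt (1 + C)" using C(2)[of x] by (intro real_le_rsqrt) simp
    then show ?thesis using norm_triangle_ineq4[of "\<phi> x" "\<phi> 0"] by (simp add: A_def R_def)
  qed
  have "compact (closure (A ` cball 0 1))"
  proof (rule compact_closure_if_Cauchy_subseq)
    fix s :: "nat \<Rightarrow> 'a" assume "\<And>n. s n \<in> A ` cball 0 1"
    then have "\<forall>n. \<exists>x. norm x \<le> 1 \<and> s n = A x" by force
    from choice[OF this] obtain x where x: "\<And>n. norm (x n) \<le> 1" "\<And>n. s n = A (x n)" by blast
    define f where "f n = (\<lambda>z. (1 / of_real R) * (z \<bullet>\<^sub>C s n))" for n
    have f: "f n \<in> H" for n unfolding f_def by (intro scale_mem linear_functional_mem)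
    have f1: "fun_norm ip (f n) \<le> 1" for n
    proof -
      have "fun_norm ip (f n) = fun_norm ip (\<lambda>z. z \<bullet>\<^sub>C s n) / R"
        unfolding f_def fun_norm_scale[OF linear_functional_mem(1)] using R by (simp add: norm_divide)
      also have "\<dots> \<le> R / R"
        using linear_functional_mem(2)[of "s n"] A_le[OF x(1)[of n]] R
        by (intro divide_right_mono) (simp_all add: x(2))
      finally show ?thesis using R by simp
    qed
    obtain g r where g: "g \<in> H" and r: "strict_mono (r :: nat \<Rightarrow> nat)"
      and lim: "(\<lambda>n. fun_norm ip (\<lambda>z. composition_operator \<phi> (f (r n)) z - g z)) \<longlonglongrightarrow> 0"
      using compact f f1 unfolding compact_operator_on_def by blast
    define h where "h n = composition_operator \<phi> (f (r n))" for n
    have h: "h n \<in> H" for n unfolding h_def using compact f unfolding compact_operator_on_def by blast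
    define \<delta> where "\<delta> n = fun_norm ip (\<lambda>z. h n z - g z)" for n
    have \<delta>: "\<delta> \<longlonglongrightarrow> 0" using lim unfolding \<delta>_def h_def .
    \<comment> \<open>Since \<parallel>y\<parallel> \<le> 2, point evaluation at \<open>y\<close>
      has norm at most exp 2, and the evaluation at 0 has norm 1.\<close>
    define Q where "Q = R * (exp 2 + 1)"
    have Q: "0 < Q" using R by (simp add: Q_def add_pos_pos)
    have key: "(dist (s (r m)) (s (r n)))\<^sup>2 \<le> Q * (\<delta> m + \<delta> n)" for m n
    proof -
      define y where "y = x (r m) - x (r n)"
      define D where "D = (\<lambda>z. h m z - h n z)"
      have D: "D \<in> H" unfolding D_def by (rule diff_mem[OF h h])
      have Ay: "A y = s (r m) - s (r n)" by (simp add: y_def clinear_diff[OF clin] x(2))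
      have "norm y \<le> 2" using norm_triangle_ineq4[of "x (r m)" "x (r n)"] x(1)[of "r m"] x(1)[of "r n"]
        by (simp add: y_def)
      then have "(norm y)\<^sup>2 \<le> 2\<^sup>2" by (intro power_mono) auto
      then have E: "exp ((norm y)\<^sup>2 / 2) \<le> exp 2" by simp
      have D_le: "fun_norm ip D \<le> \<delta> m + \<delta> n"
        using fun_norm_triangle_diff[OF h g h, of m n] fun_norm_diff_commute[OF g h, of n]
        by (simp only: D_def \<delta>_def)
      have "D z = (1 / of_real R) * (\<phi> z \<bullet>\<^sub>C A y)" for z
        by (simp add: D_def h_def f_def composition_operator_def Ay cinner_diff_right diff_divide_distrib)
      \<comment> \<open>The difference \<phi> y - \<phi> 0 is \<open>A y\<close>, the very vector
        that defines the functional.\<close>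
      then have "of_real R * (D y - D 0) = A y \<bullet>\<^sub>C A y"
        using R by (simp add: A_def[of y] cinner_diff_left field_simps)
      then have "of_real R * (D y - D 0) = of_real ((norm (A y))\<^sup>2)" by (simp only: cinner_self)
      then have "cmod (of_real R * (D y - D 0)) = (norm (A y))\<^sup>2" by (simp only: norm_of_real abs_power2)
      then have "(norm (A y))\<^sup>2 = R * cmod (D y - D 0)" using R by (simp add: norm_mult)
      also have "\<dots> \<le> R * (cmod (D y) + cmod (D 0))"
        using R by (intro mult_left_mono norm_triangle_ineq4) auto
      also have "\<dots> \<le> R * (fun_norm ip D * exp 2 + fun_norm ip D * 1)"
        using R exp_point_bound[OF D, of 0]
          order_trans[OF exp_point_bound[OF D] mult_left_mono[OF E fun_norm_nonneg[OF D]]]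
        by (intro mult_left_mono add_mono) simp_all
      also have "\<dots> = Q * fun_norm ip D" by (simp add: Q_def algebra_simps)
      also have "\<dots> \<le> Q * (\<delta> m + \<delta> n)" using Q D_le by (intro mult_left_mono) auto
      finally show ?thesis by (simp add: Ay dist_norm)
    qed
    have "Cauchy (s \<circ> r)"
    proof (rule metric_CauchyI)
      fix e :: real assume e: "0 < e"
      then have "0 < e\<^sup>2 / (2 * Q)" using Q by simp
      from order_tendstoD(2)[OF \<delta> this] obtain M where M: "\<And>n. n \<ge> M \<Longrightarrow> \<delta> n < e\<^sup>2 / (2 * Q)"
        unfolding eventually_sequentially by blast
      have "dist ((s \<circ> r) m) ((s \<circ> r) n) < e" if "m \<ge> M" "n \<ge> M" for m n
      proof (rule power2_less_imp_less)
        have "Q * (\<delta> m + \<delta> n) < Q * (e\<^sup>2 / (2 * Q) + e\<^sup>2 / (2 * Q))"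
          using M[OF that(1)] M[OF that(2)] Q by (intro mult_strict_left_mono add_strict_mono)
        also have "\<dots> = e\<^sup>2" using Q by simp
        finally show "(dist ((s \<circ> r) m) ((s \<circ> r) n))\<^sup>2 < e\<^sup>2"
          using key[of m n] by simp
      qed (use e in simp)
      then show "\<exists>M. \<forall>m\<ge>M. \<forall>n\<ge>M. dist ((s \<circ> r) m) ((s \<circ> r) n) < e" by blast
    qed
    with r show "\<exists>r :: nat \<Rightarrow> nat. strict_mono r \<and> Cauchy (s \<circ> r)" by blast
  qed
  with clin show ?thesis by (simp add: compact_operator_def A_def[abs_def])
qed

end

end

theorem theorem1p4:
  fixes \<phi> :: "'a::chilbert_space \<Rightarrow> 'a"
    and H :: "('a \<Rightarrow> complex) set"
    and ip :: "('a \<Rightarrow> complex) \<Rightarrow> ('a \<Rightarrow> complex) \<Rightarrow> complex"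
  assumes "segal_bargmann H ip"
  shows "compact_operator_on H ip (composition_operator \<phi>) \<longleftrightarrow>
    (\<exists>A b. compact_operator A \<and> onorm A < 1 \<and> (\<forall>z. \<phi> z = A z + b))"
proof
  assume compact: "compact_operator_on H ip (composition_operator \<phi>)"
  have "\<phi> z = (\<phi> z - \<phi> 0) + \<phi> 0" for z by simp
  with segal_bargmann.compact_composition_compact_linear_part[OF assms compact]
    segal_bargmann.compact_composition_onorm_less[OF assms compact]
  show "\<exists>A b. compact_operator A \<and> onorm A < 1 \<and> (\<forall>z. \<phi> z = A z + b)" by blast
next
  assume "\<exists>A b. compact_operator A \<and> onorm A < 1 \<and> (\<forall>z. \<phi> z = A z + b)"
  then show "compact_operator_on H ip (composition_operator \<phi>)"
    using segal_bargmann.compact_composition_affine[OF assms] by blast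
qed

end
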